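(* For all sufficiently large $V>0$, the non-wandering set $\Omega_V$ of the diffeomorphism $T_V : S_V \to S_V$ is a locally maximal hyperbolic set that is homeomorphic to a Cantor set.
   Context: The trace map $T:\mathbb{R}^3\to\mathbb{R}^3$ is $T(x,y,z) = (x(y^2-1)-zy,\; xy-z,\; y)$; it is invertible with polynomial inverse $T^{-1}(x,y,z)=(yz-x,\; z,\; y(z^2-1)-xz)$. For $V>0$, $T$ preserves the cubic surface $S_V=\{(x,y,z)\in\mathbb{R}^3 : x^2+y^2+z^2-xyz=4+V^2\}$, and $T_V := T|_{S_V}$. An invariant closed set $\Omega$ of a diffeomorphism $f:M\to M$ is hyperbolic if at every point $x\in\Omega$ there is a splitting $T_xM=E^u_x\oplus E^s_x$ of the tangent space, invariant under $Df$, such that $Df$ exponentially contracts vectors from the stable subspaces $E^s_x$ and exponentially expands vectors from the unstable subspaces $E^u_x$. A hyperbolic set $\Omega$ is locally maximal if there is a neighborhood $U(\Omega)$ with $\Omega=\bigcap_{n\in\mathbb{Z}} f^n(U(\Omega))$. *)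

theory Defs
  imports "HOL-Analysis.Analysis"
begin

section \<open>Discrete dynamics on embedded manifolds\<close>

text \<open>
  A submanifold of a Euclidean space is represented by its carrier set \<open>M\<close>, with the subspace
  topology. A diffeomorphism of \<open>M\<close> is represented by a map \<open>f\<close> of the ambient space that is
  differentiable at all points of \<open>M\<close> and satisfies \<open>bij_betw f M M\<close>; its derivative as a map
  of \<open>M\<close> is the restriction of the ambient derivative to the tangent spaces of \<open>M\<close>.
\<close>

text \<open>Tangent vectors are the velocities of curves in \<open>M\<close>.\<close>

definition tangent_space :: "'a::euclidean_space set \<Rightarrow> 'a \<Rightarrow> 'a set" where
  "tangent_space M p =
     {v. \<exists>\<gamma> \<epsilon>. \<epsilon> > 0 \<and> (\<forall>t\<in>{-\<epsilon><..<\<epsilon>}. \<gamma> t \<in> M) \<and> \<gamma> C1_differentiable_on {-\<epsilon><..<\<epsilon>} \<and>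
              \<gamma> (0::real) = p \<and> (\<gamma> has_vector_derivative v) (at 0)}"

definition nonwandering_set :: "'a::topological_space set \<Rightarrow> ('a \<Rightarrow> 'a) \<Rightarrow> 'a set" where
  "nonwandering_set M f =
     {p \<in> M. \<forall>U. openin (top_of_set M) U \<and> p \<in> U \<longrightarrow> (\<exists>n\<ge>1. (f ^^ n) ` U \<inter> U \<noteq> {})}"

text \<open>
  The splitting is into arbitrary subspaces, one pair for each point; the constants of contraction
  and expansion are uniform over \<open>\<Omega>\<close>.
\<close>

definition hyperbolic_set :: "'a::euclidean_space set \<Rightarrow> ('a \<Rightarrow> 'a) \<Rightarrow> 'a set \<Rightarrow> bool" where
  "hyperbolic_set M f \<Omega> \<longleftrightarrow>
     closedin (top_of_set M) \<Omega> \<and> f ` \<Omega> = \<Omega> \<and>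
     (\<exists>Eu Es.
        (\<forall>p\<in>\<Omega>. subspace (Eu p) \<and> subspace (Es p) \<and>
               Eu p \<inter> Es p = {0} \<and> {u + s |u s. u \<in> Eu p \<and> s \<in> Es p} = tangent_space M p \<and>
               frechet_derivative f (at p) ` Eu p = Eu (f p) \<and>
               frechet_derivative f (at p) ` Es p = Es (f p)) \<and>
        (\<exists>C>0. \<exists>\<mu>>1. \<forall>p\<in>\<Omega>. \<forall>n.
           (\<forall>v\<in>Es p. norm (frechet_derivative (f ^^ n) (at p) v) \<le> C / \<mu> ^ n * norm v) \<and>
           (\<forall>v\<in>Eu p. norm (frechet_derivative (f ^^ n) (at p) v) \<ge> \<mu> ^ n / C * norm v)))"

definition iterate_on :: "'a set \<Rightarrow> ('a \<Rightarrow> 'a) \<Rightarrow> int \<Rightarrow> 'a \<Rightarrow> 'a" where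
  "iterate_on M f k = (if k \<ge> 0 then f ^^ nat k else inv_into M f ^^ nat (- k))"

definition locally_maximal :: "'a::topological_space set \<Rightarrow> ('a \<Rightarrow> 'a) \<Rightarrow> 'a set \<Rightarrow> bool" where
  "locally_maximal M f \<Omega> \<longleftrightarrow>
     (\<exists>U. openin (top_of_set M) U \<and> \<Omega> \<subseteq> U \<and> \<Omega> = (\<Inter>k. iterate_on M f k ` U))"


section \<open>The middle-thirds Cantor set\<close>

primrec cantor_stage :: "nat \<Rightarrow> real set" where
  "cantor_stage 0 = {0..1}"
| "cantor_stage (Suc n) = (\<lambda>x. x / 3) ` cantor_stage n \<union> (\<lambda>x. (x + 2) / 3) ` cantor_stage n"

definition cantor_set :: "real set" where
  "cantor_set = (\<Inter>n. cantor_stage n)"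


section \<open>The trace map and its invariant surfaces\<close>

definition trace_map :: "real \<times> real \<times> real \<Rightarrow> real \<times> real \<times> real" where
  "trace_map = (\<lambda>(x, y, z). (x * (y\<^sup>2 - 1) - z * y, x * y - z, y))"

definition trace_map_inv :: "real \<times> real \<times> real \<Rightarrow> real \<times> real \<times> real" where
  "trace_map_inv = (\<lambda>(x, y, z). (y * z - x, z, y * (z\<^sup>2 - 1) - x * z))"

definition trace_surface :: "real \<Rightarrow> (real \<times> real \<times> real) set" where
  "trace_surface V = {(x, y, z). x\<^sup>2 + y\<^sup>2 + z\<^sup>2 - x * y * z = 4 + V\<^sup>2}"

lemma trace_map_inv_trace_map [simp]: "trace_map_inv (trace_map p) = p"
  by (cases p) (simp add: trace_map_def trace_map_inv_def algebra_simps power2_eq_square)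

lemma trace_map_trace_map_inv [simp]: "trace_map (trace_map_inv p) = p"
  by (cases p) (simp add: trace_map_def trace_map_inv_def algebra_simps power2_eq_square)

lemma trace_map_in_trace_surface_iff [simp]:
  "trace_map p \<in> trace_surface V \<longleftrightarrow> p \<in> trace_surface V"
  by (cases p) (simp add: trace_map_def trace_surface_def algebra_simps power2_eq_square)

lemma bij_betw_trace_map: "bij_betw trace_map (trace_surface V) (trace_surface V)"
  by (rule bij_betw_byWitness[where f' = trace_map_inv])
     (auto simp flip: trace_map_in_trace_surface_iff[of "trace_map_inv _"])

lemma trace_map_differentiable: "trace_map differentiable (at p)"
proof -
  have "((\<lambda>q. (fst q * ((fst (snd q))\<^sup>2 - 1) - snd (snd q) * fst (snd q),
              fst q * fst (snd q) - snd (snd q), fst (snd q)))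
         has_derivative
         (\<lambda>h. (fst h * ((fst (snd p))\<^sup>2 - 1) + fst p * (2 * fst (snd p) * fst (snd h))
                - (snd (snd h) * fst (snd p) + snd (snd p) * fst (snd h)),
              fst h * fst (snd p) + fst p * fst (snd h) - snd (snd h), fst (snd h)))) (at p)"
    by (auto intro!: derivative_eq_intros simp: algebra_simps)
  then show ?thesis
    by (auto simp: trace_map_def differentiable_def case_prod_beta')
qed

end

(*
  Along an orbit write y_n for the second coordinate; the third is y_(n-1), and the first satisfies
  x_n y_n = y_(n+1) + y_(n-1) and x_n + x_(n+1) = y_n y_(n+1). If both factors of one of these products
  exceed 3 in absolute value, then one of the two summands is so large that the orbit grows geometrically
  in the future or in the past, and its points wander. The remaining "tame"
  orbits stay bounded, and for large V the surface equation pins them to finitely many small boxes; their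
  itineraries form a topologically transitive subshift of finite type. Every admissible itinerary is
  realised, because curves crossing a box are stretched across all its successors (intermediate value
  theorem and compactness). It is realised only once, because differences of orbits, like tangent
  vectors, satisfy a three-term inequality 3 g_n <= g_(n-1) + g_(n+1), and a bounded solution of it on
  the integers vanishes. The same inequality forces tangent vectors bounded in the future to halve in
  each step, and those bounded in the past to double: this is the hyperbolic splitting.
*)

theory Submission
  imports Defs
begin

text \<open>The threshold 3 leaves room on both sides. A factor above 3 turns
  \<open>d + c = a * b\<close> into growth by 3 - 1 = 2, while on tame orbits every
  \<open>y n\<close> is either at most 3/2 or within 1 of \<open>V\<close> in absolute value. This
  gap makes "large" unambiguous and lets weak closed conditions be upgraded to sharp ones.

  The bands come from one polynomial. If \<open>y (n - 1)\<close> is large and t =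
  \<open>y n\<close>, then to leading order \<open>y (n + 1)\<close> is y(n-1) (t^2 - 1),
  \<open>x (n + 1)\<close> is y(n-1) t (t^2 - 2), and \<open>y (n + 2)\<close> is y(n-1)^2 t (t^2 -
  1) (t^2 - 2). Tameness forces t towards a root.

  The obstacle to the three-term inequality sits next to large indices. There the displacement of
  \<open>y\<close> is much smaller than at the neighbours, so it cannot bound them; small indices
  are compared across the large one, and the hole is filled by an average.

  No cone field is constructed. The stable and unstable spaces are defined by boundedness, which
  makes them invariant subspaces at once. They are nonzero by compactness of the unit sphere: a
  tangent vector that vanishes at a late time must decrease until then. The tangent plane has
  dimension 2, so two independent lines span it.\<close>

section \<open>Brouwer's characterisation of the Cantor set\<close>

text \<open>Each clopen cell is cut by \<open>D n\<close> if possible, and otherwise by any \<open>D k\<close> that splits it; one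
  exists because there are no isolated points. So both halves are nonempty, and the cells shrink to
  points because every \<open>D n\<close> is eventually decided.\<close>

context
  fixes X :: "'a::heine_borel set" and D :: "nat \<Rightarrow> 'a set"
  assumes cpt: "compact X"
    and op: "\<And>k. openin (top_of_set X) (X \<inter> D k)"
    and cl: "\<And>k. openin (top_of_set X) (X - D k)"
    and sep: "\<And>x y. x \<in> X \<Longrightarrow> y \<in> X \<Longrightarrow> x \<noteq> y \<Longrightarrow> \<exists>k. (x \<in> D k) \<noteq> (y \<in> D k)"
    and perf: "\<And>U x. openin (top_of_set X) U \<Longrightarrow> x \<in> U \<Longrightarrow> \<exists>y\<in>U. y \<noteq> x"
    and ne: "X \<noteq> {}"
begin

private definition splits :: "'a set \<Rightarrow> nat \<Rightarrow> bool" where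
  "splits C k \<longleftrightarrow> C \<inter> D k \<noteq> {} \<and> C - D k \<noteq> {}"

private definition cutter :: "nat \<Rightarrow> 'a set \<Rightarrow> 'a set" where
  "cutter n C = D (if splits C n then n else (SOME k. splits C k))"

private primrec cell :: "(nat \<Rightarrow> bool) \<Rightarrow> nat \<Rightarrow> 'a set" where
  "cell b 0 = X"
| "cell b (Suc n) = (if b n then cell b n \<inter> cutter n (cell b n) else cell b n - cutter n (cell b n))"

private lemma cell_antimono: "m \<le> n \<Longrightarrow> cell b n \<subseteq> cell b m"
  by (rule lift_Suc_antimono_le[where f="cell b"]) auto

private lemma cell_subset: "cell b n \<subseteq> X"
  using cell_antimono[of 0 n b] by simp

private lemma openin_cut:
  assumes "openin (top_of_set X) C"
  shows "openin (top_of_set X) (C \<inter> D k)" "openin (top_of_set X) (C - D k)"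
proof -
  have "C \<subseteq> X" using assms openin_imp_subset by blast
  then have "C \<inter> D k = C \<inter> (X \<inter> D k)" "C - D k = C \<inter> (X - D k)" by auto
  then show "openin (top_of_set X) (C \<inter> D k)" "openin (top_of_set X) (C - D k)"
    using assms op cl by (simp_all only: openin_Int)
qed

private lemma openin_cell: "openin (top_of_set X) (cell b n)"
proof (induction n)
  case (Suc n)
  then show ?case by (simp add: cutter_def openin_cut)
qed simp

private lemma cell_nonempty: "cell b n \<noteq> {}"
proof (induction n)
  case 0 then show ?case by (simp add: ne)
next
  case (Suc n)
  then obtain x where x: "x \<in> cell b n" by blast
  obtain y where y: "y \<in> cell b n" "y \<noteq> x" using perf[OF openin_cell x] by blast
  obtain k where "(x \<in> D k) \<noteq> (y \<in> D k)" using sep x y cell_subset by blast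
  then have "splits (cell b n) k" using x y by (auto simp: splits_def)
  then have "splits (cell b n) (SOME k. splits (cell b n) k)" by (rule someI)
  then have "\<exists>k. cutter n (cell b n) = D k \<and> splits (cell b n) k"
    by (auto simp: cutter_def)
  then show ?case by (auto simp: splits_def)
qed

private lemma closed_cell: "closed (cell b n)"
proof -
  have "closedin (top_of_set X) (cell b n)"
  proof (induction n)
    case (Suc n)
    have *: "closedin (top_of_set X) (C \<inter> D k)" "closedin (top_of_set X) (C - D k)"
      if "closedin (top_of_set X) C" for C k
    proof -
      have "C \<subseteq> X" using that closedin_imp_subset by blast
      then have "C \<inter> D k = C - (X - D k)" "C - D k = C - (X \<inter> D k)" by auto
      then show "closedin (top_of_set X) (C \<inter> D k)" "closedin (top_of_set X) (C - D k)"
        using that op cl by (simp_all only: closedin_diff)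
    qed
    show ?case using Suc by (simp add: cutter_def *)
  qed simp
  then show ?thesis
    using cpt compact_imp_closed closedin_closed_trans by blast
qed

private lemma cell_cong: "(\<And>i. i < n \<Longrightarrow> b i = c i) \<Longrightarrow> cell b n = cell c n"
  by (induction n) auto

private lemma cell_decides:
  assumes "x \<in> cell b (Suc n)" "y \<in> cell b (Suc n)"
  shows "(x \<in> D n) = (y \<in> D n)"
  using assms by (auto simp: cutter_def splits_def split: if_splits)

text \<open>Bit \<open>n\<close> of the code of \<open>x\<close> depends on the cell chosen by the
  earlier bits. Following the cells of \<open>x\<close> directly avoids this circular definition;
  \<open>cell_of_code\<close> identifies the two descriptions afterwards.\<close>

private primrec cell_of :: "'a \<Rightarrow> nat \<Rightarrow> 'a set" where
  "cell_of x 0 = X"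
| "cell_of x (Suc n) = (if x \<in> cutter n (cell_of x n) then cell_of x n \<inter> cutter n (cell_of x n)
     else cell_of x n - cutter n (cell_of x n))"

private definition code :: "'a \<Rightarrow> nat \<Rightarrow> bool" where
  "code x n \<longleftrightarrow> x \<in> cutter n (cell_of x n)"

private lemma cell_of_code: "cell (code x) n = cell_of x n"
  by (induction n) (auto simp: code_def)

private lemma mem_cell_code: "x \<in> X \<Longrightarrow> x \<in> cell (code x) n"
  by (induction n) (auto simp: code_def cell_of_code)

private lemma code_unique:
  assumes "\<And>n. x \<in> cell b n" shows "code x = b"
proof
  fix n show "code x n = b n"
  proof (induction n rule: less_induct)
    case (less n)
    then have "cell (code x) n = cell b n" by (intro cell_cong) auto
    then show ?case using assms[of "Suc n"] by (auto simp: code_def simp flip: cell_of_code split: if_splits)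
  qed
qed

text \<open>This is the continuity of the coding: the cell of depth \<open>Suc n\<close> around
  \<open>x\<close> is open, and every bit up to \<open>n\<close> is constant on it.\<close>

private lemma code_cell:
  assumes "x \<in> X" "y \<in> cell (code x) (Suc n)" shows "code y n = code x n"
proof -
  have "y \<in> X" using assms cell_subset by blast
  have "\<forall>i\<le>n. code y i = code x i"
  proof (intro allI impI)
    fix i show "i \<le> n \<Longrightarrow> code y i = code x i"
    proof (induction i rule: less_induct)
      case (less i)
      then have eq: "cell (code y) i = cell (code x) i" by (intro cell_cong) auto
      have "y \<in> cell (code x) (Suc i)" using assms(2) cell_antimono[of "Suc i" "Suc n"] less.prems by blast
      then have "(y \<in> cutter i (cell (code x) i)) = code x i" by (simp split: if_splits)
      then show ?case by (simp add: code_def[of y] eq flip: cell_of_code)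
    qed
  qed
  then show ?thesis by simp
qed

text \<open>The target is the product of countably many copies of {0, 1}, placed inside the
  real-valued functions on the naturals. A continuous bijection from a compact space suffices;
  surjectivity is the nonempty intersection of nested compact cells.\<close>

lemma homeomorphic_binary_sequences:
  "X homeomorphic range (\<lambda>b (n::nat). of_bool (b n) :: real)"
proof (rule homeomorphic_compact[OF cpt, where f = "\<lambda>x n. of_bool (code x n)"])
  show "continuous_on X (\<lambda>x n. of_bool (code x n) :: real)"
  proof (rule continuous_on_coordinatewise_then_product)
    fix n
    have "continuous_on X (\<lambda>x. code x n)"
      unfolding continuous_on_topological
    proof (intro ballI allI impI)
      fix x B assume x: "x \<in> X" and B: "open B" "code x n \<in> B"
      obtain A where A: "open A" "cell (code x) (Suc n) = X \<inter> A"
        using openin_cell[of "code x" "Suc n"] unfolding openin_open by blast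
      show "\<exists>A. open A \<and> x \<in> A \<and> (\<forall>y\<in>X. y \<in> A \<longrightarrow> code y n \<in> B)"
      proof (intro exI conjI ballI impI)
        show "open A" by fact
        show "x \<in> A" using A(2) mem_cell_code[OF x, of "Suc n"] by blast
        fix y assume "y \<in> X" "y \<in> A"
        then have "y \<in> cell (code x) (Suc n)" unfolding A(2) by blast
        then show "code y n \<in> B" using code_cell[OF x, of y n] B(2) by (simp del: cell.simps)
      qed
    qed
    then have "continuous_on X (of_bool \<circ> (\<lambda>x. code x n) :: _ \<Rightarrow> real)"
      by (rule continuous_on_compose) (rule Topological_Spaces.continuous_on_discrete)
    then show "continuous_on X (\<lambda>x. of_bool (code x n) :: real)"
      by (simp add: o_def)
  qed
  have "inj_on code X"
  proof (rule inj_onI, rule ccontr)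
    fix x y assume *: "x \<in> X" "y \<in> X" "code x = code y" "x \<noteq> y"
    have "(x \<in> D k) = (y \<in> D k)" for k
    proof (rule cell_decides)
      show "x \<in> cell (code x) (Suc k)" by (rule mem_cell_code) fact
      show "y \<in> cell (code x) (Suc k)" unfolding *(3) by (rule mem_cell_code) fact
    qed
    then show False using sep[of x y] * by simp
  qed
  then show "inj_on (\<lambda>x n. of_bool (code x n) :: real) X"
    by (auto simp: inj_on_def fun_eq_iff)
  have "code ` X = UNIV"
  proof (intro equalityI subset_UNIV subsetI)
    fix b :: "nat \<Rightarrow> bool"
    have "compact (cell b n)" for n
      using compact_Int_closed[OF cpt closed_cell[of b n]] cell_subset[of b n] by (simp add: Int_absorb1)
    then have "\<Inter>(range (cell b)) \<noteq> {}"
      by (rule compact_nest) (simp_all add: cell_nonempty cell_antimono del: cell.simps)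
    then obtain x where x: "\<And>n. x \<in> cell b n" by blast
    then have "x \<in> X" using cell_subset by blast
    moreover have "code x = b" using code_unique x by blast
    ultimately show "b \<in> code ` X" by blast
  qed
  then have "(\<lambda>b n. of_bool (b n) :: real) ` code ` X = range (\<lambda>b (n::nat). of_bool (b n))"
    by simp
  then show "(\<lambda>x n. of_bool (code x n) :: real) ` X = range (\<lambda>b (n::nat). of_bool (b n))"
    by (simp add: image_image)
qed

end

section \<open>The middle-thirds set is a space of binary sequences\<close>

lemma cantor_stage_bounds: "cantor_stage n \<subseteq> {0..1}"
  by (induction n) auto

lemma cantor_set_subset_stage: "cantor_set \<subseteq> cantor_stage n"
  by (auto simp: cantor_set_def)

lemma compact_cantor_stage: "compact (cantor_stage n)"
  by (induction n) (auto intro!: compact_Un compact_continuous_image continuous_intros)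

lemma compact_cantor_set: "compact cantor_set"
proof -
  have "closed cantor_set"
    unfolding cantor_set_def by (intro closed_INT ballI compact_imp_closed compact_cantor_stage)
  moreover have "cantor_set = cantor_stage 0 \<inter> cantor_set"
    using cantor_set_subset_stage by blast
  ultimately show ?thesis by (metis compact_Int_closed compact_cantor_stage)
qed

lemma cantor_set_maps:
  assumes "x \<in> cantor_set" shows "x / 3 \<in> cantor_set" "(x + 2) / 3 \<in> cantor_set"
proof -
  have *: "x / 3 \<in> cantor_stage n \<and> (x + 2) / 3 \<in> cantor_stage n" for n
    using assms by (cases n) (auto simp: cantor_set_def image_iff dest: spec[of _ 0])
  show "x / 3 \<in> cantor_set" "(x + 2) / 3 \<in> cantor_set"
    using * by (auto simp: cantor_set_def)
qed

text \<open>Since 1/2 lies in the removed gap, comparison with 1/2 decides the branch once for all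
  stages, so a single preimage lies in every stage.\<close>

lemma cantor_set_cases:
  assumes "x \<in> cantor_set"
  obtains y where "y \<in> cantor_set" "x = y / 3" | y where "y \<in> cantor_set" "x = (y + 2) / 3"
proof (cases "x \<le> 1/2")
  case True
  have "3 * x \<in> cantor_stage n" for n
  proof -
    have "x \<in> cantor_stage (Suc n)" using assms cantor_set_subset_stage by blast
    then obtain s where s: "s \<in> cantor_stage n" "x = s / 3 \<or> x = (s + 2) / 3" by auto
    moreover have "s \<ge> 0" using cantor_stage_bounds s by fastforce
    ultimately show ?thesis using True by (auto simp: mult.commute)
  qed
  then show ?thesis using that(1)[of "3 * x"] by (auto simp: cantor_set_def)
next
  case False
  have "3 * x - 2 \<in> cantor_stage n" for n
  proof -
    have "x \<in> cantor_stage (Suc n)" using assms cantor_set_subset_stage by blast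
    then obtain s where s: "s \<in> cantor_stage n" "x = s / 3 \<or> x = (s + 2) / 3" by auto
    moreover have "s \<le> 1" using cantor_stage_bounds s by fastforce
    ultimately show ?thesis using False by (auto simp: mult.commute)
  qed
  then show ?thesis using that(2)[of "3 * x - 2"] by (auto simp: cantor_set_def)
qed

lemma zero_one_cantor_set: "0 \<in> cantor_set" "1 \<in> cantor_set"
proof -
  have "0 \<in> cantor_stage n \<and> 1 \<in> cantor_stage n" for n
    by (induction n) (auto simp: image_iff)
  then show "0 \<in> cantor_set" "1 \<in> cantor_set" by (auto simp: cantor_set_def)
qed

text \<open>Self-similarity: a neighbour of \<open>z\<close> at distance d yields one of its image
  at distance d/3. At stage 0 an endpoint of the unit interval serves as the neighbour.\<close>

lemma cantor_set_not_isolated: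
  assumes "x \<in> cantor_set"
  shows "\<exists>y\<in>cantor_set. y \<noteq> x \<and> \<bar>y - x\<bar> \<le> 1 / 3 ^ n"
  using assms
proof (induction n arbitrary: x)
  case 0
  have "x \<in> {0..1}" using 0 cantor_set_subset_stage[of 0] by auto
  then show ?case using zero_one_cantor_set by (cases "x = 0") auto
next
  case (Suc n)
  from Suc.prems show ?case
  proof (cases rule: cantor_set_cases)
    case (1 z)
    with Suc.IH obtain y where "y \<in> cantor_set" "y \<noteq> z" "\<bar>y - z\<bar> \<le> 1 / 3 ^ n" by blast
    then show ?thesis using 1 cantor_set_maps(1)[of y]
      by (intro bexI[of _ "y / 3"]) (auto simp: field_simps)
  next
    case (2 z)
    with Suc.IH obtain y where "y \<in> cantor_set" "y \<noteq> z" "\<bar>y - z\<bar> \<le> 1 / 3 ^ n" by blast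
    then show ?thesis using 2 cantor_set_maps(2)[of y]
      by (intro bexI[of _ "(y + 2) / 3"]) (auto simp: field_simps)
  qed
qed

text \<open>An interval inside a stage avoids 1/2 and hence lies in one outer third; rescaling by 3
  lands in the previous stage.\<close>

lemma interval_subset_cantor_stage:
  assumes "a \<le> b" "{a..b} \<subseteq> cantor_stage n" shows "b - a \<le> 1 / 3 ^ n"
  using assms
proof (induction n arbitrary: a b)
  case (Suc n)
  have half: "1/2 \<notin> cantor_stage (Suc n)"
    using cantor_stage_bounds[of n] by auto
  have *: "{3 * a - 2..3 * b - 2} \<subseteq> cantor_stage n \<or> {3 * a..3 * b} \<subseteq> cantor_stage n"
  proof (cases "b < 1/2")
    case True
    have "t \<in> cantor_stage n" if "t \<in> {3 * a..3 * b}" for t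
    proof -
      have "t / 3 \<in> {a..b}" using that by auto
      then have "t / 3 \<in> cantor_stage (Suc n)" using Suc.prems(2) by blast
      then obtain s where s: "s \<in> cantor_stage n" "t / 3 = s / 3 \<or> t / 3 = (s + 2) / 3" by auto
      moreover have "s \<ge> 0" using cantor_stage_bounds s by fastforce
      moreover have "t < 3/2" using that True by auto
      ultimately show ?thesis by auto
    qed
    then show ?thesis by blast
  next
    case False
    have "1/2 \<notin> {a..b}" using half Suc.prems(2) by blast
    then have "a > 1/2" using False by auto
    have "t \<in> cantor_stage n" if "t \<in> {3 * a - 2..3 * b - 2}" for t
    proof -
      have "(t + 2) / 3 \<in> {a..b}" using that by auto
      then have "(t + 2) / 3 \<in> cantor_stage (Suc n)" using Suc.prems(2) by blast
      then obtain s where s: "s \<in> cantor_stage n" "(t + 2) / 3 = s / 3 \<or> (t + 2) / 3 = (s + 2) / 3"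
        by auto
      moreover have "s \<le> 1" using cantor_stage_bounds s by fastforce
      moreover have "t > - 1/2" using that \<open>a > 1/2\<close> by auto
      ultimately show ?thesis by auto
    qed
    then show ?thesis by blast
  qed
  then have "3 * b - 3 * a \<le> 1 / 3 ^ n"
    using Suc.IH[of "3 * a - 2" "3 * b - 2"] Suc.IH[of "3 * a" "3 * b"] Suc.prems(1) by auto
  then show ?case by (auto simp: field_simps)
qed auto

text \<open>Rational cut points outside the set are what makes the separating family countable. The
  middle third of the interval contains a gap point, and gaps are open.\<close>

lemma rational_gap_in_cantor_set:
  fixes a b :: real
  assumes "a < b" shows "\<exists>q::rat. a < of_rat q \<and> of_rat q < b \<and> of_rat q \<notin> cantor_set"
proof -
  define c where "c = (2 * a + b) / 3"
  define d where "d = (a + 2 * b) / 3"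
  have ord: "a < c" "c < d" "d < b" using assms by (auto simp: c_def d_def)
  obtain n where n: "(1/3) ^ n < d - c" using real_arch_pow_inv[of "d - c" "1/3"] ord by auto
  have "\<not> {c..d} \<subseteq> cantor_stage n"
    using interval_subset_cantor_stage[of c d n] n ord by (auto simp: power_one_over)
  then obtain t where t: "t \<in> {c..d}" "t \<notin> cantor_set" using cantor_set_subset_stage by blast
  have "open (- cantor_set \<inter> {a<..<b})"
    using compact_cantor_set compact_imp_closed by (auto intro!: open_Int)
  moreover have "t \<in> - cantor_set \<inter> {a<..<b}" using t ord by auto
  ultimately obtain e where e: "e > 0" "\<And>s. dist s t < e \<Longrightarrow> s \<in> - cantor_set \<inter> {a<..<b}"
    unfolding open_dist by blast
  obtain q where "t < of_rat q" "of_rat q < t + e" using of_rat_dense[of t "t + e"] e(1) by auto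
  then have "of_rat q \<in> - cantor_set \<inter> {a<..<b}" by (intro e(2)) (auto simp: dist_real_def)
  then show ?thesis by auto
qed

lemma cantor_set_homeomorphic_binary_sequences:
  "cantor_set homeomorphic range (\<lambda>b (n::nat). of_bool (b n) :: real)"
proof -
  \<comment> \<open>A half-line is clopen relative to the set only if its endpoint lies in a gap;
    the other rationals get the harmless empty cut.\<close>
  define D where "D k = (let q = of_rat (from_nat k) in if q \<in> cantor_set then {} else {q<..})"
    for k
  show ?thesis
  proof (rule homeomorphic_binary_sequences[of _ D])
    show "compact cantor_set" by (rule compact_cantor_set)
    show "cantor_set \<noteq> {}" using zero_one_cantor_set by blast
    fix k
    show "openin (top_of_set cantor_set) (cantor_set \<inter> D k)"
      by (auto simp: D_def Let_def intro!: openin_open_Int)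
    show "openin (top_of_set cantor_set) (cantor_set - D k)"
    proof (cases "of_rat (from_nat k) \<in> cantor_set")
      case False
      then have "cantor_set - D k = cantor_set \<inter> {..<of_rat (from_nat k)}"
        by (auto simp: D_def Let_def not_less less_le)
      then show ?thesis by (simp add: openin_open_Int)
    qed (simp add: D_def)
  next
    have *: "\<exists>k. (x \<in> D k) \<noteq> (y \<in> D k)" if less: "x < y" for x y
    proof -
      obtain q :: rat where "x < of_rat q" "of_rat q < y" "of_rat q \<notin> cantor_set"
        using rational_gap_in_cantor_set[OF less] by blast
      then have "x \<notin> D (to_nat q)" "y \<in> D (to_nat q)" by (simp_all add: D_def)
      then show ?thesis by blast
    qed
    fix x y :: real assume "x \<noteq> y"
    then consider "x < y" | "y < x" by linarith
    then show "\<exists>k. (x \<in> D k) \<noteq> (y \<in> D k)" by cases (use * in blast)+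
  next
    fix U and x :: real assume U: "openin (top_of_set cantor_set) U" "x \<in> U"
    then obtain e where e: "e > 0" "ball x e \<inter> cantor_set \<subseteq> U"
      using openin_contains_ball by metis
    have x: "x \<in> cantor_set" using U openin_imp_subset by blast
    obtain n where n: "(1/3) ^ n < e" using real_arch_pow_inv[of e "1/3"] e by auto
    obtain y where "y \<in> cantor_set" "y \<noteq> x" "\<bar>y - x\<bar> \<le> 1 / 3 ^ n"
      using cantor_set_not_isolated[OF x] by blast
    then show "\<exists>y\<in>U. y \<noteq> x"
      using e n by (intro bexI[of _ y]) (auto simp: dist_real_def power_one_over subset_iff)
  qed
qed

section \<open>Orbits of the trace map as sequences\<close>

text \<open>Kept generic in a map and its inverse because it serves twice: for the trace map on
  points, and for its tangent map on pairs of a point and a vector.\<close>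

definition zpow :: "('a \<Rightarrow> 'a) \<Rightarrow> ('a \<Rightarrow> 'a) \<Rightarrow> int \<Rightarrow> 'a \<Rightarrow> 'a" where
  "zpow f g k = (if k \<ge> 0 then f ^^ nat k else g ^^ nat (- k))"

lemma zpow_0 [simp]: "zpow f g 0 p = p"
  by (simp add: zpow_def)

lemma zpow_of_nat: "zpow f g (int n) = f ^^ n"
  by (simp add: zpow_def)

lemma zpow_minus: "zpow f g (- k) = zpow g f k"
  by (auto simp: zpow_def)

lemma zpow_Suc:
  assumes "\<And>p. f (g p) = p"
  shows "zpow f g (k + 1) p = f (zpow f g k p)"
proof (cases "k \<ge> 0")
  case True
  then show ?thesis by (simp add: zpow_def nat_add_distrib)
next
  case False
  then have "nat (- k) = Suc (nat (- (k + 1)))" by linarith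
  then show ?thesis using False assms by (auto simp: zpow_def)
qed

lemma zpow_pred:
  assumes "\<And>p. g (f p) = p"
  shows "zpow f g (k - 1) p = g (zpow f g k p)"
proof -
  have "zpow f g (k - 1) p = zpow g f (- k + 1) p" using zpow_minus[of f g "- k + 1"] by simp
  also have "\<dots> = g (zpow g f (- k) p)" by (rule zpow_Suc) (rule assms)
  finally show ?thesis by (simp add: zpow_minus)
qed

lemma zpow_add:
  assumes "\<And>p. f (g p) = p" "\<And>p. g (f p) = p"
  shows "zpow f g (j + k) p = zpow f g j (zpow f g k p)"
proof (induction j rule: int_induct[where k=0])
  case (step1 i)
  have "zpow f g (i + 1 + k) p = zpow f g (i + k + 1) p" by (simp add: algebra_simps)
  then show ?case using step1 by (simp add: zpow_Suc[of f g, OF assms(1)])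
next
  case (step2 i)
  have "zpow f g (i - 1 + k) p = zpow f g (i + k - 1) p" by (simp add: algebra_simps)
  also have "\<dots> = g (zpow f g (i + k) p)" using assms(2) by (rule zpow_pred)
  finally show ?case using step2 by (simp add: zpow_pred[of g f, OF assms(2)])
qed simp

abbreviation tz :: "int \<Rightarrow> real \<times> real \<times> real \<Rightarrow> real \<times> real \<times> real" where
  "tz \<equiv> zpow trace_map trace_map_inv"

lemmas tz_Suc = zpow_Suc[of trace_map trace_map_inv, OF trace_map_trace_map_inv]
lemmas tz_pred = zpow_pred[of trace_map_inv trace_map, OF trace_map_inv_trace_map]
lemmas tz_add = zpow_add[of trace_map trace_map_inv, OF trace_map_trace_map_inv trace_map_inv_trace_map]

definition xs :: "real \<times> real \<times> real \<Rightarrow> int \<Rightarrow> real" where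
  "xs p n = fst (tz n p)"

definition ys :: "real \<times> real \<times> real \<Rightarrow> int \<Rightarrow> real" where
  "ys p n = fst (snd (tz n p))"

lemma tz_eq: "tz n p = (xs p n, ys p n, ys p (n - 1))"
proof -
  have "tz n p = trace_map (tz (n - 1) p)" using tz_Suc[of "n - 1" p] by simp
  then show ?thesis
    by (cases "tz (n - 1) p") (simp add: xs_def ys_def trace_map_def)
qed

lemma seq_tz: "xs (tz k p) n = xs p (n + k)" "ys (tz k p) n = ys p (n + k)"
  by (simp_all add: xs_def ys_def tz_add)

lemma tz_in_surface_iff [simp]: "tz k p \<in> trace_surface V \<longleftrightarrow> p \<in> trace_surface V"
proof (induction k rule: int_induct[where k=0])
  case (step2 i)
  then show ?case using trace_map_in_trace_surface_iff[of "trace_map_inv (tz i p)" V]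
    by (simp add: tz_pred)
qed (simp_all add: tz_Suc)

lemma continuous_trace_map: "continuous_on S trace_map"
  by (auto simp: trace_map_def case_prod_beta' intro!: continuous_intros)

lemma continuous_trace_map_inv: "continuous_on S trace_map_inv"
  by (auto simp: trace_map_inv_def case_prod_beta' intro!: continuous_intros)

lemma continuous_tz: "continuous_on S (tz k)"
proof (induction k rule: int_induct[where k=0])
  case base
  have "tz 0 = (\<lambda>p. p)" by auto
  then show ?case by (simp add: continuous_on_id)
next
  case (step1 i)
  have "tz (i + 1) = trace_map \<circ> tz i" by (auto simp: tz_Suc)
  then show ?case using step1 by (simp only: continuous_on_compose continuous_trace_map)
next
  case (step2 i)
  have "tz (i - 1) = trace_map_inv \<circ> tz i" by (auto simp: tz_pred)
  then show ?case using step2 by (simp only: continuous_on_compose continuous_trace_map_inv)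
qed

lemma continuous_xs: "continuous_on S (\<lambda>p. xs p k)"
  unfolding xs_def by (intro continuous_intros continuous_tz)

lemma continuous_ys: "continuous_on S (\<lambda>p. ys p k)"
  unfolding ys_def by (intro continuous_intros continuous_tz)

definition surf :: "real \<Rightarrow> real \<Rightarrow> real \<Rightarrow> real \<Rightarrow> bool" where
  "surf V x y z \<longleftrightarrow> x\<^sup>2 + y\<^sup>2 + z\<^sup>2 - x * y * z = 4 + V\<^sup>2"

lemma trace_surface_iff: "(x, y, z) \<in> trace_surface V \<longleftrightarrow> surf V x y z"
  by (simp add: surf_def trace_surface_def)

text \<open>The \<open>n\<close>-th point of the orbit is \<open>(x n, y n, y (n - 1))\<close>; in these coordinates time reversal
  is \<open>n \<mapsto> - n\<close>.\<close>

lemma surf_flip: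
  assumes "surf V x y z" "z' + z = x * y" shows "surf V x y z'"
proof -
  have "z = x * y - z'" using assms(2) by simp
  with assms(1) show ?thesis by (simp add: surf_def algebra_simps power2_eq_square)
qed

definition orbit :: "real \<Rightarrow> (int \<Rightarrow> real) \<Rightarrow> (int \<Rightarrow> real) \<Rightarrow> bool" where
  "orbit V x y \<longleftrightarrow> (\<forall>n. y (n + 1) + y (n - 1) = x n * y n \<and> x (n + 1) + x n = y n * y (n + 1) \<and>
     surf V (x n) (y n) (y (n - 1)))"

lemma orbit_xs_ys:
  assumes "p \<in> trace_surface V" shows "orbit V (xs p) (ys p)"
  unfolding orbit_def
proof (intro allI conjI)
  fix n
  have "(xs p (n + 1), ys p (n + 1), ys p n) = trace_map (xs p n, ys p n, ys p (n - 1))"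
    using tz_Suc[of n p] by (simp add: tz_eq[of "n + 1"] tz_eq[of n])
  then have y: "ys p (n + 1) = xs p n * ys p n - ys p (n - 1)"
    and x: "xs p (n + 1) = xs p n * ((ys p n)\<^sup>2 - 1) - ys p (n - 1) * ys p n"
    by (simp_all add: trace_map_def)
  show "ys p (n + 1) + ys p (n - 1) = xs p n * ys p n" using y by simp
  show "xs p (n + 1) + xs p n = ys p n * ys p (n + 1)"
    unfolding x y by (simp add: algebra_simps power2_eq_square)
  have "tz n p \<in> trace_surface V" using assms by simp
  then show "surf V (xs p n) (ys p n) (ys p (n - 1))"
    by (simp add: tz_eq trace_surface_iff)
qed

text \<open>The last two facts are the mirror images of the second and third under n -> -n, and thus
  what \<open>orbit_reverse\<close> needs. \<open>surf_flip\<close> is the Vieta involution: it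
  exchanges the two roots of the surface equation in its last variable.\<close>

lemma orbitD:
  assumes "orbit V x y"
  shows "y (n + 1) + y (n - 1) = x n * y n" "x (n + 1) + x n = y n * y (n + 1)"
    "surf V (x n) (y n) (y (n - 1))" "x n + x (n - 1) = y (n - 1) * y n"
    "surf V (x n) (y n) (y (n + 1))"
proof -
  show *: "y (n + 1) + y (n - 1) = x n * y n" "x (n + 1) + x n = y n * y (n + 1)"
    "surf V (x n) (y n) (y (n - 1))" using assms by (auto simp: orbit_def)
  have "x (n - 1 + 1) + x (n - 1) = y (n - 1) * y (n - 1 + 1)" using assms unfolding orbit_def by blast
  then show "x n + x (n - 1) = y (n - 1) * y n" by simp
  show "surf V (x n) (y n) (y (n + 1))" using surf_flip[OF *(3) *(1)] .
qed

lemma orbit_reverse: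
  assumes "orbit V x y" shows "orbit V (\<lambda>n. x (- n)) (\<lambda>n. y (- n))"
  unfolding orbit_def
proof (intro allI conjI)
  fix n
  show "y (- (n + 1)) + y (- (n - 1)) = x (- n) * y (- n)"
    using orbitD(1)[OF assms, of "- n"] by (simp add: minus_diff_commute add.commute)
  show "x (- (n + 1)) + x (- n) = y (- n) * y (- (n + 1))"
    using orbitD(4)[OF assms, of "- n"] by (simp add: minus_diff_commute add.commute mult.commute)
  show "surf V (x (- n)) (y (- n)) (y (- (n - 1)))"
    using orbitD(5)[OF assms, of "- n"] by (simp add: algebra_simps)
qed

section \<open>Escaping orbits\<close>

text \<open>The pairs are the factors of the two products in the recursion. The remaining pair
  \<open>x n\<close>, \<open>y (n - 1)\<close> must stay free: both are large in the states
  \<open>ZL s j\<close> with j nonzero.\<close>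

definition tame :: "(int \<Rightarrow> real) \<Rightarrow> (int \<Rightarrow> real) \<Rightarrow> bool" where
  "tame x y \<longleftrightarrow> (\<forall>n. (\<bar>x n\<bar> \<le> 3 \<or> \<bar>y n\<bar> \<le> 3) \<and> (\<bar>y n\<bar> \<le> 3 \<or> \<bar>y (n - 1)\<bar> \<le> 3))"

text \<open>The arguments are listed in increasing order of size. With \<open>y (n - 1)\<close> in
  the first place this is escape to the future, with \<open>y (n + 1)\<close> escape to the
  past.\<close>

definition growing :: "real \<Rightarrow> real \<Rightarrow> real \<Rightarrow> bool" where
  "growing z y x \<longleftrightarrow> 3 < \<bar>z\<bar> \<and> \<bar>z\<bar> < \<bar>y\<bar> \<and> \<bar>y\<bar> < \<bar>x\<bar>"

lemma tame_reverse:
  assumes "tame x y" shows "tame (\<lambda>n. x (- n)) (\<lambda>n. y (- n))"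
  unfolding tame_def
proof (intro allI conjI)
  fix n
  show "\<bar>x (- n)\<bar> \<le> 3 \<or> \<bar>y (- n)\<bar> \<le> 3" using assms by (auto simp: tame_def)
  have "\<bar>y (- n + 1)\<bar> \<le> 3 \<or> \<bar>y (- n + 1 - 1)\<bar> \<le> 3" using assms unfolding tame_def by blast
  then show "\<bar>y (- n)\<bar> \<le> 3 \<or> \<bar>y (- (n - 1))\<bar> \<le> 3" by (auto simp: algebra_simps)
qed

lemma double_growth:
  fixes a b c d :: real
  assumes "d + c = a * b" "3 < \<bar>a\<bar>" "\<bar>c\<bar> \<le> \<bar>b\<bar>"
  shows "2 * \<bar>b\<bar> \<le> \<bar>d\<bar>"
proof -
  have "3 * \<bar>b\<bar> \<le> \<bar>a * b\<bar>" using assms(2) by (simp add: abs_mult mult_right_mono)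
  also have "\<dots> \<le> \<bar>d\<bar> + \<bar>c\<bar>" using assms(1) by linarith
  finally show ?thesis using assms(3) by linarith
qed

lemma growing_step:
  assumes "orbit V x y" "growing (y (n - 1)) (y n) (x n)"
  shows "growing (y n) (y (n + 1)) (x (n + 1))" "2 * \<bar>x n\<bar> \<le> \<bar>y (n + 1)\<bar>"
    "2 * \<bar>y (n + 1)\<bar> \<le> \<bar>x (n + 1)\<bar>"
proof -
  have inc: "3 < \<bar>y (n - 1)\<bar>" "\<bar>y (n - 1)\<bar> < \<bar>y n\<bar>" "\<bar>y n\<bar> < \<bar>x n\<bar>"
    using assms(2) by (auto simp: growing_def)
  show 1: "2 * \<bar>x n\<bar> \<le> \<bar>y (n + 1)\<bar>"
    by (rule double_growth[where a = "y n" and c = "y (n - 1)"])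
      (use orbitD(1)[OF assms(1), of n] inc in \<open>auto simp: mult.commute\<close>)
  show 2: "2 * \<bar>y (n + 1)\<bar> \<le> \<bar>x (n + 1)\<bar>"
    by (rule double_growth[where a = "y n" and c = "x n"])
      (use orbitD(2)[OF assms(1), of n] inc 1 in auto)
  show "growing (y n) (y (n + 1)) (x (n + 1))"
    using inc 1 2 by (auto simp: growing_def)
qed

text \<open>The two summands have total size at least three times the larger factor, so one of them
  beats both factors. That summand decides whether the orbit escapes forwards or backwards.\<close>

lemma product_large:
  fixes a b c d :: real
  assumes "d + c = a * b" "3 < \<bar>a\<bar>" "3 < \<bar>b\<bar>"
  shows "(\<bar>a\<bar> < \<bar>d\<bar> \<and> \<bar>b\<bar> < \<bar>d\<bar>) \<or> (\<bar>a\<bar> < \<bar>c\<bar> \<and> \<bar>b\<bar> < \<bar>c\<bar>)"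
proof -
  have "3 * \<bar>b\<bar> \<le> \<bar>a * b\<bar>" "3 * \<bar>a\<bar> \<le> \<bar>a * b\<bar>"
    using assms(2,3) mult_right_mono[of 3 "\<bar>a\<bar>" "\<bar>b\<bar>"] mult_right_mono[of 3 "\<bar>b\<bar>" "\<bar>a\<bar>"]
    by (simp_all add: abs_mult mult.commute)
  moreover have "\<bar>a * b\<bar> \<le> \<bar>d\<bar> + \<bar>c\<bar>" using assms(1) by linarith
  ultimately show ?thesis using assms(2,3) by linarith
qed

lemma growing_from_xy:
  assumes "orbit V x y" "3 < \<bar>y n\<bar>" "\<bar>y n\<bar> < \<bar>y (n + 1)\<bar>" "\<bar>x n\<bar> < \<bar>y (n + 1)\<bar>"
  shows "growing (y n) (y (n + 1)) (x (n + 1))"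
proof -
  have "2 * \<bar>y (n + 1)\<bar> \<le> \<bar>x (n + 1)\<bar>"
    by (rule double_growth[where a = "y n" and c = "x n"])
      (use orbitD(2)[OF assms(1), of n] assms in auto)
  then show ?thesis using assms by (auto simp: growing_def)
qed

lemma growing_from_yy:
  assumes "orbit V x y" "3 < \<bar>y n\<bar>" "\<bar>y n\<bar> < \<bar>x n\<bar>" "\<bar>y (n - 1)\<bar> < \<bar>x n\<bar>"
  shows "growing (y n) (y (n + 1)) (x (n + 1))"
proof (rule growing_from_xy[OF assms(1,2)])
  have "2 * \<bar>x n\<bar> \<le> \<bar>y (n + 1)\<bar>"
    by (rule double_growth[where a = "y n" and c = "y (n - 1)"])
      (use orbitD(1)[OF assms(1), of n] assms in \<open>auto simp: mult.commute\<close>)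
  then show "\<bar>y n\<bar> < \<bar>y (n + 1)\<bar>" "\<bar>x n\<bar> < \<bar>y (n + 1)\<bar>" using assms by linarith+
qed

lemma not_tame_escapes:
  assumes o: "orbit V x y" and "\<not> tame x y"
  shows "\<exists>n. growing (y (n - 1)) (y n) (x n) \<or> growing (y (n + 1)) (y n) (x n)"
proof -
  have o': "orbit V (\<lambda>n. x (- n)) (\<lambda>n. y (- n))" by (rule orbit_reverse[OF o])
  have fwd: ?thesis if "growing (y n) (y (n + 1)) (x (n + 1))" for n
    using that by (intro exI[of _ "n + 1"]) simp
  have bwd: ?thesis if "growing (y (- n)) (y (- (n + 1))) (x (- (n + 1)))" for n
    using that by (intro exI[of _ "- (n + 1)"]) simp
  obtain n where "3 < \<bar>x n\<bar> \<and> 3 < \<bar>y n\<bar> \<or> 3 < \<bar>y n\<bar> \<and> 3 < \<bar>y (n - 1)\<bar>"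
    using assms(2) by (auto simp: tame_def not_le)
  then show ?thesis
  proof
    assume big: "3 < \<bar>x n\<bar> \<and> 3 < \<bar>y n\<bar>"
    from product_large[OF orbitD(1)[OF o, of n]] big
    have "(\<bar>x n\<bar> < \<bar>y (n + 1)\<bar> \<and> \<bar>y n\<bar> < \<bar>y (n + 1)\<bar>) \<or> (\<bar>x n\<bar> < \<bar>y (n - 1)\<bar> \<and> \<bar>y n\<bar> < \<bar>y (n - 1)\<bar>)"
      by blast
    then show ?thesis
    proof
      assume "\<bar>x n\<bar> < \<bar>y (n + 1)\<bar> \<and> \<bar>y n\<bar> < \<bar>y (n + 1)\<bar>"
      then show ?thesis using growing_from_xy[OF o, of n] big fwd[of n] by blast
    next
      assume "\<bar>x n\<bar> < \<bar>y (n - 1)\<bar> \<and> \<bar>y n\<bar> < \<bar>y (n - 1)\<bar>"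
      then show ?thesis using growing_from_xy[OF o', of "- n"] big bwd[of "- n"] by simp
    qed
  next
    assume big: "3 < \<bar>y n\<bar> \<and> 3 < \<bar>y (n - 1)\<bar>"
    from product_large[OF orbitD(4)[OF o, of n]] big
    have "(\<bar>y (n - 1)\<bar> < \<bar>x n\<bar> \<and> \<bar>y n\<bar> < \<bar>x n\<bar>) \<or> (\<bar>y (n - 1)\<bar> < \<bar>x (n - 1)\<bar> \<and> \<bar>y n\<bar> < \<bar>x (n - 1)\<bar>)"
      by blast
    then show ?thesis
    proof
      assume "\<bar>y (n - 1)\<bar> < \<bar>x n\<bar> \<and> \<bar>y n\<bar> < \<bar>x n\<bar>"
      then show ?thesis using growing_from_yy[OF o, of n] big fwd[of n] by blast
    next
      assume "\<bar>y (n - 1)\<bar> < \<bar>x (n - 1)\<bar> \<and> \<bar>y n\<bar> < \<bar>x (n - 1)\<bar>"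
      \<comment> \<open>In reversed time the instant \<open>1 - n\<close> has
        \<open>y (n - 1)\<close> as its current and \<open>y n\<close> as its preceding value, which
        accounts for the shift by one.\<close>
      then show ?thesis using growing_from_yy[OF o', of "1 - n"] big bwd[of "1 - n"] by simp
    qed
  qed
qed

section \<open>The shape of tame orbits\<close>

text \<open>For |y|, |z| at most 3 the surface equation reads x^2 = V^2 up to a constant and a term
  of size at most 9 |x|, so |x| differs from \<open>V\<close> by a bounded amount.\<close>

lemma surf_x_bounds:
  assumes "surf V x y z" "\<bar>y\<bar> \<le> 3" "\<bar>z\<bar> \<le> 3" "V \<ge> 1000"
  shows "V - 10 \<le> \<bar>x\<bar>" "\<bar>x\<bar> \<le> V + 10"
proof -
  have yz: "\<bar>x * y * z\<bar> \<le> 9 * \<bar>x\<bar>"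
  proof -
    have "\<bar>y\<bar> * \<bar>z\<bar> \<le> 3 * 3" using assms by (intro mult_mono) auto
    then have "\<bar>x\<bar> * (\<bar>y\<bar> * \<bar>z\<bar>) \<le> \<bar>x\<bar> * 9" by (intro mult_left_mono) auto
    then show ?thesis by (simp add: abs_mult mult_ac)
  qed
  have sq: "y\<^sup>2 \<le> 9" "z\<^sup>2 \<le> 9" using abs_le_square_iff[of y 3] abs_le_square_iff[of z 3] assms by auto
  have eq: "\<bar>x\<bar>\<^sup>2 = 4 + V\<^sup>2 - y\<^sup>2 - z\<^sup>2 + x * y * z" using assms(1) by (simp add: surf_def)
  show "V - 10 \<le> \<bar>x\<bar>"
  proof (rule ccontr)
    assume "\<not> ?thesis"
    then have "\<bar>x\<bar> * (\<bar>x\<bar> + 9) \<le> (V - 10) * (V - 10 + 9)" by (intro mult_mono) auto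
    then have "\<bar>x\<bar>\<^sup>2 + 9 * \<bar>x\<bar> \<le> V\<^sup>2 - 11 * V + 10" by (simp add: power2_eq_square algebra_simps)
    then show False using eq sq yz assms(4) zero_le_power2[of y] zero_le_power2[of z] by linarith
  qed
  show "\<bar>x\<bar> \<le> V + 10"
  proof (rule ccontr)
    assume "\<not> ?thesis"
    then have "(V + 10) * (V + 10 - 9) \<le> \<bar>x\<bar> * (\<bar>x\<bar> - 9)" using assms by (intro mult_mono) auto
    then have "V\<^sup>2 + 11 * V + 10 \<le> \<bar>x\<bar>\<^sup>2 - 9 * \<bar>x\<bar>" by (simp add: power2_eq_square algebra_simps)
    then show False using eq sq yz assms(4) zero_le_power2[of y] zero_le_power2[of z] by linarith
  qed
qed

text \<open>The bound on \<open>x * y\<close> comes from the recursion, whose left side is a sum of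
  two small values. It makes the cubic term bounded instead of linear in \<open>y\<close>, which
  sharpens the error from 10 to 1 and forces \<open>x\<close> to be tiny.\<close>

lemma surf_y_bounds:
  assumes "surf V x y z" "\<bar>x\<bar> \<le> 3" "\<bar>z\<bar> \<le> 3" "\<bar>x * y\<bar> \<le> 6" "V \<ge> 1000"
  shows "V - 1 \<le> \<bar>y\<bar>" "\<bar>y\<bar> \<le> V + 1" "\<bar>x\<bar> \<le> 1/100"
proof -
  have "\<bar>x * y\<bar> * \<bar>z\<bar> \<le> 6 * 3" using assms by (intro mult_mono) auto
  then have xyz: "\<bar>x * y * z\<bar> \<le> 18" by (simp add: abs_mult)
  have sq: "x\<^sup>2 \<le> 9" "z\<^sup>2 \<le> 9" using abs_le_square_iff[of x 3] abs_le_square_iff[of z 3] assms by auto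
  have eq: "\<bar>y\<bar>\<^sup>2 = 4 + V\<^sup>2 - x\<^sup>2 - z\<^sup>2 + x * y * z" using assms(1) by (simp add: surf_def)
  show 1: "V - 1 \<le> \<bar>y\<bar>"
  proof (rule power2_le_imp_le)
    show "(V - 1)\<^sup>2 \<le> \<bar>y\<bar>\<^sup>2" unfolding eq using xyz sq assms(5)
      by (simp add: power2_diff abs_le_iff)
  qed simp
  show "\<bar>y\<bar> \<le> V + 1"
  proof (rule power2_le_imp_le)
    have "x * y * z \<le> 18" using xyz by linarith
    then show "\<bar>y\<bar>\<^sup>2 \<le> (V + 1)\<^sup>2" unfolding eq using zero_le_power2[of x] zero_le_power2[of z] assms(5)
      unfolding power2_sum one_power2 by linarith
  qed (use assms in simp)
  have "\<bar>x\<bar> * 999 \<le> \<bar>x\<bar> * \<bar>y\<bar>" using 1 assms(5) by (intro mult_left_mono) auto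
  then show "\<bar>x\<bar> \<le> 1/100" using assms(4) by (simp add: abs_mult)
qed

lemma abs_mult_cancel_bounds:
  fixes a b :: real
  assumes "l \<le> \<bar>a * b\<bar>" "\<bar>a * b\<bar> \<le> u" "0 < m" "m \<le> \<bar>a\<bar>" "\<bar>a\<bar> \<le> k" 
  shows "l / k \<le> \<bar>b\<bar>" "\<bar>b\<bar> \<le> u / m"
proof -
  have "m * \<bar>b\<bar> \<le> \<bar>a\<bar> * \<bar>b\<bar>" "\<bar>a\<bar> * \<bar>b\<bar> \<le> k * \<bar>b\<bar>" using assms by (auto intro: mult_right_mono)
  then show "l / k \<le> \<bar>b\<bar>" "\<bar>b\<bar> \<le> u / m"
    using assms by (auto simp: abs_mult divide_le_eq le_divide_eq mult.commute)
qed

locale tame_orbit =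
  fixes V :: real and x y :: "int \<Rightarrow> real"
  assumes V: "V \<ge> 1000" and orbit: "orbit V x y" and tame: "tame x y"
begin

lemmas rec_y = orbitD(1)[OF orbit]
lemmas rec_x = orbitD(2)[OF orbit]
lemmas rec_x' = orbitD(4)[OF orbit]
lemmas surf = orbitD(3)[OF orbit]
lemmas surf' = orbitD(5)[OF orbit]

lemma reverse: "tame_orbit V (\<lambda>n. x (- n)) (\<lambda>n. y (- n))"
  by unfold_locales (auto intro: V orbit_reverse orbit tame_reverse tame)

lemma large_neighbours:
  assumes "3 < \<bar>y n\<bar>" shows "\<bar>x n\<bar> \<le> 3" "\<bar>y (n - 1)\<bar> \<le> 3" "\<bar>y (n + 1)\<bar> \<le> 3"
proof -
  have "\<bar>y (n + 1)\<bar> \<le> 3 \<or> \<bar>y (n + 1 - 1)\<bar> \<le> 3" using tame unfolding tame_def by blast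
  then show "\<bar>y (n + 1)\<bar> \<le> 3" using assms by auto
  show "\<bar>x n\<bar> \<le> 3" "\<bar>y (n - 1)\<bar> \<le> 3"
    using tame[unfolded tame_def, rule_format, of n] assms by auto
qed

lemma large_bounds:
  assumes "3 < \<bar>y n\<bar>" shows "V - 1 \<le> \<bar>y n\<bar>" "\<bar>y n\<bar> \<le> V + 1" "\<bar>x n\<bar> \<le> 1/100"
proof -
  have "\<bar>x n * y n\<bar> \<le> 6" using rec_y[of n] large_neighbours[OF assms] by linarith
  with surf_y_bounds[OF surf[of n]] large_neighbours[OF assms] V
  show "V - 1 \<le> \<bar>y n\<bar>" "\<bar>y n\<bar> \<le> V + 1" "\<bar>x n\<bar> \<le> 1/100" by blast+
qed

lemma x_bounds:
  assumes "\<bar>y n\<bar> \<le> 3" "\<bar>y (n - 1)\<bar> \<le> 3 \<or> \<bar>y (n + 1)\<bar> \<le> 3"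
  shows "V - 10 \<le> \<bar>x n\<bar>" "\<bar>x n\<bar> \<le> V + 10"
proof -
  have "V - 10 \<le> \<bar>x n\<bar> \<and> \<bar>x n\<bar> \<le> V + 10"
    using assms(2)
  proof
    assume "\<bar>y (n - 1)\<bar> \<le> 3"
    then show ?thesis using surf_x_bounds[OF surf[of n]] assms(1) V by simp
  next
    assume "\<bar>y (n + 1)\<bar> \<le> 3"
    then show ?thesis using surf_x_bounds[OF surf'[of n]] assms(1) V by simp
  qed
  then show "V - 10 \<le> \<bar>x n\<bar>" "\<bar>x n\<bar> \<le> V + 10" by simp_all
qed

text \<open>\<open>x n\<close> has size about \<open>V\<close>, but its product with
  \<open>y n\<close> is a sum of two small neighbours.\<close>

lemma small_zero:
  assumes "\<bar>y n\<bar> \<le> 3" "\<bar>y (n - 1)\<bar> \<le> 3" "\<bar>y (n + 1)\<bar> \<le> 3"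
  shows "\<bar>y n\<bar> \<le> 1/100"
proof -
  have "\<bar>x n * y n\<bar> \<le> 6" using rec_y[of n] assms by linarith
  then have "\<bar>y n\<bar> \<le> 6 / 990"
    using x_bounds[of n] assms V by (intro abs_mult_cancel_bounds(2)[where a = "x n" and l = 0 and k = "V + 10"]) auto
  then show ?thesis by simp
qed

text \<open>Here \<open>x n * y n\<close> equals \<open>y (n + 1)\<close> up to 3, and both
  \<open>x n\<close> and \<open>y (n + 1)\<close> have size about \<open>V\<close>; their quotient
  is near 1, and the signs must match.\<close>

lemma small_one:
  assumes "\<bar>y n\<bar> \<le> 3" "\<bar>y (n - 1)\<bar> \<le> 3" "3 < \<bar>y (n + 1)\<bar>"
  shows "97/100 \<le> \<bar>y n\<bar>" "\<bar>y n\<bar> \<le> 103/100" "0 < x n * y n * y (n + 1)"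
proof -
  have b: "V - 4 \<le> \<bar>x n * y n\<bar>" "\<bar>x n * y n\<bar> \<le> V + 4"
    using rec_y[of n] large_bounds[OF assms(3)] assms by linarith+
  have "(V - 4) / (V + 10) \<le> \<bar>y n\<bar>" "\<bar>y n\<bar> \<le> (V + 4) / (V - 10)"
    by (rule abs_mult_cancel_bounds[OF b]; use x_bounds[of n] assms V in simp)+
  moreover have "97/100 \<le> (V - 4) / (V + 10)" "(V + 4) / (V - 10) \<le> 103/100"
    using V by (simp_all add: field_simps)
  ultimately show "97/100 \<le> \<bar>y n\<bar>" "\<bar>y n\<bar> \<le> 103/100" by linarith+
  have "0 < x n * y n \<and> 0 < y (n + 1) \<or> x n * y n < 0 \<and> y (n + 1) < 0"
    using rec_y[of n] large_bounds[OF assms(3)] assms V by linarith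
  then show "0 < x n * y n * y (n + 1)" by (auto simp: zero_less_mult_iff[of "x n * y n"])
qed

lemma small_one':
  assumes "\<bar>y n\<bar> \<le> 3" "3 < \<bar>y (n - 1)\<bar>" "\<bar>y (n + 1)\<bar> \<le> 3"
  shows "97/100 \<le> \<bar>y n\<bar>" "\<bar>y n\<bar> \<le> 103/100" "0 < x n * y n * y (n - 1)"
proof -
  have e: "- (- n) = n" "- (- n - 1) = n + 1" "- (- n + 1) = n - 1" by simp_all
  show "97/100 \<le> \<bar>y n\<bar>" "\<bar>y n\<bar> \<le> 103/100" "0 < x n * y n * y (n - 1)"
    using tame_orbit.small_one[OF reverse, of "- n", unfolded e] assms by blast+
qed

text \<open>Subtracting the two recursions for \<open>x\<close> around \<open>n\<close> eliminates
  \<open>x n\<close>. What remains on the right is a difference of values of \<open>x\<close> at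
  large indices, which are tiny, while the coefficient of \<open>y n\<close> has size about 2
  \<open>V\<close>.\<close>

lemma small_between_opposite:
  assumes "\<bar>y n\<bar> \<le> 3" "3 < \<bar>y (n - 1)\<bar>" "3 < \<bar>y (n + 1)\<bar>" "y (n - 1) * y (n + 1) < 0"
  shows "\<bar>y n\<bar> \<le> 1/100"
proof -
  have "(y (n - 1) - y (n + 1)) * y n = x (n - 1) - x (n + 1)"
    using rec_x[of n] rec_x'[of n] by (simp add: algebra_simps)
  then have b: "\<bar>(y (n - 1) - y (n + 1)) * y n\<bar> \<le> 2/100"
    using large_bounds(3)[OF assms(2)] large_bounds(3)[OF assms(3)] by linarith
  have "\<bar>y (n - 1) - y (n + 1)\<bar> = \<bar>y (n - 1)\<bar> + \<bar>y (n + 1)\<bar>"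
    using assms(4) unfolding mult_less_0_iff by linarith
  then have "998 \<le> \<bar>y (n - 1) - y (n + 1)\<bar>"
    using large_bounds(1)[OF assms(2)] large_bounds(1)[OF assms(3)] V by linarith
  then have "\<bar>y n\<bar> \<le> (2/100) / 998"
    by (intro abs_mult_cancel_bounds(2)[OF _ b, where k = "\<bar>y (n - 1) - y (n + 1)\<bar>"]) auto
  then show ?thesis by simp
qed

text \<open>Eliminating \<open>x n\<close> gives y(n-1) y(n)^2 = y(n-1) + y(n+1) up to a tiny error;
  both large values are close to \<open>V\<close> with the same sign, so y(n)^2 is near 2.\<close>

lemma small_between_same:
  assumes "\<bar>y n\<bar> \<le> 3" "3 < \<bar>y (n - 1)\<bar>" "3 < \<bar>y (n + 1)\<bar>" "y (n - 1) * y (n + 1) > 0"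
  shows "138/100 \<le> \<bar>y n\<bar>" "\<bar>y n\<bar> \<le> 145/100"
proof -
  note L = large_bounds[OF assms(2)] and R = large_bounds[OF assms(3)]
  define S where "S = y (n - 1) + y (n + 1)"
  define e where "e = y n * x (n - 1)"
  have eq: "y (n - 1) * (y n)\<^sup>2 = S + e"
    unfolding S_def e_def using rec_y[of n] rec_x'[of n] by algebra
  have e: "\<bar>e\<bar> \<le> 3 * (1/100)"
    unfolding e_def abs_mult using assms(1) L by (intro mult_mono) auto
  have "\<bar>S\<bar> = \<bar>y (n - 1)\<bar> + \<bar>y (n + 1)\<bar>"
    using assms(4) unfolding S_def zero_less_mult_iff by linarith
  then have "2 * V - 2 \<le> \<bar>S\<bar>" "\<bar>S\<bar> \<le> 2 * V + 2"
    using L(1,2) R(1,2) by simp_all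
  then have b: "2 * V - 3 \<le> \<bar>y (n - 1) * (y n)\<^sup>2\<bar>" "\<bar>y (n - 1) * (y n)\<^sup>2\<bar> \<le> 2 * V + 3"
    unfolding eq using e by linarith+
  have "(2 * V - 3) / (V + 1) \<le> \<bar>(y n)\<^sup>2\<bar>" "\<bar>(y n)\<^sup>2\<bar> \<le> (2 * V + 3) / (V - 1)"
    by (rule abs_mult_cancel_bounds[OF b]; use L V in simp)+
  moreover have "(138/100)\<^sup>2 \<le> (2 * V - 3) / (V + 1)" "(2 * V + 3) / (V - 1) \<le> (145/100)\<^sup>2"
    using V by (simp_all add: field_simps power2_eq_square)
  ultimately have sq: "(138/100)\<^sup>2 \<le> \<bar>y n\<bar>\<^sup>2" "\<bar>y n\<bar>\<^sup>2 \<le> (145/100)\<^sup>2" by simp_all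
  from sq(1) show "138/100 \<le> \<bar>y n\<bar>" by (rule power2_le_imp_le) simp
  from sq(2) show "\<bar>y n\<bar> \<le> 145/100" by (rule power2_le_imp_le) simp
qed

lemma small_bound:
  assumes "\<bar>y n\<bar> \<le> 3" shows "\<bar>y n\<bar> \<le> 3/2"
proof -
  consider "\<bar>y (n - 1)\<bar> \<le> 3" "\<bar>y (n + 1)\<bar> \<le> 3" | "\<bar>y (n - 1)\<bar> \<le> 3" "3 < \<bar>y (n + 1)\<bar>"
    | "3 < \<bar>y (n - 1)\<bar>" "\<bar>y (n + 1)\<bar> \<le> 3" | "3 < \<bar>y (n - 1)\<bar>" "3 < \<bar>y (n + 1)\<bar>"
    by linarith
  then show ?thesis
  proof cases
    case 1
    then show ?thesis using small_zero[OF assms] by simp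
  next
    case 2
    then show ?thesis using small_one(2)[OF assms] by simp
  next
    case 3
    then show ?thesis using small_one'(2)[OF assms] by simp
  next
    case 4
    then have "y (n - 1) * y (n + 1) < 0 \<or> y (n - 1) * y (n + 1) > 0" by (auto simp: less_le)
    then show ?thesis
      using small_between_same(2)[OF assms 4] small_between_opposite[OF assms 4] by force
  qed
qed

end

section \<open>Symbolic dynamics\<close>

text \<open>
  A state records which of \<open>x n\<close>, \<open>y n\<close>, \<open>y (n - 1)\<close> dominates, the sign of the dominating coordinate,
  and the position of a small one: \<open>y n\<close> for \<open>XL\<close> and \<open>ZL\<close>, and \<open>y (n + 1)\<close> for \<open>YL\<close>. As \<open>V\<close> grows,
  a small coordinate is forced towards \<open>0\<close>, \<open>\<plusminus> 1\<close> or \<open>\<plusminus> sqrt 2\<close>; these limits have the indices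
  \<open>0\<close>, \<open>\<plusminus> 1\<close> and \<open>\<plusminus> 2\<close>, and the intervals \<open>band j\<close> below surround them.
\<close>

datatype state = XL int int | YL int int | ZL int int

fun valid :: "state \<Rightarrow> bool" where
  "valid (XL s j) \<longleftrightarrow> s \<in> {1, -1} \<and> j \<in> {-1, 0, 1}"
| "valid (YL s j) \<longleftrightarrow> s \<in> {1, -1} \<and> j \<in> {-2, -1, 0, 1, 2}"
| "valid (ZL s j) \<longleftrightarrow> s \<in> {1, -1} \<and> j \<in> {-2, -1, 0, 1, 2}"

text \<open>Each rule reads off the dominant term of the recursion. From \<open>XL\<close>:
  \<open>x (n + 1)\<close> is about \<open>- x n\<close> if \<open>y n\<close> is near 0, and
  otherwise \<open>y (n + 1)\<close> has the sign of \<open>x n * y n\<close>. From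
  \<open>YL\<close> to \<open>ZL\<close> the same small coordinate is recorded again. From
  \<open>ZL\<close>: \<open>y (n + 1)\<close> is about y(n-1) (y(n)^2 - 1), which is negative
  relative to \<open>y (n - 1)\<close> for index 0 and positive for index 2 or -2; near 1 or -1 it
  cancels, and then \<open>x (n + 1)\<close> is about - y(n-1) y(n).\<close>

fun edge :: "state \<Rightarrow> state \<Rightarrow> bool" where
  "edge (XL s i) (XL t j) \<longleftrightarrow> i = 0 \<and> t = - s"
| "edge (XL s i) (YL t j) \<longleftrightarrow> i \<noteq> 0 \<and> t = s * i"
| "edge (YL s i) (ZL t j) \<longleftrightarrow> t = s \<and> j = i"
| "edge (ZL s i) (XL t j) \<longleftrightarrow> \<bar>i\<bar> = 1 \<and> t = - (s * i)"
| "edge (ZL s i) (YL t j) \<longleftrightarrow> i = 0 \<and> t = - s \<or> \<bar>i\<bar> = 2 \<and> t = s"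
| "edge _ _ \<longleftrightarrow> False"

text \<open>The bands contain the values of tame orbits with slack (at most 0.01 in size, 0.97 to
  1.03, 1.38 to 1.45), yet stay disjoint. Their ends are far enough from the limits that the next
  small coordinate overshoots the interval from -2 to 2. Only upper ends are listed; the symmetry v
  -> -v supplies the lower ones.\<close>

definition hi :: "int \<Rightarrow> real" where
  "hi j = (if j = 0 then 1/2 else if j = 1 then 12/10 else if j = -1 then - (7/10)
           else if j = 2 then 16/10 else - (13/10))"

definition lo :: "int \<Rightarrow> real" where
  "lo j = - hi (- j)"

definition band :: "int \<Rightarrow> real set" where
  "band j = {lo j..hi j}"

fun index :: "state \<Rightarrow> int" where
  "index (XL s j) = j" | "index (YL s j) = j" | "index (ZL s j) = j"

text \<open>In \<open>YL\<close> the current \<open>y n\<close> is the large coordinate, so the free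
  small one is only seen one step later. This is also why the edge from \<open>YL\<close> to
  \<open>ZL\<close> stretches nothing.\<close>

fun coord :: "(int \<Rightarrow> real) \<Rightarrow> int \<Rightarrow> state \<Rightarrow> real" where
  "coord y n (XL s j) = y n"
| "coord y n (YL s j) = y (n + 1)"
| "coord y n (ZL s j) = y n"

text \<open>The dominant coordinate is only asked to have the right sign, or to reach 3; its true
  size of about \<open>V\<close> follows from the surface equation. So the conditions are closed and
  easy to verify along a curve.\<close>

fun region :: "(int \<Rightarrow> real) \<Rightarrow> (int \<Rightarrow> real) \<Rightarrow> int \<Rightarrow> state \<Rightarrow> bool" where
  "region x y n (XL s j) \<longleftrightarrow> \<bar>y (n - 1)\<bar> \<le> 2 \<and> y n \<in> band j \<and> 0 \<le> of_int s * x n"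
| "region x y n (YL s j) \<longleftrightarrow> \<bar>y (n - 1)\<bar> \<le> 2 \<and> y (n + 1) \<in> band j \<and> 3 \<le> of_int s * y n"
| "region x y n (ZL s j) \<longleftrightarrow> \<bar>y (n - 2)\<bar> \<le> 2 \<and> y n \<in> band j \<and> 3 \<le> of_int s * y (n - 1)"

lemma band_bound: "v \<in> band j \<Longrightarrow> \<bar>v\<bar> \<le> 8/5"
  by (auto simp: band_def lo_def hi_def split: if_splits)

lemma band_eq:
  "band 0 = {-1/2..1/2}" "band 1 = {7/10..12/10}" "band (-1) = {-12/10..-7/10}"
  "band 2 = {13/10..16/10}" "band (-2) = {-16/10..-13/10}"
  by (simp_all add: band_def lo_def hi_def)

lemma band_unique:
  assumes "v \<in> band i" "v \<in> band j" "i \<in> {-2, -1, 0, 1, 2}" "j \<in> {-2, -1, 0, 1, 2}"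
  shows "i = j"
  using assms(3,4) by (elim insertE emptyE; use assms(1,2) in \<open>simp add: band_eq\<close>)

lemma index_valid: "valid a \<Longrightarrow> index a \<in> {-2, -1, 0, 1, 2}"
  by (cases a) auto

section \<open>Stretching along each edge\<close>

lemma large_x_of_small:
  assumes "orbit V x y" "V \<ge> 1000" "\<bar>y n\<bar> \<le> 2" "\<bar>y (n - 1)\<bar> \<le> 2"
  shows "990 \<le> \<bar>x n\<bar>"
  using surf_x_bounds(1)[OF orbitD(3)[OF assms(1), of n]] assms by simp

lemma large_y_of_small:
  assumes "orbit V x y" "V \<ge> 1000" "\<bar>y (n + 1)\<bar> \<le> 2" "\<bar>y (n - 1)\<bar> \<le> 2" "3 \<le> \<bar>y n\<bar>"
  shows "999 \<le> \<bar>y n\<bar>" "\<bar>x n\<bar> \<le> 1/100"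
proof -
  have 1: "\<bar>x n * y n\<bar> \<le> 4" using orbitD(1)[OF assms(1), of n] assms(3,4) by linarith
  have "\<bar>x n\<bar> * 3 \<le> \<bar>x n\<bar> * \<bar>y n\<bar>" using assms(5) by (intro mult_left_mono) auto
  then have "\<bar>x n\<bar> \<le> 3" using 1 by (simp add: abs_mult)
  with 1 assms show "999 \<le> \<bar>y n\<bar>" "\<bar>x n\<bar> \<le> 1/100"
    using surf_y_bounds[OF orbitD(3)[OF assms(1), of n]] by simp_all
qed

lemma tame_of_regions:
  assumes "orbit V x y" "\<And>n. \<exists>a. region x y n a"
  shows "tame x y"
  unfolding tame_def
proof (intro allI)
  fix n
  obtain a where "region x y n a" using assms by blast
  then show "(\<bar>x n\<bar> \<le> 3 \<or> \<bar>y n\<bar> \<le> 3) \<and> (\<bar>y n\<bar> \<le> 3 \<or> \<bar>y (n - 1)\<bar> \<le> 3)"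
  proof (cases a)
    case (YL s j)
    with \<open>region x y n a\<close> have r: "\<bar>y (n - 1)\<bar> \<le> 2" "\<bar>y (n + 1)\<bar> \<le> 8/5" "3 \<le> of_int s * y n"
      using band_bound[of "y (n + 1)" j] by auto
    show ?thesis
    proof (cases "\<bar>y n\<bar> \<le> 3")
      case False
      have "\<bar>x n * y n\<bar> \<le> 4" using orbitD(1)[OF assms(1), of n] r(1,2) by linarith
      moreover have "\<bar>x n\<bar> * 3 \<le> \<bar>x n\<bar> * \<bar>y n\<bar>" using False by (intro mult_left_mono) auto
      ultimately show ?thesis using r(1) by (simp add: abs_mult)
    qed (use r in simp)
  qed (use band_bound[of "y n"] in force)+
qed

lemma sign_cases:
  fixes s :: int assumes "s \<in> {1, -1}" obtains "s = 1" | "s = -1"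
  using assms by auto

text \<open>A curve along which the small coordinate runs through its band is stretched across the band of
  every successor state, upwards or downwards according to \<open>\<sigma>\<close>.\<close>

definition sweeps :: "real \<Rightarrow> state \<Rightarrow> (int \<Rightarrow> real) \<Rightarrow> int \<Rightarrow> state \<Rightarrow> bool" where
  "sweeps \<sigma> a y n b \<longleftrightarrow>
     (coord y n a = lo (index a) \<longrightarrow> \<sigma> * coord y (n + 1) b \<le> \<sigma> * (if \<sigma> > 0 then lo (index b) else hi (index b))) \<and>
     (coord y n a = hi (index a) \<longrightarrow> \<sigma> * coord y (n + 1) b \<ge> \<sigma> * (if \<sigma> > 0 then hi (index b) else lo (index b)))"

lemma lo_hi_bounds: "- 2 \<le> lo j" "hi j \<le> 2" "lo j \<le> 2" "- 2 \<le> hi j"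
  by (auto simp: lo_def hi_def)

text \<open>All bands lie between -2 and 2, so overshooting these two values is enough whatever the
  index of the target.\<close>

lemma sweepsI:
  assumes "\<sigma> \<in> {1, -1}" "coord y n a = lo (index a) \<Longrightarrow> \<sigma> * coord y (n + 1) b \<le> -2"
    "coord y n a = hi (index a) \<Longrightarrow> \<sigma> * coord y (n + 1) b \<ge> 2"
  shows "sweeps \<sigma> a y n b"
  using assms lo_hi_bounds[of "index b"] unfolding sweeps_def by auto

lemma product_ge:
  fixes a b :: real
  assumes "l \<le> a" "m \<le> b" "0 \<le> l" "0 \<le> m" shows "l * m \<le> a * b"
  using assms by (intro mult_mono) auto

lemma product_abs_le:
  fixes a b :: real
  assumes "\<bar>a\<bar> \<le> l" "\<bar>b\<bar> \<le> m" shows "\<bar>a * b\<bar> \<le> l * m"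
  unfolding abs_mult using assms by (intro mult_mono) auto

text \<open>\<open>y (n + 1)\<close> is \<open>x n * y n\<close> up to 2 and |x n| is at least 990,
  so the band around 0 is stretched with the orientation given by the sign of
  \<open>x n\<close>.\<close>

lemma edge_XL_XL:
  assumes o: "orbit V x y" "V \<ge> 1000" and s: "s \<in> {1, -1}" and r: "region x y n (XL s 0)"
  shows "y (n + 1) \<in> band j \<Longrightarrow> region x y (n + 1) (XL (- s) j)"
    and "sweeps (of_int s) (XL s 0) y n (XL (- s) j)"
proof -
  have b: "\<bar>y (n - 1)\<bar> \<le> 2" "\<bar>y n\<bar> \<le> 8/5" using r band_bound[of "y n" 0] by auto
  have x: "990 \<le> of_int s * x n"
    using large_x_of_small[of V x y n] o b r s by auto
  show "region x y (n + 1) (XL (- s) j)" if "y (n + 1) \<in> band j"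
  proof -
    have "\<bar>y n * y (n + 1)\<bar> \<le> (8/5) * (8/5)" using b band_bound[OF that] by (intro product_abs_le) auto
    then have "0 \<le> of_int (- s) * x (n + 1)"
      using orbitD(2)[OF o(1), of n] x s by (auto simp: abs_le_iff)
    then show ?thesis using b that by simp
  qed
  have ends: "y (n + 1) + y (n - 1) = x n * v" if "y n = v" for v
    using orbitD(1)[OF o(1), of n] that by simp
  have low: "of_int s * y (n + 1) \<le> - 2" if "y n = - 1/2"
    using ends[OF that] x b(1) s by auto
  have high: "2 \<le> of_int s * y (n + 1)" if "y n = 1/2"
    using ends[OF that] x b(1) s by auto
  show "sweeps (of_int s) (XL s 0) y n (XL (- s) j)"
    by (rule sweepsI; use s low high in \<open>force simp: lo_def hi_def\<close>)
qed

text \<open>To leading order \<open>x (n + 1)\<close> is x(n) (y(n)^2 - 1), which changes sign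
  across the band around 1 or -1. Multiplied by the large \<open>y (n + 1)\<close> it drives
  \<open>y (n + 2)\<close> through every band; the signs \<open>s\<close> and \<open>i\<close>
  cancel in the orientation.\<close>

lemma edge_XL_YL:
  assumes o: "orbit V x y" "V \<ge> 1000" and s: "s \<in> {1, -1}" "i \<in> {1, -1}"
    and r: "region x y n (XL s i)"
  shows "y (n + 2) \<in> band j \<Longrightarrow> region x y (n + 1) (YL (s * i) j)"
    and "sweeps 1 (XL s i) y n (YL (s * i) j)"
proof -
  have b: "\<bar>y (n - 1)\<bar> \<le> 2" "\<bar>y n\<bar> \<le> 8/5" using r band_bound[of "y n" i] by auto
  have x: "990 \<le> of_int s * x n"
    using large_x_of_small[of V x y n] o b r s by auto
  have yi: "7/10 \<le> of_int i * y n" "of_int i * y n \<le> 12/10" using r s(2) by (auto simp: band_eq)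
  have "990 * (7/10) \<le> (of_int s * x n) * (of_int i * y n)" using x yi by (intro product_ge) auto
  then have y1: "600 \<le> of_int (s * i) * y (n + 1)"
    using orbitD(1)[OF o(1), of n] b s by auto
  show "region x y (n + 1) (YL (s * i) j)" if "y (n + 2) \<in> band j"
    using that b y1 by (simp add: algebra_simps)
  have rec: "x (n + 1) + x n = y n * y (n + 1)" "y (n + 1) + y (n - 1) = x n * y n"
    "y (n + 2) + y n = x (n + 1) * y (n + 1)"
    using orbitD(2)[OF o(1), of n] orbitD(1)[OF o(1), of n] orbitD(1)[OF o(1), of "n + 1"]
    by (simp_all add: algebra_simps)
  have ends: "x (n + 1) + x n = of_int i * c * y (n + 1)" "y (n + 1) + y (n - 1) = of_int i * c * x n"
    if "y n = of_int i * c" for c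
    using rec(1,2) unfolding that by (simp_all add: ac_simps)
  have low: "of_int i * y (n + 2) \<le> - 2" if "of_int i * y n = 7/10"
  proof -
    have v: "y n = of_int i * (7/10)" using that s(2) by auto
    then have "10 \<le> - (of_int s * x (n + 1))"
      using ends[OF v] x b(1) s by auto
    then have "10 * 10 \<le> - (of_int s * x (n + 1)) * (of_int (s * i) * y (n + 1))"
      using y1 by (intro product_ge) auto
    then have "100 \<le> - (of_int i * (x (n + 1) * y (n + 1)))" using s by auto
    then show ?thesis using rec(3) b s by auto
  qed
  have high: "2 \<le> of_int i * y (n + 2)" if "of_int i * y n = 12/10"
  proof -
    have v: "y n = of_int i * (12/10)" using that s(2) by auto
    then have "10 \<le> of_int s * x (n + 1)"
      using ends[OF v] x b(1) s by auto
    then have "10 * 10 \<le> (of_int s * x (n + 1)) * (of_int (s * i) * y (n + 1))"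
      using y1 by (intro product_ge) auto
    then have "100 \<le> of_int i * (x (n + 1) * y (n + 1))" using s by auto
    then show ?thesis using rec(3) b s by auto
  qed
  show "sweeps 1 (XL s i) y n (YL (s * i) j)"
    using s(2)
  proof (cases rule: sign_cases)
    case 1
    show ?thesis
      by (rule sweepsI; use 1 low high in \<open>simp add: lo_def hi_def add.assoc\<close>)
  next
    case 2
    show ?thesis
      by (rule sweepsI; use 2 low high in \<open>simp add: lo_def hi_def add.assoc\<close>)
  qed
qed

lemma edge_YL_ZL:
  assumes r: "region x y n (YL s i)"
  shows "region x y (n + 1) (ZL s i)" "sweeps 1 (YL s i) y n (ZL s i)"
  using r by (auto simp: sweeps_def)

lemma region_ZL_bounds:
  assumes o: "orbit V x y" "V \<ge> 1000" and s: "s \<in> {1, -1}" and r: "region x y n (ZL s i)"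
  shows "\<bar>y n\<bar> \<le> 8/5" "999 \<le> of_int s * y (n - 1)" "\<bar>x (n - 1)\<bar> \<le> 1/100"
    "x n + x (n - 1) = y (n - 1) * y n" "y (n + 1) + y (n - 1) = x n * y n"
    "x (n + 1) + x n = y n * y (n + 1)" "y (n + 2) + y n = x (n + 1) * y (n + 1)"
proof -
  show b: "\<bar>y n\<bar> \<le> 8/5" using r band_bound[of "y n" i] by auto
  have y: "3 \<le> of_int s * y (n - 1)" "\<bar>y (n - 2)\<bar> \<le> 2" using r by auto
  then have "999 \<le> \<bar>y (n - 1)\<bar> \<and> \<bar>x (n - 1)\<bar> \<le> 1/100"
    using large_y_of_small[of V x y "n - 1"] o b s by auto
  then show "999 \<le> of_int s * y (n - 1)" "\<bar>x (n - 1)\<bar> \<le> 1/100" using y s by auto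
  show "x n + x (n - 1) = y (n - 1) * y n" "y (n + 1) + y (n - 1) = x n * y n"
    "x (n + 1) + x n = y n * y (n + 1)" "y (n + 2) + y n = x (n + 1) * y (n + 1)"
    using orbitD(4,1,2)[OF o(1), of n] orbitD(1)[OF o(1), of "n + 1"]
    by (simp_all add: algebra_simps)
qed

lemma region_ZL_ends:
  fixes x y :: "int \<Rightarrow> real"
  assumes "x n + x (n - 1) = y (n - 1) * y n" "y (n + 1) + y (n - 1) = x n * y n"
    "x (n + 1) + x n = y n * y (n + 1)" "y n = v"
  shows "x n + x (n - 1) = v * y (n - 1)" "y (n + 1) + y (n - 1) = v * x n"
    "x (n + 1) + x n = v * y (n + 1)"
  using assms by (simp_all add: ac_simps)

text \<open>Here y(n-1) (y(n)^2 - 1), the leading term of \<open>y (n + 1)\<close>, changes sign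
  across the band; it moves in the direction \<open>s\<close> as \<open>of_int i * y n\<close>
  increases, hence the orientation \<open>s * i\<close>.\<close>

lemma edge_ZL_XL:
  assumes o: "orbit V x y" "V \<ge> 1000" and s: "s \<in> {1, -1}" "i \<in> {1, -1}"
    and r: "region x y n (ZL s i)"
  shows "y (n + 1) \<in> band j \<Longrightarrow> region x y (n + 1) (XL (- (s * i)) j)"
    and "sweeps (of_int (s * i)) (ZL s i) y n (XL (- (s * i)) j)"
proof -
  note b = region_ZL_bounds[OF o s(1) r]
  have yi: "7/10 \<le> of_int i * y n" "of_int i * y n \<le> 12/10" using r s(2) by (auto simp: band_eq)
  have "999 * (7/10) \<le> (of_int s * y (n - 1)) * (of_int i * y n)"
    using b yi by (intro product_ge) auto
  then have x: "600 \<le> of_int (s * i) * x n" using b(3,4) s by auto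
  show "region x y (n + 1) (XL (- (s * i)) j)" if "y (n + 1) \<in> band j"
  proof -
    have "\<bar>y n * y (n + 1)\<bar> \<le> (8/5) * (8/5)" using b band_bound[OF that] by (intro product_abs_le) auto
    then have "0 \<le> of_int (- (s * i)) * x (n + 1)"
      using b(6) x s by auto
    then show ?thesis using b that by simp
  qed
  have low: "of_int s * y (n + 1) \<le> - 2" if "of_int i * y n = 7/10"
  proof -
    have v: "y n = of_int i * (7/10)" using that s(2) by auto
    show ?thesis using region_ZL_ends[OF b(4-6) v] b(2,3) s by auto
  qed
  have high: "2 \<le> of_int s * y (n + 1)" if "of_int i * y n = 12/10"
  proof -
    have v: "y n = of_int i * (12/10)" using that s(2) by auto
    show ?thesis using region_ZL_ends[OF b(4-6) v] b(2,3) s by auto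
  qed
  show "sweeps (of_int (s * i)) (ZL s i) y n (XL (- (s * i)) j)"
    using s(2)
  proof (cases rule: sign_cases)
    case 1
    show ?thesis
      by (rule sweepsI; use 1 s(1) low high in \<open>auto simp add: lo_def hi_def\<close>)
  next
    case 2
    show ?thesis
      by (rule sweepsI; use 2 s(1) low high in \<open>auto simp add: lo_def hi_def\<close>)
  qed
qed

text \<open>The root 0 of t (t^2 - 1) (t^2 - 2), the leading behaviour of \<open>y (n + 2)\<close>
  in t = \<open>y n\<close>. Its derivative there is positive, so the orientation is 1 for both
  signs.\<close>

lemma edge_ZL_YL_opposite:
  assumes o: "orbit V x y" "V \<ge> 1000" and s: "s \<in> {1, -1}" and r: "region x y n (ZL s 0)"
  shows "y (n + 2) \<in> band j \<Longrightarrow> region x y (n + 1) (YL (- s) j)"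
    and "sweeps 1 (ZL s 0) y n (YL (- s) j)"
proof -
  note b = region_ZL_bounds[OF o s r]
  have y0: "\<bar>y n\<bar> \<le> 1/2" using r by (auto simp: band_eq)
  have y1: "y (n + 1) = y (n - 1) * ((y n)\<^sup>2 - 1) - x (n - 1) * y n"
    using b(4,5) by (simp add: algebra_simps power2_eq_square) algebra
  have "(y n)\<^sup>2 \<le> (1/2)\<^sup>2" using y0 by (intro power2_le_iff_abs_le[THEN iffD2]) auto
  then have "999 * (3/4) \<le> (of_int s * y (n - 1)) * (1 - (y n)\<^sup>2)"
    using b by (intro product_ge) (auto simp: power2_eq_square)
  moreover have "\<bar>x (n - 1) * y n\<bar> \<le> (1/100) * (1/2)" using b y0 by (intro product_abs_le) auto
  ultimately have y1: "600 \<le> of_int (- s) * y (n + 1)"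
    unfolding y1 using s by (auto simp: algebra_simps)
  show "region x y (n + 1) (YL (- s) j)" if "y (n + 2) \<in> band j"
    using that b y1 by (simp add: algebra_simps)
  have low: "y (n + 2) \<le> - 2" if "y n = - 1/2"
  proof -
    have "10 \<le> of_int s * x (n + 1)"
      using region_ZL_ends[OF b(4-6) that] b(2,3) s by auto
    then have "10 * 10 \<le> (of_int s * x (n + 1)) * (of_int (- s) * y (n + 1))"
      using y1 by (intro product_ge) auto
    then have "100 \<le> - (x (n + 1) * y (n + 1))" using s by auto
    then show ?thesis using b y0 by linarith
  qed
  have high: "2 \<le> y (n + 2)" if "y n = 1/2"
  proof -
    have "10 \<le> - (of_int s * x (n + 1))"
      using region_ZL_ends[OF b(4-6) that] b(2,3) s by auto
    then have "10 * 10 \<le> - (of_int s * x (n + 1)) * (of_int (- s) * y (n + 1))"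
      using y1 by (intro product_ge) auto
    then have "100 \<le> x (n + 1) * y (n + 1)" using s by auto
    then show ?thesis using b y0 by linarith
  qed
  show "sweeps 1 (ZL s 0) y n (YL (- s) j)"
    by (rule sweepsI; use low high in \<open>simp add: lo_def hi_def add.assoc\<close>)
qed

text \<open>The roots sqrt 2 and - sqrt 2 of the same polynomial, where its derivative is positive
  again. The index is written \<open>2 * i\<close> so that the sign \<open>i\<close> can treat both
  bands at once.\<close>

lemma edge_ZL_YL_same:
  assumes o: "orbit V x y" "V \<ge> 1000" and s: "s \<in> {1, -1}" "i \<in> {1, -1}"
    and r: "region x y n (ZL s (2 * i))"
  shows "y (n + 2) \<in> band j \<Longrightarrow> region x y (n + 1) (YL s j)"
    and "sweeps 1 (ZL s (2 * i)) y n (YL s j)"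
proof -
  note b = region_ZL_bounds[OF o s(1) r]
  have yi: "13/10 \<le> of_int i * y n" "of_int i * y n \<le> 16/10" using r s(2) by (auto simp: band_eq)
  have y1: "y (n + 1) = y (n - 1) * ((y n)\<^sup>2 - 1) - x (n - 1) * y n"
    using b(4,5) by (simp add: algebra_simps power2_eq_square) algebra
  have "(13/10)\<^sup>2 \<le> (of_int i * y n)\<^sup>2" using yi by (intro power_mono) auto
  then have "(13/10)\<^sup>2 \<le> (y n)\<^sup>2" using s(2) by auto
  then have "999 * (69/100) \<le> (of_int s * y (n - 1)) * ((y n)\<^sup>2 - 1)"
    using b by (intro product_ge) (auto simp: power2_eq_square)
  moreover have "\<bar>x (n - 1) * y n\<bar> \<le> (1/100) * (8/5)" using b by (intro product_abs_le) auto
  ultimately have y1: "600 \<le> of_int s * y (n + 1)"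
    unfolding y1 using s by (auto simp: algebra_simps)
  show "region x y (n + 1) (YL s j)" if "y (n + 2) \<in> band j"
    using that b y1 by (simp add: algebra_simps)
  have low: "of_int i * y (n + 2) \<le> - 2" if "of_int i * y n = 13/10"
  proof -
    have v: "y n = of_int i * (13/10)" using that s(2) by auto
    have "10 \<le> - (of_int (s * i) * x (n + 1))"
      using region_ZL_ends[OF b(4-6) v] b(2,3) s by auto
    then have "10 * 10 \<le> - (of_int (s * i) * x (n + 1)) * (of_int s * y (n + 1))"
      using y1 by (intro product_ge) auto
    then have "100 \<le> - (of_int i * (x (n + 1) * y (n + 1)))" using s by auto
    then show ?thesis using b(1,7) s(2) by auto
  qed
  have high: "2 \<le> of_int i * y (n + 2)" if "of_int i * y n = 16/10"
  proof -
    have v: "y n = of_int i * (16/10)" using that s(2) by auto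
    have "10 \<le> of_int (s * i) * x (n + 1)"
      using region_ZL_ends[OF b(4-6) v] b(2,3) s by auto
    then have "10 * 10 \<le> (of_int (s * i) * x (n + 1)) * (of_int s * y (n + 1))"
      using y1 by (intro product_ge) auto
    then have "100 \<le> of_int i * (x (n + 1) * y (n + 1))" using s by auto
    then show ?thesis using b(1,7) s(2) by auto
  qed
  show "sweeps 1 (ZL s (2 * i)) y n (YL s j)"
    using s(2)
  proof (cases rule: sign_cases)
    case 1
    show ?thesis
      by (rule sweepsI; use 1 low high in \<open>simp add: lo_def hi_def add.assoc\<close>)
  next
    case 2
    show ?thesis
      by (rule sweepsI; use 2 low high in \<open>simp add: lo_def hi_def add.assoc\<close>)
  qed
qed

lemma edge_sweeps:
  assumes "edge a b" "valid a" "valid b" "V \<ge> 1000"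
  shows "\<exists>\<sigma>\<in>{1, -1}. \<forall>x y. orbit V x y \<longrightarrow> region x y n a \<longrightarrow>
     sweeps \<sigma> a y n b \<and> (coord y (n + 1) b \<in> band (index b) \<longrightarrow> region x y (n + 1) b)"
proof (cases a; cases b)
  fix s i t j assume ab: "a = XL s i" "b = XL t j"
  then have "i = 0" "t = - s" "s \<in> {1, -1}" using assms by auto
  then show ?thesis unfolding ab using edge_XL_XL[where s = s and n = n and j = j] assms(4)
    by (intro bexI[of _ "of_int s"]) auto
next
  fix s i t j assume ab: "a = XL s i" "b = YL t j"
  then have "t = s * i" "s \<in> {1, -1}" "i \<in> {1, -1}" using assms by auto
  then show ?thesis unfolding ab using edge_XL_YL[where s = s and i = i and n = n and j = j] assms(4)
    by (intro bexI[of _ 1]) (auto simp: add.assoc)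
next
  fix s i t j assume ab: "a = YL s i" "b = ZL t j"
  then have "t = s" "j = i" using assms by auto
  then show ?thesis unfolding ab using edge_YL_ZL[where s = s and i = i and n = n]
    by (intro bexI[of _ 1]) auto
next
  fix s i t j assume ab: "a = ZL s i" "b = XL t j"
  then have "t = - (s * i)" "s \<in> {1, -1}" "i \<in> {1, -1}" using assms by auto
  then show ?thesis unfolding ab using edge_ZL_XL[where s = s and i = i and n = n and j = j] assms(4)
    by (intro bexI[of _ "of_int (s * i)"]) auto
next
  fix s i t j assume ab: "a = ZL s i" "b = YL t j"
  then have s: "s \<in> {1, -1}" using assms by auto
  have "i = 0 \<and> t = - s \<or> (\<exists>k\<in>{1, -1}. i = 2 * k) \<and> t = s" using assms ab by auto
  then show ?thesis
  proof
    assume "i = 0 \<and> t = - s"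
    then show ?thesis unfolding ab
      using edge_ZL_YL_opposite[where s = s and n = n and j = j] assms(4) s
      by (intro bexI[of _ 1]) (auto simp: add.assoc)
  next
    assume "(\<exists>k\<in>{1, -1}. i = 2 * k) \<and> t = s"
    then obtain k where "k \<in> {1, -1}" "i = 2 * k" "t = s" by blast
    then show ?thesis unfolding ab
      using edge_ZL_YL_same[where s = s and i = k and n = n and j = j] assms(4) s
      by (intro bexI[of _ 1]) (auto simp: add.assoc)
  qed
qed (use assms in auto)

section \<open>Itineraries of tame orbits\<close>

lemma band_of_abs:
  "\<bar>v\<bar> \<le> 1/2 \<Longrightarrow> v \<in> band 0"
  "7/10 \<le> \<bar>v\<bar> \<Longrightarrow> \<bar>v\<bar> \<le> 12/10 \<Longrightarrow> v \<in> band 1 \<or> v \<in> band (-1)"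
  "13/10 \<le> \<bar>v\<bar> \<Longrightarrow> \<bar>v\<bar> \<le> 16/10 \<Longrightarrow> v \<in> band 2 \<or> v \<in> band (-2)"
  by (auto simp: band_eq)

text \<open>The addition about \<open>y (n - 1)\<close> is what restricts \<open>XL\<close> to the
  indices -1, 0, 1: a value near sqrt 2 in size needs large values on both sides.\<close>

lemma (in tame_orbit) small_band:
  assumes "\<bar>y n\<bar> \<le> 3"
  shows "\<exists>j\<in>{-2, -1, 0, 1, 2}. y n \<in> band j \<and> (\<bar>y (n - 1)\<bar> \<le> 3 \<longrightarrow> j \<in> {-1, 0, 1})"
proof -
  consider "\<bar>y (n - 1)\<bar> \<le> 3" "\<bar>y (n + 1)\<bar> \<le> 3" | "\<bar>y (n - 1)\<bar> \<le> 3" "3 < \<bar>y (n + 1)\<bar>"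
    | "3 < \<bar>y (n - 1)\<bar>" "\<bar>y (n + 1)\<bar> \<le> 3" | "3 < \<bar>y (n - 1)\<bar>" "3 < \<bar>y (n + 1)\<bar>"
    by linarith
  then show ?thesis
  proof cases
    case 1
    then have "y n \<in> band 0" using small_zero[OF assms] by (intro band_of_abs) auto
    then show ?thesis by blast
  next
    case 2
    then have "y n \<in> band 1 \<or> y n \<in> band (-1)"
      using small_one(1,2)[OF assms] by (intro band_of_abs) auto
    then show ?thesis by blast
  next
    case 3
    then have "y n \<in> band 1 \<or> y n \<in> band (-1)"
      using small_one'(1,2)[OF assms] by (intro band_of_abs) auto
    then show ?thesis by blast
  next
    case 4
    then have "y (n - 1) * y (n + 1) < 0 \<or> y (n - 1) * y (n + 1) > 0" by (auto simp: less_le)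
    then have "y n \<in> band 0 \<or> y n \<in> band 2 \<or> y n \<in> band (-2)"
    proof
      assume "y (n - 1) * y (n + 1) < 0"
      then have "y n \<in> band 0"
        using small_between_opposite[OF assms 4] by (intro band_of_abs) auto
      then show ?thesis by blast
    next
      assume "y (n - 1) * y (n + 1) > 0"
      then have "y n \<in> band 2 \<or> y n \<in> band (-2)"
        using small_between_same[OF assms 4] by (intro band_of_abs) auto
      then show ?thesis by blast
    qed
    moreover have "\<not> \<bar>y (n - 1)\<bar> \<le> 3" using 4 by simp
    ultimately show ?thesis by blast
  qed
qed

lemma (in tame_orbit) ex_region: "\<exists>a. valid a \<and> region x y n a"
proof -
  have small: "\<bar>y k\<bar> \<le> 2" if "\<bar>y k\<bar> \<le> 3" for k using small_bound[OF that] by simp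
  have sgn: "\<exists>s\<in>{1, -1}. c \<le> of_int s * v" if "c \<le> \<bar>v\<bar>" for c v :: real
    using that by (cases "v \<ge> 0") auto
  consider "3 < \<bar>y n\<bar>" | "\<bar>y n\<bar> \<le> 3" "\<bar>y (n - 1)\<bar> \<le> 3" | "\<bar>y n\<bar> \<le> 3" "3 < \<bar>y (n - 1)\<bar>" by linarith
  then show ?thesis
  proof cases
    case 1
    then have "3 \<le> \<bar>y n\<bar>" by simp
    from sgn[OF this] obtain s where s: "s \<in> {1, -1}" "3 \<le> of_int s * y n" by blast
    obtain j where j: "j \<in> {-2, -1, 0, 1, 2}" "y (n + 1) \<in> band j"
      using small_band large_neighbours(3)[OF 1] by blast
    have "valid (YL s j) \<and> region x y n (YL s j)"
      using s j small[OF large_neighbours(2)[OF 1]] by simp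
    then show ?thesis by blast
  next
    case 2
    obtain s where s: "s \<in> {1, -1}" "0 \<le> of_int s * x n" using sgn[OF abs_ge_zero] by blast
    obtain j where j: "j \<in> {-1, 0, 1}" "y n \<in> band j" using small_band 2 by blast
    have "valid (XL s j) \<and> region x y n (XL s j)"
      using s j small[OF 2(2)] by simp
    then show ?thesis by blast
  next
    case 3
    then have "3 \<le> \<bar>y (n - 1)\<bar>" by simp
    from sgn[OF this] obtain s where s: "s \<in> {1, -1}" "3 \<le> of_int s * y (n - 1)" by blast
    obtain j where j: "j \<in> {-2, -1, 0, 1, 2}" "y n \<in> band j" using small_band 3 by blast
    have "\<bar>y (n - 2)\<bar> \<le> 2" using small[OF large_neighbours(2)[OF 3(2)]] by simp
    then have "valid (ZL s j) \<and> region x y n (ZL s j)" using s j by simp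
    then show ?thesis by blast
  qed
qed

lemma (in tame_orbit) region_large:
  assumes "3 \<le> of_int s * y n" "s \<in> {1, -1}"
  shows "3 < \<bar>y n\<bar>"
proof (rule ccontr)
  assume "\<not> ?thesis"
  then have "\<bar>y n\<bar> \<le> 3/2" using small_bound by simp
  then show False using assms by auto
qed

lemma sign_product:
  fixes a b c :: real and s i t :: int
  assumes "0 < of_int s * a" "0 < of_int i * b" "0 < of_int t * c" "0 < a * b * c"
    "s \<in> {1, -1}" "i \<in> {1, -1}" "t \<in> {1, -1}"
  shows "t = s * i"
proof -
  have "0 < (of_int s * a) * (of_int i * b) * (of_int t * c)" by (intro mult_pos_pos[OF mult_pos_pos] assms)
  also have "\<dots> = of_int (s * i * t) * (a * b * c)" by simp
  finally have "0 < real_of_int (s * i * t)" using assms(4) by (rule zero_less_mult_pos2)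
  then show ?thesis using assms(5-7) by auto
qed

lemma (in tame_orbit) region_edge:
  assumes a: "valid a" "region x y n a" and b: "valid b" "region x y (n + 1) b"
  shows "edge a b"
proof (cases a; cases b)
  fix s i t j assume ab: "a = XL s i" "b = XL t j"
  have v: "s \<in> {1, -1}" "t \<in> {1, -1}" "i \<in> {-1, 0, 1}" using a b ab by auto
  have y: "\<bar>y (n - 1)\<bar> \<le> 2" "\<bar>y n\<bar> \<le> 2" "\<bar>y (n + 1)\<bar> \<le> 8/5"
    using a b ab band_bound[of "y (n + 1)"] by auto
  have "\<bar>y n\<bar> \<le> 1/100" using y by (intro small_zero) auto
  then have "y n \<in> band 0" by (intro band_of_abs) auto
  moreover have "y n \<in> band i" using a ab by auto
  ultimately have "i = 0" using v by (intro band_unique) auto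
  have "990 \<le> \<bar>x n\<bar>" using x_bounds(1)[of n] y V by simp
  then have "990 \<le> of_int s * x n" using a(2) ab v(1) by auto
  moreover have "\<bar>y n * y (n + 1)\<bar> \<le> 2 * (8/5)" using y by (intro product_abs_le) auto
  moreover have "0 \<le> of_int t * x (n + 1)" using b ab by auto
  ultimately have "t = - s" using rec_x[of n] v(1,2) by (elim insertE emptyE) auto
  then show ?thesis using ab \<open>i = 0\<close> by simp
next
  fix s i t j assume ab: "a = XL s i" "b = YL t j"
  have v: "s \<in> {1, -1}" "t \<in> {1, -1}" "i \<in> {-1, 0, 1}" using a b ab by auto
  have y: "\<bar>y (n - 1)\<bar> \<le> 2" "\<bar>y n\<bar> \<le> 2" "3 \<le> of_int t * y (n + 1)" "y n \<in> band i" "0 \<le> of_int s * x n"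
    using a b ab by auto
  have "3 < \<bar>y (n + 1)\<bar>" using y v region_large by blast
  then have 1: "97/100 \<le> \<bar>y n\<bar>" "\<bar>y n\<bar> \<le> 103/100" "0 < x n * y n * y (n + 1)"
    using small_one[of n] y by auto
  have i: "i \<in> {1, -1}" using v(3) by (elim insertE emptyE; use y(4) 1(1,2) in \<open>auto simp: band_eq\<close>)
  have "0 < of_int i * y n" using i by (elim insertE emptyE; use y(4) in \<open>simp add: band_eq\<close>)
  moreover have "990 \<le> \<bar>x n\<bar>" using x_bounds(1)[of n] y(1,2) V by simp
  then have "0 < of_int s * x n" using v(1) y(5) by auto
  moreover have "0 < of_int t * y (n + 1)" using y(3) by simp
  ultimately have "t = s * i" using sign_product 1(3) v(1,2) i by blast
  then show ?thesis using ab i by auto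
next
  fix s i t j assume ab: "a = XL s i" "b = ZL t j"
  then have "\<bar>y n\<bar> \<le> 8/5" "3 \<le> of_int t * y n" "t \<in> {1, -1}" using a b band_bound[of "y n"] by auto
  then show ?thesis by auto
next
  fix s i t j assume ab: "a = YL s i" "b = XL t j"
  then have "\<bar>y n\<bar> \<le> 2" "3 \<le> of_int s * y n" "s \<in> {1, -1}" using a b by auto
  then show ?thesis by auto
next
  fix s i t j assume ab: "a = YL s i" "b = YL t j"
  then have "\<bar>y n\<bar> \<le> 2" "3 \<le> of_int s * y n" "s \<in> {1, -1}" using a b by auto
  then show ?thesis by auto
next
  fix s i t j assume ab: "a = YL s i" "b = ZL t j"
  then have "i = j" using band_unique[of "y (n + 1)" i j] a b by auto
  moreover have "3 \<le> of_int s * y n" "s \<in> {1, -1}" "3 \<le> of_int t * y n" "t \<in> {1, -1}"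
    using a b ab by auto
  then have "s = t" by auto
  ultimately show ?thesis using ab by simp
next
  fix s i t j assume ab: "a = ZL s i" "b = XL t j"
  have v: "s \<in> {1, -1}" "t \<in> {1, -1}" "i \<in> {-2, -1, 0, 1, 2}" using a b ab by auto
  have y: "3 \<le> of_int s * y (n - 1)" "\<bar>y n\<bar> \<le> 2" "\<bar>y (n + 1)\<bar> \<le> 8/5" "y n \<in> band i"
    "0 \<le> of_int t * x (n + 1)"
    using a b ab band_bound[of "y (n + 1)"] by auto
  have "3 < \<bar>y (n - 1)\<bar>" using y v region_large by blast
  then have 1: "97/100 \<le> \<bar>y n\<bar>" "\<bar>y n\<bar> \<le> 103/100" "0 < x n * y n * y (n - 1)"
    using small_one'[of n] y by auto
  have i: "i \<in> {1, -1}" using v(3) by (elim insertE emptyE; use y(4) 1(1,2) in \<open>auto simp: band_eq\<close>)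
  have iy: "0 < of_int i * y n" using i by (elim insertE emptyE; use y(4) in \<open>simp add: band_eq\<close>)
  have x: "990 \<le> \<bar>x n\<bar>" using x_bounds(1)[of n] y(2,3) V by simp
  define u :: int where "u = (if 0 < x n then 1 else -1)"
  have u: "u \<in> {1, -1}" "of_int u * x n = \<bar>x n\<bar>" by (auto simp: u_def)
  \<comment> \<open>A state \<open>ZL\<close> does not record the sign of \<open>x n\<close>; it is
    recovered from the sign relation at a value near 1 and called \<open>u\<close>. The next
    \<open>x\<close> then has the opposite sign.\<close>
  have "0 < y (n - 1) * y n * x n" using 1(3) by (simp add: mult_ac)
  moreover have "0 < of_int s * y (n - 1)" "0 < of_int u * x n" using y(1) x u(2) by simp_all
  ultimately have usi: "u = s * i" using sign_product iy v(1) u(1) i by blast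
  have "990 \<le> of_int u * x n" using u(2) x by simp
  moreover have "\<bar>y n * y (n + 1)\<bar> \<le> 2 * (8/5)" using y by (intro product_abs_le) auto
  ultimately have "t = - u"
    using rec_x[of n] v(2) u(1) y(5) by (elim insertE emptyE) auto
  then show ?thesis using ab i usi by auto
next
  fix s i t j assume ab: "a = ZL s i" "b = YL t j"
  have v: "s \<in> {1, -1}" "t \<in> {1, -1}" "i \<in> {-2, -1, 0, 1, 2}" using a b ab by auto
  have y: "3 \<le> of_int s * y (n - 1)" "\<bar>y n\<bar> \<le> 3" "3 \<le> of_int t * y (n + 1)" "y n \<in> band i"
    using a b ab by auto
  have L: "3 < \<bar>y (n - 1)\<bar>" "3 < \<bar>y (n + 1)\<bar>" using y v region_large by blast+
  show ?thesis
  proof (cases "t = s")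
    case True
    then have "y (n - 1) * y (n + 1) > 0" using y(1,3) v(1) by (elim insertE emptyE) (auto simp: zero_less_mult_iff)
    then have "138/100 \<le> \<bar>y n\<bar>" using small_between_same[OF y(2) L] by simp
    then have "\<bar>i\<bar> = 2" using v(3) by (elim insertE emptyE; use y(4) in \<open>auto simp: band_eq\<close>)
    then show ?thesis using True ab by simp
  next
    case False
    then have t: "t = - s" using v by auto
    then have "y (n - 1) * y (n + 1) < 0" using y(1,3) v(1) by (elim insertE emptyE) (auto simp: mult_less_0_iff)
    then have "\<bar>y n\<bar> \<le> 1/100" using small_between_opposite[OF y(2) L] by simp
    then have "i = 0" using v(3) by (elim insertE emptyE; use y(4) in \<open>auto simp: band_eq\<close>)
    then show ?thesis using t ab by simp
  qed
next
  fix s i t j assume ab: "a = ZL s i" "b = ZL t j"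
  then have "\<bar>y n\<bar> \<le> 8/5" "3 \<le> of_int t * y n" "t \<in> {1, -1}" using a b band_bound[of "y n"] by auto
  then show ?thesis by auto
qed

lemma (in tame_orbit) region_unique:
  assumes a: "valid a" "region x y n a" and b: "valid b" "region x y n b"
  shows "a = b"
proof -
  have big: "\<not> 3 \<le> of_int s * v" if "s \<in> {1, -1}" "\<bar>v\<bar> \<le> 2" for s :: int and v :: real
    using that by auto
  have bd: "\<bar>v\<bar> \<le> 2" if "v \<in> band j" for v j using band_bound[OF that] by simp
  have same: "s = t" if "s \<in> {1, -1}" "t \<in> {1, -1}" "c \<le> of_int s * v" "c \<le> of_int t * v" "0 < c"
    for s t :: int and c v :: real using that by auto
  show ?thesis
  proof (cases a; cases b)
    fix s i t j assume ab: "a = XL s i" "b = XL t j"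
    have "i = j" using band_unique[of "y n" i j] a b ab by auto
    have "990 \<le> \<bar>x n\<bar>" using x_bounds(1)[of n] a ab band_bound[of "y n" i] V by auto
    then have "s = t" using a b ab by auto
    then show ?thesis using ab \<open>i = j\<close> by simp
  next
    fix s i t j assume ab: "a = YL s i" "b = YL t j"
    then show ?thesis using band_unique[of "y (n + 1)" i j] a b same[of s t 3 "y n"] by auto
  next
    fix s i t j assume ab: "a = ZL s i" "b = ZL t j"
    then show ?thesis using band_unique[of "y n" i j] a b same[of s t 3 "y (n - 1)"] by auto
  next
    fix s i t j assume "a = XL s i" "b = YL t j"
    then have "\<bar>y n\<bar> \<le> 2" "3 \<le> of_int t * y n" "t \<in> {1, -1}" using a b bd[of "y n"] by auto
    then show ?thesis using big by blast
  next
    fix s i t j assume "a = XL s i" "b = ZL t j"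
    then have "\<bar>y (n - 1)\<bar> \<le> 2" "3 \<le> of_int t * y (n - 1)" "t \<in> {1, -1}" using a b bd[of "y n"] by auto
    then show ?thesis using big by blast
  next
    fix s i t j assume "a = YL s i" "b = XL t j"
    then have "\<bar>y n\<bar> \<le> 2" "3 \<le> of_int s * y n" "s \<in> {1, -1}" using a b bd[of "y n"] by auto
    then show ?thesis using big by blast
  next
    fix s i t j assume "a = YL s i" "b = ZL t j"
    then have "\<bar>y n\<bar> \<le> 2" "3 \<le> of_int s * y n" "s \<in> {1, -1}" using a b bd[of "y n"] by auto
    then show ?thesis using big by blast
  next
    fix s i t j assume "a = ZL s i" "b = XL t j"
    then have "\<bar>y (n - 1)\<bar> \<le> 2" "3 \<le> of_int s * y (n - 1)" "s \<in> {1, -1}" using a b bd[of "y n"] by auto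
    then show ?thesis using big by blast
  next
    fix s i t j assume "a = ZL s i" "b = YL t j"
    then have "\<bar>y n\<bar> \<le> 2" "3 \<le> of_int t * y n" "t \<in> {1, -1}" using a b bd[of "y n"] by auto
    then show ?thesis using big by blast
  qed
qed

section \<open>Realisation of symbol sequences\<close>

text \<open>Take the first time \<open>b'\<close> at which \<open>r\<close> is reached, then the
  last time \<open>a'\<close> before it at which \<open>l\<close> is reached. Leaving the strip in
  between would, by the intermediate value theorem, contradict one of the two choices.\<close>

lemma crossing_up:
  fixes f :: "real \<Rightarrow> real"
  assumes "a \<le> b" "continuous_on {a..b} f" "f a \<le> l" "r \<le> f b" "l \<le> r"
  shows "\<exists>a' b'. a \<le> a' \<and> a' \<le> b' \<and> b' \<le> b \<and> f a' = l \<and> f b' = r \<and> (\<forall>t\<in>{a'..b'}. f t \<in> {l..r})"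
proof -
  have compact_level: "compact {t\<in>{c..d}. f t = v}" if "a \<le> c" "d \<le> b" for c d v
  proof -
    have "continuous_on {c..d} f" using assms(2) that by (auto intro: continuous_on_subset)
    then have "closed {t\<in>{c..d}. f t = v}"
      by (intro continuous_closed_preimage_constant) auto
    moreover have "{t\<in>{c..d}. f t = v} = {c..d} \<inter> {t\<in>{c..d}. f t = v}" by auto
    ultimately show ?thesis by (metis compact_Icc compact_Int_closed)
  qed
  have ivt: "\<exists>t. c \<le> t \<and> t \<le> d \<and> f t = v" if "a \<le> c" "c \<le> d" "d \<le> b" "f c \<le> v" "v \<le> f d" for c d v
    using that assms(2) IVT'[of f c v d] continuous_on_subset[of "{a..b}" f "{c..d}"] by auto
  have "{t\<in>{a..b}. f t = r} \<noteq> {}" using ivt[of a b r] assms by auto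
  then obtain b' where b': "b' \<in> {a..b}" "f b' = r" "\<And>t. t \<in> {a..b} \<Longrightarrow> f t = r \<Longrightarrow> b' \<le> t"
    using compact_attains_inf[OF compact_level[of a b r]] by auto
  have "{t\<in>{a..b'}. f t = l} \<noteq> {}" using ivt[of a b' l] assms b' by auto
  then obtain a' where a': "a' \<in> {a..b'}" "f a' = l" "\<And>t. t \<in> {a..b'} \<Longrightarrow> f t = l \<Longrightarrow> t \<le> a'"
    using compact_attains_sup[OF compact_level[of a b' l]] b' by auto
  have "f t \<in> {l..r}" if t: "t \<in> {a'..b'}" for t
  proof (rule ccontr)
    assume "f t \<notin> {l..r}"
    then consider "f t < l" | "r < f t" by force
    then show False
    proof cases
      case 1
      then obtain u where "t \<le> u" "u \<le> b'" "f u = l" using ivt[of t b' l] t a' b' assms by auto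
      moreover from this have "u \<le> a'" using a' t by auto
      ultimately have "t = u" using t by simp
      then show False using 1 \<open>f u = l\<close> by simp
    next
      case 2
      then obtain u where "a \<le> u" "u \<le> t" "f u = r" using ivt[of a t r] t a' b' assms by auto
      moreover from this have "b' \<le> u" using b' t by auto
      ultimately have "t = u" using t by simp
      then show False using 2 \<open>f u = r\<close> by simp
    qed
  qed
  then show ?thesis using a' b' by (intro exI[of _ a'] exI[of _ b']) auto
qed

lemma crossing_subinterval:
  fixes f :: "real \<Rightarrow> real"
  assumes "a \<le> b" "continuous_on {a..b} f" "l \<le> r"
    "f a \<le> l \<and> r \<le> f b \<or> r \<le> f a \<and> f b \<le> l"
  shows "\<exists>a' b'. a \<le> a' \<and> a' \<le> b' \<and> b' \<le> b \<and> (f a' = l \<and> f b' = r \<or> f a' = r \<and> f b' = l) \<and>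
    (\<forall>t\<in>{a'..b'}. f t \<in> {l..r})"
  using assms(4)
proof
  assume "f a \<le> l \<and> r \<le> f b"
  then show ?thesis using crossing_up[OF assms(1,2), of l r] assms(3) by blast
next
  assume "r \<le> f a \<and> f b \<le> l"
  then have "\<exists>a' b'. a \<le> a' \<and> a' \<le> b' \<and> b' \<le> b \<and> - f a' = - r \<and> - f b' = - l \<and>
      (\<forall>t\<in>{a'..b'}. - f t \<in> {- r..- l})"
    using assms by (intro crossing_up) (auto intro: continuous_intros)
  then show ?thesis by fastforce
qed

text \<open>Both directions of travel are allowed, since some edges reverse the orientation.\<close>

definition crossing :: "(real \<Rightarrow> real \<times> real \<times> real) \<Rightarrow> real \<Rightarrow> real \<Rightarrow> int \<Rightarrow> state \<Rightarrow> bool" where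
  "crossing \<gamma> \<alpha> \<beta> n a \<longleftrightarrow> \<alpha> \<le> \<beta> \<and> (\<forall>t\<in>{\<alpha>..\<beta>}. region (xs (\<gamma> t)) (ys (\<gamma> t)) n a) \<and>
     (coord (ys (\<gamma> \<alpha>)) n a = lo (index a) \<and> coord (ys (\<gamma> \<beta>)) n a = hi (index a) \<or>
      coord (ys (\<gamma> \<alpha>)) n a = hi (index a) \<and> coord (ys (\<gamma> \<beta>)) n a = lo (index a))"

lemma continuous_coord: "continuous_on S (\<lambda>p. coord (ys p) n a)"
  by (cases a) (simp_all add: continuous_ys)

lemma crossing_step:
  assumes V: "V \<ge> 1000" and e: "edge a b" "valid a" "valid b"
    and \<gamma>: "continuous_on {\<alpha>..\<beta>} \<gamma>" "\<And>t. t \<in> {\<alpha>..\<beta>} \<Longrightarrow> \<gamma> t \<in> trace_surface V"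
    and c: "crossing \<gamma> \<alpha> \<beta> n a"
  shows "\<exists>\<alpha>' \<beta>'. \<alpha> \<le> \<alpha>' \<and> \<beta>' \<le> \<beta> \<and> crossing \<gamma> \<alpha>' \<beta>' (n + 1) b"
proof -
  obtain \<sigma> :: real where \<sigma>: "\<sigma> \<in> {1, -1}" and
    sw: "\<And>x y. orbit V x y \<Longrightarrow> region x y n a \<Longrightarrow>
     sweeps \<sigma> a y n b \<and> (coord y (n + 1) b \<in> band (index b) \<longrightarrow> region x y (n + 1) b)"
    using edge_sweeps[OF e V, of n] by blast
  define f where "f t = coord (ys (\<gamma> t)) (n + 1) b" for t
  have o: "sweeps \<sigma> a (ys (\<gamma> t)) n b" "f t \<in> band (index b) \<Longrightarrow> region (xs (\<gamma> t)) (ys (\<gamma> t)) (n + 1) b"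
    if "t \<in> {\<alpha>..\<beta>}" for t
    using sw[OF orbit_xs_ys[OF \<gamma>(2)[OF that]]] c that unfolding f_def crossing_def by auto
  have "\<alpha> \<le> \<beta>" using c by (simp add: crossing_def)
  have cont: "continuous_on {\<alpha>..\<beta>} f"
    unfolding f_def by (rule continuous_on_compose2[OF continuous_coord[of UNIV] \<gamma>(1)]) auto
  have lh: "lo (index b) \<le> hi (index b)"
    using index_valid[OF e(3)] by (auto simp: lo_def hi_def)
  have ends: "f \<alpha> \<le> lo (index b) \<and> hi (index b) \<le> f \<beta> \<or> hi (index b) \<le> f \<alpha> \<and> f \<beta> \<le> lo (index b)"
    (is ?ends)
  proof -
    have sweep: "sweeps \<sigma> a (ys (\<gamma> \<alpha>)) n b" "sweeps \<sigma> a (ys (\<gamma> \<beta>)) n b" using o(1) \<open>\<alpha> \<le> \<beta>\<close> by simp_all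
    have "coord (ys (\<gamma> \<alpha>)) n a = lo (index a) \<and> coord (ys (\<gamma> \<beta>)) n a = hi (index a) \<or>
      coord (ys (\<gamma> \<alpha>)) n a = hi (index a) \<and> coord (ys (\<gamma> \<beta>)) n a = lo (index a)"
      using c by (simp add: crossing_def)
    moreover have "\<sigma> = 1 \<or> \<sigma> = -1" using \<sigma> by simp
    ultimately show ?ends using sweep unfolding sweeps_def f_def by (elim disjE conjE) simp_all
  qed
  from crossing_subinterval[OF \<open>\<alpha> \<le> \<beta>\<close> cont lh ends]
  obtain \<alpha>' \<beta>' where *: "\<alpha> \<le> \<alpha>'" "\<alpha>' \<le> \<beta>'" "\<beta>' \<le> \<beta>"
    "f \<alpha>' = lo (index b) \<and> f \<beta>' = hi (index b) \<or> f \<alpha>' = hi (index b) \<and> f \<beta>' = lo (index b)"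
    "\<And>t. t \<in> {\<alpha>'..\<beta>'} \<Longrightarrow> f t \<in> {lo (index b)..hi (index b)}"
    by blast
  have "crossing \<gamma> \<alpha>' \<beta>' (n + 1) b"
    unfolding crossing_def f_def[symmetric]
  proof (intro conjI ballI)
    show "region (xs (\<gamma> t)) (ys (\<gamma> t)) (n + 1) b" if "t \<in> {\<alpha>'..\<beta>'}" for t
      using *(1-3) *(5)[OF that] that by (intro o(2)) (simp_all add: band_def)
  qed (use * in blast)+
  then show ?thesis using * by blast
qed

definition admissible :: "(int \<Rightarrow> state) \<Rightarrow> bool" where
  "admissible a \<longleftrightarrow> (\<forall>n. valid (a n) \<and> edge (a n) (a (n + 1)))"

lemma crossing_admissible:
  assumes V: "V \<ge> 1000" and a: "admissible a"
    and \<gamma>: "continuous_on {\<alpha>..\<beta>} \<gamma>" "\<And>t. t \<in> {\<alpha>..\<beta>} \<Longrightarrow> \<gamma> t \<in> trace_surface V"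
    and c: "crossing \<gamma> \<alpha> \<beta> m (a m)"
  shows "\<exists>\<alpha>' \<beta>'. \<alpha> \<le> \<alpha>' \<and> \<beta>' \<le> \<beta> \<and> crossing \<gamma> \<alpha>' \<beta>' (m + int N) (a (m + int N)) \<and>
    (\<forall>t\<in>{\<alpha>'..\<beta>'}. \<forall>k\<in>{m..m + int N}. region (xs (\<gamma> t)) (ys (\<gamma> t)) k (a k))"
proof (induction N)
  case 0
  then show ?case using c by (intro exI[of _ \<alpha>] exI[of _ \<beta>]) (auto simp: crossing_def)
next
  case (Suc N)
  then obtain \<alpha>' \<beta>' where *: "\<alpha> \<le> \<alpha>'" "\<beta>' \<le> \<beta>" "crossing \<gamma> \<alpha>' \<beta>' (m + int N) (a (m + int N))"
    "\<forall>t\<in>{\<alpha>'..\<beta>'}. \<forall>k\<in>{m..m + int N}. region (xs (\<gamma> t)) (ys (\<gamma> t)) k (a k)" by blast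
  have "\<exists>\<alpha>'' \<beta>''. \<alpha>' \<le> \<alpha>'' \<and> \<beta>'' \<le> \<beta>' \<and> crossing \<gamma> \<alpha>'' \<beta>'' (m + int N + 1) (a (m + int N + 1))"
  proof (rule crossing_step[OF V _ _ _ _ _ *(3)])
    show "continuous_on {\<alpha>'..\<beta>'} \<gamma>" using \<gamma>(1) * by (auto intro: continuous_on_subset)
    show "edge (a (m + int N)) (a (m + int N + 1))" "valid (a (m + int N))" "valid (a (m + int N + 1))"
      using a by (simp_all add: admissible_def)
    show "\<gamma> t \<in> trace_surface V" if "t \<in> {\<alpha>'..\<beta>'}" for t using \<gamma>(2) * that by simp
  qed
  then obtain \<alpha>'' \<beta>'' where **: "\<alpha>' \<le> \<alpha>''" "\<beta>'' \<le> \<beta>'"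
    "crossing \<gamma> \<alpha>'' \<beta>'' (m + int N + 1) (a (m + int N + 1))" by blast
  have "region (xs (\<gamma> t)) (ys (\<gamma> t)) k (a k)"
    if "t \<in> {\<alpha>''..\<beta>''}" "k \<in> {m..m + int (Suc N)}" for t k
  proof (cases "k = m + int N + 1")
    case True
    then show ?thesis using **(3) that by (auto simp: crossing_def)
  next
    case False
    then show ?thesis using *(4) ** that by auto
  qed
  moreover have "m + int (Suc N) = m + int N + 1" by simp
  moreover have "\<alpha> \<le> \<alpha>''" "\<beta>'' \<le> \<beta>" using *(1,2) **(1,2) by simp_all
  ultimately show ?case using **(3) by metis
qed

lemma crossing_exists:
  assumes V: "V \<ge> 1000" and "valid a"
  shows "\<exists>\<gamma> \<alpha> \<beta> n. continuous_on {\<alpha>..\<beta>} \<gamma> \<and> (\<forall>t\<in>{\<alpha>..\<beta>}. \<gamma> t \<in> trace_surface V) \<and> crossing \<gamma> \<alpha> \<beta> n a"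
    (is "?P a")
proof -
  have X: "?P (XL s j)" if v: "valid (XL s j)" for s j
  proof -
    \<comment> \<open>The slice z = 0 of the surface, a circle, solved for the first coordinate with
      sign \<open>s\<close>; the parameter is the small coordinate itself.\<close>
    define \<gamma> where "\<gamma> t = (of_int s * sqrt (4 + V\<^sup>2 - t\<^sup>2), t, 0::real)" for t
    have sq: "t\<^sup>2 \<le> 4" if "t \<in> {lo j..hi j}" for t
      using that lo_hi_bounds[of j] abs_le_square_iff[of t 2] by auto
    have s: "(of_int s)\<^sup>2 = (1::real)" using v by auto
    have seq: "xs (\<gamma> t) 0 = of_int s * sqrt (4 + V\<^sup>2 - t\<^sup>2)" "ys (\<gamma> t) 0 = t" "ys (\<gamma> t) (- 1) = 0" for t
      using tz_eq[of 0 "\<gamma> t"] by (simp_all add: \<gamma>_def)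
    have "continuous_on {lo j..hi j} \<gamma>" unfolding \<gamma>_def by (intro continuous_intros)
    moreover have "\<gamma> t \<in> trace_surface V" if "t \<in> {lo j..hi j}" for t
    proof -
      have "0 \<le> 4 + V\<^sup>2 - t\<^sup>2" using sq[OF that] zero_le_power2[of V] by linarith
      then show ?thesis using s by (simp add: \<gamma>_def trace_surface_iff surf_def power_mult_distrib)
    qed
    moreover have "crossing \<gamma> (lo j) (hi j) 0 (XL s j)"
    proof -
      have "lo j \<le> hi j" using v by (auto simp: lo_def hi_def)
      moreover have "0 \<le> of_int s * (of_int s * sqrt (4 + V\<^sup>2 - t\<^sup>2))" if "t \<in> {lo j..hi j}" for t
      proof -
        have "0 \<le> 4 + V\<^sup>2 - t\<^sup>2" using sq[OF that] zero_le_power2[of V] by linarith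
        then have "0 \<le> sqrt (4 + V\<^sup>2 - t\<^sup>2)" by simp
        then show ?thesis using v by auto
      qed
      ultimately show ?thesis by (auto simp: crossing_def seq band_def)
    qed
    ultimately show ?thesis by blast
  qed
  have next_state: "?P b" if pa: "?P a" and e: "edge a b" "valid a" "valid b" for a b
  proof -
    from pa obtain \<gamma> \<alpha> \<beta> n where *: "continuous_on {\<alpha>..\<beta>} \<gamma>" "\<forall>t\<in>{\<alpha>..\<beta>}. \<gamma> t \<in> trace_surface V"
      "crossing \<gamma> \<alpha> \<beta> n a" by blast
    obtain \<alpha>' \<beta>' where **: "\<alpha> \<le> \<alpha>'" "\<beta>' \<le> \<beta>" "crossing \<gamma> \<alpha>' \<beta>' (n + 1) b"
      using crossing_step[OF V e *(1) _ *(3)] *(2) by blast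
    moreover have "continuous_on {\<alpha>'..\<beta>'} \<gamma>" using *(1) ** by (auto intro: continuous_on_subset)
    moreover have "\<forall>t\<in>{\<alpha>'..\<beta>'}. \<gamma> t \<in> trace_surface V" using *(2) ** by auto
    ultimately show ?thesis by blast
  qed
  \<comment> \<open>No explicit curve is needed for the other states: \<open>XL s 1\<close> precedes
    \<open>YL s j\<close>, which precedes \<open>ZL s j\<close>, and crossings propagate along
    edges.\<close>
  have Y: "?P (YL s j)" if "valid (YL s j)" for s j
    using that by (intro next_state[of "XL s 1" "YL s j"] X) auto
  show ?thesis
  proof (cases a)
    case (ZL s j)
    then show ?thesis using \<open>valid a\<close> next_state[of "YL s j" "ZL s j"] Y[of s j] by simp
  qed (use X Y \<open>valid a\<close> in auto)
qed

section \<open>Compactness and bi-infinite itineraries\<close>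

lemma region_tz:
  "region (xs (tz c p)) (ys (tz c p)) k a = region (xs p) (ys p) (k + c) a"
  by (cases a) (simp_all add: seq_tz algebra_simps)

lemma closed_region: "closed {p. region (xs p) (ys p) k a}"
  by (cases a) (auto simp: band_def intro!: closed_Collect_conj closed_Collect_le continuous_intros
      continuous_xs continuous_ys)

lemma closed_trace_surface: "closed (trace_surface V)"
proof -
  have "trace_surface V = {p. (fst p)\<^sup>2 + (fst (snd p))\<^sup>2 + (snd (snd p))\<^sup>2
      - fst p * fst (snd p) * snd (snd p) = 4 + V\<^sup>2}"
    by (auto simp: trace_surface_def)
  then show ?thesis by (auto intro!: closed_Collect_eq continuous_intros)
qed

lemma region_bounded:
  assumes o: "orbit V x y" "V \<ge> 1000" and "valid a" "region x y n a"
  shows "\<bar>x n\<bar> \<le> 10 * V" "\<bar>y n\<bar> \<le> 10 * V" "\<bar>y (n - 1)\<bar> \<le> 10 * V"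
proof -
  have large: "\<bar>x k\<bar> \<le> 3 \<and> \<bar>y k\<bar> \<le> V + 1"
    if "\<bar>y (k - 1)\<bar> \<le> 2" "\<bar>y (k + 1)\<bar> \<le> 2" "3 \<le> of_int s * y k" "s \<in> {1, -1}" for k and s :: int
  proof -
    have "3 \<le> \<bar>y k\<bar>" using that by auto
    have 1: "\<bar>x k * y k\<bar> \<le> 4" using orbitD(1)[OF o(1), of k] that(1,2) by linarith
    have "\<bar>x k\<bar> * 3 \<le> \<bar>x k\<bar> * \<bar>y k\<bar>" using \<open>3 \<le> \<bar>y k\<bar>\<close> by (intro mult_left_mono) auto
    then have "\<bar>x k\<bar> \<le> 3" using 1 by (simp add: abs_mult)
    then show ?thesis using surf_y_bounds(2)[OF orbitD(3)[OF o(1), of k]] 1 that o(2) by simp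
  qed
  have "\<bar>x n\<bar> \<le> 10 * V \<and> \<bar>y n\<bar> \<le> 10 * V \<and> \<bar>y (n - 1)\<bar> \<le> 10 * V"
  proof (cases a)
    case (XL s j)
    then have "\<bar>y n\<bar> \<le> 8/5" "\<bar>y (n - 1)\<bar> \<le> 2" using assms band_bound[of "y n" j] by auto
    then show ?thesis using surf_x_bounds(2)[OF orbitD(3)[OF o(1), of n]] o(2) by simp
  next
    case (YL s j)
    then show ?thesis using assms band_bound[of "y (n + 1)" j] large[of n s] by auto
  next
    case (ZL s j)
    then have "\<bar>y n\<bar> \<le> 8/5" using assms band_bound[of "y n" j] by auto
    moreover from this have l: "\<bar>x (n - 1)\<bar> \<le> 3" "\<bar>y (n - 1)\<bar> \<le> V + 1"
      using assms ZL large[of "n - 1" s] by auto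
    moreover have "\<bar>y (n - 1) * y n\<bar> \<le> (V + 1) * 2" using calculation by (intro product_abs_le) auto
    ultimately show ?thesis using orbitD(4)[OF o(1), of n] o(2) by (auto simp: abs_le_iff)
  qed
  then show "\<bar>x n\<bar> \<le> 10 * V" "\<bar>y n\<bar> \<le> 10 * V" "\<bar>y (n - 1)\<bar> \<le> 10 * V" by auto
qed

lemma compact_region:
  assumes "V \<ge> 1000" "valid a"
  shows "compact {p \<in> trace_surface V. region (xs p) (ys p) 0 a}" (is "compact ?K")
proof -
  have "?K \<subseteq> cball 0 (10 * V) \<times> cball 0 (10 * V) \<times> cball 0 (10 * V)"
  proof
    fix p assume p: "p \<in> ?K"
    have "p = (xs p 0, ys p 0, ys p (0 - 1))" using tz_eq[of 0 p] by simp
    moreover have "\<bar>xs p 0\<bar> \<le> 10 * V" "\<bar>ys p 0\<bar> \<le> 10 * V" "\<bar>ys p (0 - 1)\<bar> \<le> 10 * V"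
      using region_bounded[OF orbit_xs_ys, of p V a 0] p assms by auto
    ultimately show "p \<in> cball 0 (10 * V) \<times> cball 0 (10 * V) \<times> cball 0 (10 * V)"
      by (metis SigmaI mem_cball_0 real_norm_def)
  qed
  moreover have "?K = trace_surface V \<inter> {p. region (xs p) (ys p) 0 a}" by auto
  then have "closed ?K" by (simp add: closed_Int closed_trace_surface closed_region)
  ultimately show ?thesis
    using bounded_subset[OF _ \<open>?K \<subseteq> _\<close>]
    by (simp add: compact_eq_bounded_closed bounded_Times)
qed

text \<open>Forward stretching alone realises any finite window, by starting from a curve that
  crosses the leftmost state. The points realising larger and larger windows form nested compact
  sets.\<close>

lemma realisation:
  assumes V: "V \<ge> 1000" and a: "admissible a"
  shows "\<exists>p\<in>trace_surface V. \<forall>k. region (xs p) (ys p) k (a k)"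
proof -
  define K where "K M = {p \<in> trace_surface V. \<forall>k\<in>{- int M..int M}. region (xs p) (ys p) k (a k)}" for M
  have K0: "compact (K 0)" using compact_region[OF V, of "a 0"] a by (simp add: K_def admissible_def)
  have cl: "closed (K M)" for M
  proof -
    have "K M = trace_surface V \<inter> (\<Inter>k\<in>{- int M..int M}. {p. region (xs p) (ys p) k (a k)})"
      by (auto simp: K_def)
    then show ?thesis by (auto intro!: closed_Int closed_INT closed_trace_surface closed_region)
  qed
  have mono: "K M \<subseteq> K N" if "N \<le> M" for M N
    using that by (auto simp: K_def)
  have "compact (K M)" for M
    using compact_Int_closed[OF K0 cl[of M]] mono[of 0 M] by (simp add: Int_absorb1)
  moreover have "K M \<noteq> {}" for M
  proof -
    have "valid (a (- int M))" using a by (simp add: admissible_def)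
    from crossing_exists[OF V this] obtain \<gamma> \<alpha> \<beta> n where *: "continuous_on {\<alpha>..\<beta>} \<gamma>"
      "\<And>t. t \<in> {\<alpha>..\<beta>} \<Longrightarrow> \<gamma> t \<in> trace_surface V" "crossing \<gamma> \<alpha> \<beta> n (a (- int M))" by blast
    \<comment> \<open>\<open>crossing_exists\<close> dictates its own time \<open>n\<close>; the
      shift by \<open>c\<close> moves it to \<open>- int M\<close>, so that \<open>2 * M\<close>
      further steps reach \<open>int M\<close>.\<close>
    define c where "c = n + int M"
    have "admissible (\<lambda>k. a (k - c))"
      unfolding admissible_def
    proof (intro allI conjI)
      fix k
      show "valid (a (k - c))" "edge (a (k - c)) (a (k + 1 - c))"
        using a[unfolded admissible_def, rule_format, of "k - c"] by (simp_all add: algebra_simps)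
    qed
    moreover have "crossing \<gamma> \<alpha> \<beta> n (a (n - c))" using *(3) by (simp add: c_def)
    ultimately obtain \<alpha>' \<beta>' where **: "\<alpha> \<le> \<alpha>'" "\<beta>' \<le> \<beta>"
      "crossing \<gamma> \<alpha>' \<beta>' (n + int (2 * M)) (a (n + int (2 * M) - c))"
      "\<forall>t\<in>{\<alpha>'..\<beta>'}. \<forall>k\<in>{n..n + int (2 * M)}. region (xs (\<gamma> t)) (ys (\<gamma> t)) k (a (k - c))"
      using crossing_admissible[OF V _ *(1,2), of "\<lambda>k. a (k - c)" n "2 * M"] by blast
    have le: "\<alpha>' \<le> \<beta>'" using **(3) by (simp add: crossing_def)
    have "tz c (\<gamma> \<alpha>') \<in> K M"
      unfolding K_def
    proof (intro CollectI conjI ballI)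
      show "tz c (\<gamma> \<alpha>') \<in> trace_surface V" using *(2)[of \<alpha>'] le ** by simp
      fix k assume k: "k \<in> {- int M..int M}"
      have "region (xs (\<gamma> \<alpha>')) (ys (\<gamma> \<alpha>')) (k + c) (a (k + c - c))"
        using **(4)[rule_format, of \<alpha>' "k + c"] le k by (simp add: c_def)
      then show "region (xs (tz c (\<gamma> \<alpha>'))) (ys (tz c (\<gamma> \<alpha>'))) k (a k)" by (simp add: region_tz)
    qed
    then show ?thesis by blast
  qed
  ultimately have "\<Inter>(range K) \<noteq> {}" using mono by (intro compact_nest) auto
  then obtain p where p: "\<And>M. p \<in> K M" by blast
  have "region (xs p) (ys p) k (a k)" for k
  proof -
    have "k \<in> {- int (nat \<bar>k\<bar>)..int (nat \<bar>k\<bar>)}" by auto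
    then show ?thesis using p[of "nat \<bar>k\<bar>"] unfolding K_def by blast
  qed
  then show ?thesis using p[of 0] by (auto simp: K_def)
qed

section \<open>Displacements between orbits\<close>

text \<open>
  The recursion is quadratic and the surface is multilinear up to squares, so the difference of two
  orbits solves the linearised equations exactly, with coefficients taken at the midpoint; only the
  cubic term leaves a correction \<open>\<kappa>\<close>. One set of estimates therefore covers both expansiveness
  (differences) and hyperbolicity (tangent vectors, where the two orbits coincide).
\<close>

lemma linear_bound:
  fixes A B C u v w :: real
  assumes "A * u + B * v + C * w = 0" "a \<le> \<bar>A\<bar>" "\<bar>B\<bar> \<le> b" "\<bar>C\<bar> \<le> c"
  shows "a * \<bar>u\<bar> \<le> b * \<bar>v\<bar> + c * \<bar>w\<bar>"
proof -
  have "a * \<bar>u\<bar> \<le> \<bar>A * u\<bar>" using assms(2) by (simp add: abs_mult mult_right_mono)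
  also have "\<bar>A * u\<bar> \<le> \<bar>B * v\<bar> + \<bar>C * w\<bar>" using assms(1) by linarith
  also have "\<dots> \<le> b * \<bar>v\<bar> + c * \<bar>w\<bar>"
    using assms(3,4) by (intro add_mono) (simp_all add: abs_mult mult_right_mono)
  finally show ?thesis .
qed

text \<open>The coefficient of \<open>u\<close> has size about 2 \<open>V\<close>, the other two at
  most about 3/2 \<open>V\<close>.\<close>

lemma x_displacement_bound:
  fixes X Y Z \<kappa> u v w :: real
  assumes "V \<ge> 1000" "(2 * X - Y * Z - \<kappa>) * u + (2 * Y - X * Z) * v + (2 * Z - X * Y) * w = 0"
    "\<bar>\<kappa>\<bar> \<le> 4" "V - 10 \<le> \<bar>X\<bar>" "\<bar>X\<bar> \<le> V + 10" "\<bar>Y\<bar> \<le> 3/2" "\<bar>Z\<bar> \<le> 3/2"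
  shows "\<bar>u\<bar> \<le> \<bar>v\<bar> + \<bar>w\<bar>"
proof -
  have YZ: "\<bar>Y * Z\<bar> \<le> (3/2) * (3/2)" using assms by (intro product_abs_le) auto
  have XZ: "\<bar>X * Z\<bar> \<le> 3/2 * V + 15"
    using product_abs_le[of X "V + 10" Z "3/2"] assms by (simp add: algebra_simps)
  have XY: "\<bar>X * Y\<bar> \<le> 3/2 * V + 15"
    using product_abs_le[of X "V + 10" Y "3/2"] assms by (simp add: algebra_simps)
  have "(2 * V - 27) * \<bar>u\<bar> \<le> (3/2 * V + 18) * \<bar>v\<bar> + (3/2 * V + 18) * \<bar>w\<bar>"
  proof (rule linear_bound[OF assms(2)])
    show "2 * V - 27 \<le> \<bar>2 * X - Y * Z - \<kappa>\<bar>" using assms(3,4) YZ by linarith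
    show "\<bar>2 * Y - X * Z\<bar> \<le> 3/2 * V + 18" using assms(6) XZ by linarith
    show "\<bar>2 * Z - X * Y\<bar> \<le> 3/2 * V + 18" using assms(7) XY by linarith
  qed
  also have "\<dots> \<le> (2 * V - 27) * \<bar>v\<bar> + (2 * V - 27) * \<bar>w\<bar>"
    using assms(1) by (intro add_mono mult_right_mono) auto
  also have "\<dots> = (2 * V - 27) * (\<bar>v\<bar> + \<bar>w\<bar>)" by (simp add: algebra_simps)
  finally show ?thesis by (rule mult_left_le_imp_le) (use assms(1) in simp)
qed

text \<open>Midpoints of two orbits need not form an orbit, so the size estimates are assumed for
  \<open>X\<close> and \<open>Y\<close> rather than derived. The alternative in
  \<open>between\<close> reflects large neighbours of opposite and of equal sign; each case supplies
  a coefficient of size at least about \<open>V\<close> for \<open>v n\<close>.\<close>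

locale displacement =
  fixes V :: real and X Y u v \<kappa> \<kappa>' :: "int \<Rightarrow> real" and large :: "int \<Rightarrow> bool"
  assumes V: "V \<ge> 1000"
    and rec_v: "v (n + 1) + v (n - 1) = X n * v n + Y n * u n"
    and rec_u: "u (n + 1) + u n = Y n * v (n + 1) + Y (n + 1) * v n"
    and tangent: "(2 * X n - Y n * Y (n - 1) - \<kappa> n) * u n + (2 * Y n - X n * Y (n - 1)) * v n
        + (2 * Y (n - 1) - X n * Y n) * v (n - 1) = 0" "\<bar>\<kappa> n\<bar> \<le> 4"
    and tangent': "(2 * X n - Y n * Y (n + 1) - \<kappa>' n) * u n + (2 * Y n - X n * Y (n + 1)) * v n
        + (2 * Y (n + 1) - X n * Y n) * v (n + 1) = 0" "\<bar>\<kappa>' n\<bar> \<le> 4"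
    and large_neighbours: "large n \<Longrightarrow> \<not> large (n - 1)" "large n \<Longrightarrow> \<not> large (n + 1)"
    and large_Y: "large n \<Longrightarrow> V - 1 \<le> \<bar>Y n\<bar>" "large n \<Longrightarrow> \<bar>Y n\<bar> \<le> V + 1"
    and large_X: "large n \<Longrightarrow> \<bar>X n\<bar> \<le> 1/100"
    and small_Y: "\<not> large n \<Longrightarrow> \<bar>Y n\<bar> \<le> 3/2"
    and small_X: "\<not> large n \<Longrightarrow> \<not> large (n - 1) \<or> \<not> large (n + 1) \<Longrightarrow> V - 10 \<le> \<bar>X n\<bar>"
       "\<not> large n \<Longrightarrow> \<not> large (n - 1) \<or> \<not> large (n + 1) \<Longrightarrow> \<bar>X n\<bar> \<le> V + 10"
    and between: "\<not> large n \<Longrightarrow> large (n - 1) \<Longrightarrow> large (n + 1) \<Longrightarrow>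
        2 * V - 2 \<le> \<bar>Y (n - 1) - Y (n + 1)\<bar> \<or> V \<le> \<bar>X n + Y n * Y (n - 1)\<bar>"
begin

lemma rec_u': "u n + u (n - 1) = Y (n - 1) * v n + Y n * v (n - 1)"
  using rec_u[of "n - 1"] by simp

text \<open>The recursion for \<open>v\<close> bounds \<open>u n\<close>, because its coefficient
  \<open>Y n\<close> is large. The tangency equation then bounds \<open>v n\<close>, whose
  coefficient has size about 2 \<open>V\<close>, by 8/10 of \<open>u n\<close> and little
  else.\<close>

lemma large_displacement:
  assumes "large n"
  shows "\<bar>u n\<bar> \<le> (\<bar>v (n - 1)\<bar> + \<bar>v (n + 1)\<bar>) / 100" "\<bar>v n\<bar> \<le> (\<bar>v (n - 1)\<bar> + \<bar>v (n + 1)\<bar>) / 50"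
proof -
  let ?S = "\<bar>v (n - 1)\<bar> + \<bar>v (n + 1)\<bar>"
  note Y = large_Y[OF assms] and X = large_X[OF assms]
  have Z: "\<bar>Y (n - 1)\<bar> \<le> 3/2" using small_Y large_neighbours assms by blast
  have "Y n * u n + X n * v n + (- 1) * (v (n - 1) + v (n + 1)) = 0" using rec_v[of n] by simp
  from linear_bound[OF this, of "V - 1" "1/100" 1] have
    "(V - 1) * \<bar>u n\<bar> \<le> 1/100 * \<bar>v n\<bar> + \<bar>v (n - 1) + v (n + 1)\<bar>" using Y X by simp
  moreover have "999 * \<bar>u n\<bar> \<le> (V - 1) * \<bar>u n\<bar>" using V by (intro mult_right_mono) auto
  ultimately have 1: "999 * \<bar>u n\<bar> \<le> 1/100 * \<bar>v n\<bar> + ?S" by linarith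
  have YZ: "\<bar>Y n * Y (n - 1)\<bar> \<le> 3/2 * V + 3/2"
    using product_abs_le[of "Y n" "V + 1" "Y (n - 1)" "3/2"] Y Z by (simp add: algebra_simps)
  have XZ: "\<bar>X n * Y (n - 1)\<bar> \<le> 1/100 * (3/2)" using X Z by (intro product_abs_le) auto
  have XY: "\<bar>X n * Y n\<bar> \<le> 1/100 * V + 1/100"
    using product_abs_le[of "X n" "1/100" "Y n" "V + 1"] X Y by (simp add: algebra_simps)
  have "(2 * Y n - X n * Y (n - 1)) * v n + (2 * X n - Y n * Y (n - 1) - \<kappa> n) * u n
        + (2 * Y (n - 1) - X n * Y n) * v (n - 1) = 0"
    using tangent(1)[of n] by simp
  then have "(2 * V - 3) * \<bar>v n\<bar> \<le> (3/2 * V + 6) * \<bar>u n\<bar> + (1/100 * V + 4) * \<bar>v (n - 1)\<bar>"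
  proof (rule linear_bound)
    show "2 * V - 3 \<le> \<bar>2 * Y n - X n * Y (n - 1)\<bar>" using Y(1) XZ by linarith
    show "\<bar>2 * X n - Y n * Y (n - 1) - \<kappa> n\<bar> \<le> 3/2 * V + 6" using X YZ tangent(2)[of n] by linarith
    show "\<bar>2 * Y (n - 1) - X n * Y n\<bar> \<le> 1/100 * V + 4" using Z XY by linarith
  qed
  also have "\<dots> \<le> (8/10 * (2 * V - 3)) * \<bar>u n\<bar> + (1/100 * (2 * V - 3)) * \<bar>v (n - 1)\<bar>"
    using V by (intro add_mono mult_right_mono) auto
  also have "\<dots> = (2 * V - 3) * (8/10 * \<bar>u n\<bar> + 1/100 * \<bar>v (n - 1)\<bar>)" by (simp add: algebra_simps)
  finally have 2: "\<bar>v n\<bar> \<le> 8/10 * \<bar>u n\<bar> + 1/100 * \<bar>v (n - 1)\<bar>"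
    by (rule mult_left_le_imp_le) (use V in simp)
  show "\<bar>u n\<bar> \<le> ?S / 100" "\<bar>v n\<bar> \<le> ?S / 50"
    using 1 2 abs_ge_zero[of "v (n + 1)"] abs_ge_zero[of "v (n - 1)"] by argo+
qed

lemma u_bound:
  assumes "\<not> large n" "\<not> large (n - 1)"
  shows "\<bar>u n\<bar> \<le> \<bar>v n\<bar> + \<bar>v (n - 1)\<bar>"
  using x_displacement_bound[OF V tangent] small_X small_Y assms by blast

lemma u_bound':
  assumes "\<not> large n" "\<not> large (n + 1)"
  shows "\<bar>u n\<bar> \<le> \<bar>v n\<bar> + \<bar>v (n + 1)\<bar>"
  using x_displacement_bound[OF V tangent'] small_X small_Y assms by blast

text \<open>The nearest non-large index on the left; large indices are never adjacent, so one skip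
  suffices.\<close>

definition pre :: "int \<Rightarrow> int" where
  "pre n = (if large (n - 1) then n - 2 else n - 1)"

definition suc :: "int \<Rightarrow> int" where
  "suc n = (if large (n + 1) then n + 2 else n + 1)"

lemma small_displacement_outside:
  assumes n: "\<not> large n" and "\<not> large (n - 1) \<or> \<not> large (n + 1)"
    and u: "\<bar>u n\<bar> \<le> \<bar>v n\<bar> + \<bar>v (pre n)\<bar> + \<bar>v (suc n)\<bar>"
  shows "\<bar>v n\<bar> \<le> (\<bar>v (pre n)\<bar> + \<bar>v (suc n)\<bar>) / 50"
proof -
  have "X n * v n + Y n * u n + (- 1) * (v (n - 1) + v (n + 1)) = 0" using rec_v[of n] by simp
  from linear_bound[OF this, of 990 "3/2" 1]
  have 1: "990 * \<bar>v n\<bar> \<le> 3/2 * \<bar>u n\<bar> + \<bar>v (n - 1) + v (n + 1)\<bar>"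
    using small_X(1)[OF n assms(2)] small_Y[OF n] V by simp
  \<comment> \<open>If \<open>n - 1\<close> is large, its displacement is replaced by those at
    \<open>n - 2\<close> and \<open>n\<close>; the latter share is absorbed by the factor
    990.\<close>
  have 2: "\<bar>v (n - 1)\<bar> \<le> \<bar>v n\<bar> + \<bar>v (pre n)\<bar>"
    using large_displacement(2)[of "n - 1"] by (auto simp: pre_def)
  have 3: "\<bar>v (n + 1)\<bar> \<le> \<bar>v n\<bar> + \<bar>v (suc n)\<bar>"
    using large_displacement(2)[of "n + 1"] by (auto simp: suc_def add.assoc)
  have "\<bar>v (n - 1) + v (n + 1)\<bar> \<le> 2 * \<bar>v n\<bar> + (\<bar>v (pre n)\<bar> + \<bar>v (suc n)\<bar>)"
    using 2 3 abs_triangle_ineq[of "v (n - 1)" "v (n + 1)"] by simp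
  then have "1972 * \<bar>v n\<bar> \<le> 5 * (\<bar>v (pre n)\<bar> + \<bar>v (suc n)\<bar>)" using 1 u by argo
  moreover have "5 * (\<bar>v (pre n)\<bar> + \<bar>v (suc n)\<bar>) \<le> 1972 * ((\<bar>v (pre n)\<bar> + \<bar>v (suc n)\<bar>) / 50)" by simp
  ultimately show ?thesis by argo
qed

lemma small_displacement_between:
  assumes n: "\<not> large n" and l: "large (n - 1)" "large (n + 1)"
  shows "\<bar>v n\<bar> \<le> (\<bar>v (n - 2)\<bar> + \<bar>v (n + 2)\<bar>) / 50"
proof -
  have L: "\<bar>u (n - 1)\<bar> \<le> (\<bar>v (n - 2)\<bar> + \<bar>v n\<bar>) / 100" "\<bar>v (n - 1)\<bar> \<le> (\<bar>v (n - 2)\<bar> + \<bar>v n\<bar>) / 50"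
    using large_displacement[OF l(1)] by simp_all
  have R: "\<bar>u (n + 1)\<bar> \<le> (\<bar>v n\<bar> + \<bar>v (n + 2)\<bar>) / 100" "\<bar>v (n + 1)\<bar> \<le> (\<bar>v n\<bar> + \<bar>v (n + 2)\<bar>) / 50"
    using large_displacement[OF l(2)] by (simp_all add: add.assoc)
  have Y: "\<bar>Y n\<bar> \<le> 3/2" by (rule small_Y[OF n])
  from between[OF n l] show ?thesis
  proof
    assume *: "2 * V - 2 \<le> \<bar>Y (n - 1) - Y (n + 1)\<bar>"
    \<comment> \<open>The linearised form of the identity behind
      \<open>small_between_opposite\<close>: subtracting the two recursions eliminates
      \<open>u n\<close>.\<close>
    have "(Y (n - 1) - Y (n + 1)) * v n + Y n * (v (n - 1) - v (n + 1)) + (- 1) * (u (n - 1) - u (n + 1)) = 0"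
      using rec_u[of n] rec_u'[of n] by (simp add: algebra_simps)
    from linear_bound[OF this, of 1000 "3/2" 1]
    have "1000 * \<bar>v n\<bar> \<le> 3/2 * \<bar>v (n - 1) - v (n + 1)\<bar> + \<bar>u (n - 1) - u (n + 1)\<bar>"
      using * Y V by simp
    also have "\<dots> \<le> 3/2 * (\<bar>v (n - 1)\<bar> + \<bar>v (n + 1)\<bar>) + (\<bar>u (n - 1)\<bar> + \<bar>u (n + 1)\<bar>)"
      by (intro add_mono mult_left_mono abs_triangle_ineq4) simp
    finally have "1000 * \<bar>v n\<bar> \<le> 3/2 * (\<bar>v (n - 1)\<bar> + \<bar>v (n + 1)\<bar>) + (\<bar>u (n - 1)\<bar> + \<bar>u (n + 1)\<bar>)" .
    with L R abs_ge_zero[of "v (n - 2)"] abs_ge_zero[of "v (n + 2)"] show ?thesis by argo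
  next
    assume *: "V \<le> \<bar>X n + Y n * Y (n - 1)\<bar>"
    \<comment> \<open>With equal signs the difference above may vanish. Instead \<open>u n\<close>
      is substituted into the recursion for \<open>v\<close>, where the terms \<open>X n\<close> and
      \<open>Y n * Y (n - 1)\<close> reinforce each other.\<close>
    have u: "u n = Y (n - 1) * v n + Y n * v (n - 1) - u (n - 1)" using rec_u'[of n] by simp
    have eq: "(X n + Y n * Y (n - 1)) * v n + (Y n * Y n - 1) * v (n - 1)
        + (- 1) * (v (n + 1) + Y n * u (n - 1)) = 0"
      using rec_v[of n] unfolding u by (simp add: algebra_simps)
    have "\<bar>Y n * Y n\<bar> \<le> (3/2) * (3/2)" using Y by (intro product_abs_le) auto
    then have "\<bar>Y n * Y n - 1\<bar> \<le> 4" by linarith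
    then have "1000 * \<bar>v n\<bar> \<le> 4 * \<bar>v (n - 1)\<bar> + 1 * \<bar>v (n + 1) + Y n * u (n - 1)\<bar>"
      using * V by (intro linear_bound[OF eq]) auto
    moreover have "\<bar>v (n + 1) + Y n * u (n - 1)\<bar> \<le> \<bar>v (n + 1)\<bar> + 3/2 * \<bar>u (n - 1)\<bar>"
    proof -
      have "\<bar>Y n * u (n - 1)\<bar> \<le> 3/2 * \<bar>u (n - 1)\<bar>" using Y by (intro product_abs_le) auto
      then show ?thesis by linarith
    qed
    ultimately have "1000 * \<bar>v n\<bar> \<le> 4 * \<bar>v (n - 1)\<bar> + (\<bar>v (n + 1)\<bar> + 3/2 * \<bar>u (n - 1)\<bar>)" by linarith
    with L R abs_ge_zero[of "v (n - 2)"] abs_ge_zero[of "v (n + 2)"] show ?thesis by argo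
  qed
qed

lemma small_displacement:
  assumes n: "\<not> large n"
  shows "\<bar>v n\<bar> \<le> (\<bar>v (pre n)\<bar> + \<bar>v (suc n)\<bar>) / 50"
proof (cases "large (n - 1)"; cases "large (n + 1)")
  assume "large (n - 1)" "large (n + 1)"
  then show ?thesis using small_displacement_between[OF n] by (simp add: pre_def suc_def)
next
  assume "large (n - 1)" "\<not> large (n + 1)"
  then show ?thesis using u_bound'[OF n] by (intro small_displacement_outside[OF n]) (auto simp: suc_def)
next
  assume "\<not> large (n - 1)" "large (n + 1)"
  then show ?thesis using u_bound[OF n] by (intro small_displacement_outside[OF n]) (auto simp: pre_def)
next
  assume "\<not> large (n - 1)" "\<not> large (n + 1)"
  then show ?thesis using u_bound[OF n] by (intro small_displacement_outside[OF n]) (auto simp: pre_def)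
qed

text \<open>Filling in the large indices makes \<open>spread\<close> expand in every single step.\<close>

definition spread :: "int \<Rightarrow> real" where
  "spread n = (if large n then (\<bar>v (n - 1)\<bar> + \<bar>v (n + 1)\<bar>) / 3 else \<bar>v n\<bar>)"

lemma spread_nonneg: "0 \<le> spread n"
  by (simp add: spread_def)

lemma spread_expands: "3 * spread n \<le> spread (n - 1) + spread (n + 1)"
proof (cases "large n")
  case True
  then show ?thesis using large_neighbours[OF True] by (simp add: spread_def)
next
  case False
  have "\<bar>v (pre n)\<bar> \<le> 3 * spread (n - 1)" "\<bar>v (suc n)\<bar> \<le> 3 * spread (n + 1)"
    by (auto simp: pre_def suc_def spread_def add.assoc)
  then show ?thesis using small_displacement[OF False] spread_nonneg[of "n - 1"] spread_nonneg[of "n + 1"]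
    False by (simp add: spread_def[of n])
qed

lemma abs_v_le_spread: "\<bar>v n\<bar> \<le> spread n"
  using large_displacement(2)[of n] by (auto simp: spread_def)

lemma abs_u_le_spread: "\<bar>u n\<bar> \<le> (V + 4) * (spread n + spread (n - 1))"
proof -
  have scale: "c * s \<le> (V + 4) * s" if "c \<le> V + 4" "0 \<le> s" for c s :: real
    using that by (rule mult_right_mono)
  note nn = spread_nonneg[of n] spread_nonneg[of "n - 1"]
  show ?thesis
  proof (cases "large n")
    case True
    have "\<bar>u n\<bar> \<le> spread n"
      using large_displacement(1)[OF True] True by (simp add: spread_def[of n])
    then have "\<bar>u n\<bar> \<le> 1 * (spread n + spread (n - 1))" using nn by simp
    also have "\<dots> \<le> (V + 4) * (spread n + spread (n - 1))" using V nn by (intro scale) auto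
    finally show ?thesis .
  next
    case small: False
    show ?thesis
    proof (cases "large (n - 1)")
      case False
      have "\<bar>u n\<bar> \<le> 1 * (spread n + spread (n - 1))"
        using u_bound[OF small False] abs_v_le_spread[of n] abs_v_le_spread[of "n - 1"] by simp
      also have "\<dots> \<le> (V + 4) * (spread n + spread (n - 1))" using V nn by (intro scale) auto
      finally show ?thesis .
    next
      case True
      have "\<bar>u (n - 1)\<bar> \<le> spread (n - 1)"
        using large_displacement(1)[OF True] True by (simp add: spread_def[of "n - 1"])
      moreover have "\<bar>Y (n - 1) * v n\<bar> \<le> (V + 1) * spread n"
        using large_Y(2)[OF True] abs_v_le_spread by (intro product_abs_le) auto
      moreover have "\<bar>Y n * v (n - 1)\<bar> \<le> 3/2 * spread (n - 1)"
        using small_Y[OF small] abs_v_le_spread by (intro product_abs_le) auto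
      ultimately have "\<bar>u n\<bar> \<le> (V + 1) * spread n + 5/2 * spread (n - 1)"
        using rec_u'[of n] by linarith
      also have "\<dots> \<le> (V + 4) * spread n + (V + 4) * spread (n - 1)"
        using V nn by (intro add_mono scale) auto
      finally show ?thesis by (simp add: algebra_simps)
    qed
  qed
qed

text \<open>Converse to the previous two bounds: two consecutive values of \<open>spread\<close> are
  comparable with the triple of displacements. One factor \<open>V\<close> is lost in passing from
  \<open>u n\<close> to \<open>v (n + 1)\<close>, two in reaching \<open>v (n - 2)\<close>, since
  that goes through \<open>u (n - 1)\<close>.\<close>

lemma spread_le: "spread n \<le> 10 * V\<^sup>2 * (\<bar>u n\<bar> + \<bar>v n\<bar> + \<bar>v (n - 1)\<bar>)"
  and spread_pred_le: "spread (n - 1) \<le> 10 * V\<^sup>2 * (\<bar>u n\<bar> + \<bar>v n\<bar> + \<bar>v (n - 1)\<bar>)"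
proof -
  let ?s = "\<bar>u n\<bar> + \<bar>v n\<bar> + \<bar>v (n - 1)\<bar>"
  have VV: "V * V \<ge> 1000 * V" using V by (intro mult_right_mono) auto
  have scale: "c * \<bar>s\<bar> \<le> 10 * V\<^sup>2 * \<bar>s\<bar>" if "c \<le> 3 * V * V" for c s :: real
  proof (rule mult_right_mono)
    have "c \<le> 3 * (V * V)" using that by (simp add: mult.assoc)
    then show "c \<le> 10 * V\<^sup>2" using zero_le_square[of V] unfolding power2_eq_square by linarith
  qed simp
  have sq: "(V + 1) * (V + 1) = V * V + 2 * V + 1" by (simp add: algebra_simps)
  have coeffs: "1 \<le> 3 * V * V" "V + 1 \<le> 3 * V * V" "3/2 * V + 5/2 \<le> 3 * V * V"
    "(V + 1) * (V + 1) + 2 \<le> 3 * V * V"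
    unfolding sq mult.assoc using VV V by linarith+
  have one: "\<bar>s\<bar> \<le> 10 * V\<^sup>2 * \<bar>s\<bar>" for s using scale[OF coeffs(1), of s] by simp
  have small: "\<bar>s\<bar> \<le> 10 * V\<^sup>2 * ?s" if "\<bar>s\<bar> \<le> ?s" for s
    using one[of ?s] that by simp
  show "spread n \<le> 10 * V\<^sup>2 * ?s"
  proof (cases "large n")
    case True
    have "\<bar>X n * v n\<bar> \<le> 1/100 * \<bar>v n\<bar>" using large_X[OF True] by (intro product_abs_le) auto
    moreover have "\<bar>Y n * u n\<bar> \<le> (V + 1) * \<bar>u n\<bar>" using large_Y[OF True] by (intro product_abs_le) auto
    ultimately have "spread n \<le> \<bar>v n\<bar> + (V + 1) * \<bar>u n\<bar> + \<bar>v (n - 1)\<bar>"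
      using rec_v[of n] True unfolding spread_def by (simp add: field_simps) linarith
    also have "\<dots> \<le> 10 * V\<^sup>2 * \<bar>v n\<bar> + 10 * V\<^sup>2 * \<bar>u n\<bar> + 10 * V\<^sup>2 * \<bar>v (n - 1)\<bar>"
      by (intro add_mono one scale coeffs)
    finally show ?thesis by (simp add: algebra_simps)
  qed (use small in \<open>simp add: spread_def\<close>)
  show "spread (n - 1) \<le> 10 * V\<^sup>2 * ?s"
  proof (cases "large (n - 1)")
    case True
    then have "\<not> large n" using large_neighbours(2)[OF True] by simp
    have arith: "(p + b) / 3 \<le> a + W + 2 * b" if "p \<le> a + W + b" "0 \<le> a" "0 \<le> b" "0 \<le> W" for p a b W :: real
      using that by (simp add: field_simps)
    have "\<bar>X (n - 1) * v (n - 1)\<bar> \<le> 1/100 * \<bar>v (n - 1)\<bar>" using large_X[OF True] by (intro product_abs_le) auto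
    moreover have "\<bar>Y (n - 1) * u (n - 1)\<bar> \<le> (V + 1) * ((V + 1) * \<bar>v n\<bar> + 3/2 * \<bar>v (n - 1)\<bar> + \<bar>u n\<bar>)"
    proof (rule product_abs_le)
      have "\<bar>Y (n - 1) * v n\<bar> \<le> (V + 1) * \<bar>v n\<bar>" using large_Y[OF True] by (intro product_abs_le) auto
      moreover have "\<bar>Y n * v (n - 1)\<bar> \<le> 3/2 * \<bar>v (n - 1)\<bar>"
        using small_Y[OF \<open>\<not> large n\<close>] by (intro product_abs_le) auto
      ultimately show "\<bar>u (n - 1)\<bar> \<le> (V + 1) * \<bar>v n\<bar> + 3/2 * \<bar>v (n - 1)\<bar> + \<bar>u n\<bar>"
        using rec_u'[of n] by linarith
    qed (rule large_Y[OF True])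
    moreover have "v (n - 2) = X (n - 1) * v (n - 1) + Y (n - 1) * u (n - 1) - v n"
      using rec_v[of "n - 1"] by simp
    ultimately have vb: "\<bar>v (n - 2)\<bar> \<le> \<bar>v (n - 1)\<bar> + (V + 1) * ((V + 1) * \<bar>v n\<bar> + 3/2 * \<bar>v (n - 1)\<bar> + \<bar>u n\<bar>) + \<bar>v n\<bar>"
      by linarith
    have "0 \<le> (V + 1) * ((V + 1) * \<bar>v n\<bar> + 3/2 * \<bar>v (n - 1)\<bar> + \<bar>u n\<bar>)" using V by simp
    note arith[OF vb abs_ge_zero abs_ge_zero this]
    moreover have "spread (n - 1) = (\<bar>v (n - 2)\<bar> + \<bar>v n\<bar>) / 3" using True by (simp add: spread_def)
    ultimately have "spread (n - 1) \<le> \<bar>v (n - 1)\<bar> + (V + 1) * ((V + 1) * \<bar>v n\<bar> + 3/2 * \<bar>v (n - 1)\<bar> + \<bar>u n\<bar>) + 2 * \<bar>v n\<bar>"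
      by (simp only:)
    also have "\<dots> = ((V + 1) * (V + 1) + 2) * \<bar>v n\<bar> + (3/2 * V + 5/2) * \<bar>v (n - 1)\<bar> + (V + 1) * \<bar>u n\<bar>"
      by (simp add: field_simps)
    also have "\<dots> \<le> 10 * V\<^sup>2 * \<bar>v n\<bar> + 10 * V\<^sup>2 * \<bar>v (n - 1)\<bar> + 10 * V\<^sup>2 * \<bar>u n\<bar>"
      by (intro add_mono scale coeffs)
    finally show ?thesis by (simp add: algebra_simps)
  qed (use small in \<open>simp add: spread_def\<close>)
qed

end

section \<open>The dichotomy for expanding sequences\<close>

locale expanding =
  fixes g :: "int \<Rightarrow> real"
  assumes nonneg: "0 \<le> g n" and expands: "3 * g n \<le> g (n - 1) + g (n + 1)"
begin

lemma reverse: "expanding (\<lambda>n. g (- n))"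
proof
  fix n
  show "3 * g (- n) \<le> g (- (n - 1)) + g (- (n + 1))" using expands[of "- n"] by (simp add: minus_diff_commute add.commute)
qed (rule nonneg)

text \<open>One step without decrease starts doubling: the next value is at least 3 - 1 times the
  present one, and the situation reproduces itself. Boundedness therefore forces
  monotonicity.\<close>

lemma increases:
  assumes "g m \<le> g (m + 1)" shows "2 ^ k * g (m + 1) \<le> g (m + 1 + int k)"
proof -
  have "2 ^ k * g (m + 1) \<le> g (m + 1 + int k) \<and> g (m + int k) \<le> g (m + 1 + int k)"
  proof (induction k)
    case (Suc k)
    have "2 * g (m + 1 + int k) \<le> g (m + 1 + int k + 1)"
      using expands[of "m + 1 + int k"] Suc by simp
    then show ?case using Suc nonneg[of "m + 1 + int k"] by (simp add: algebra_simps)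
  qed (use assms in simp)
  then show ?thesis by simp
qed

lemma bounded_forward_decreasing:
  assumes "\<And>n. 0 \<le> n \<Longrightarrow> g n \<le> B" shows "g (n + 1) \<le> g n"
proof (rule ccontr)
  assume "\<not> ?thesis"
  then have up: "g n \<le> g (n + 1)" "0 < g (n + 1)" using nonneg[of n] by auto
  obtain j where j: "B / g (n + 1) < 2 ^ j" using real_arch_pow[of 2] by auto
  define k where "k = j + nat \<bar>n + 1\<bar>"
  have "B < 2 ^ j * g (n + 1)" using j up(2) by (simp add: field_simps)
  also have "\<dots> \<le> 2 ^ k * g (n + 1)" using up(2) by (intro mult_right_mono power_increasing) (auto simp: k_def)
  also have "\<dots> \<le> g (n + 1 + int k)" by (rule increases[OF up(1)])
  also have "\<dots> \<le> B" by (rule assms) (auto simp: k_def)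
  finally show False by simp
qed

lemma decreasing_halves:
  assumes "\<And>n. g (n + 1) \<le> g n" shows "g (k + int n) \<le> g k / 2 ^ n"
proof (induction n)
  case (Suc n)
  have "3 * g (k + int n + 1) \<le> g (k + int n) + g (k + int n + 1 + 1)" using expands[of "k + int n + 1"] by simp
  moreover have "g (k + int n + 1 + 1) \<le> g (k + int n + 1)" by (rule assms)
  ultimately have "2 * g (k + int n + 1) \<le> g (k + int n)" by simp
  then have "g (k + int n + 1) \<le> g k / 2 ^ n / 2" using Suc by simp
  then show ?case by (simp add: ac_simps)
qed simp

text \<open>Boundedness on both sides makes both neighbours at most \<open>g n\<close>, which leaves
  3 \<open>g n\<close> below 2 \<open>g n\<close>.\<close>

lemma bounded_imp_zero:
  assumes "\<And>n. g n \<le> B" shows "g n = 0"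
proof -
  interpret r: expanding "\<lambda>n. g (- n)" by (rule reverse)
  have "g (n + 1) \<le> g n" for n using bounded_forward_decreasing assms by blast
  moreover have "g (n - 1) \<le> g n" for n
    using r.bounded_forward_decreasing[of B "- n"] assms by simp
  ultimately have "3 * g n \<le> 2 * g n" using expands[of n] by (smt (verit))
  then show ?thesis using nonneg[of n] by simp
qed

end

lemma (in displacement) expanding_spread: "expanding spread"
  by unfold_locales (auto intro: spread_nonneg spread_expands)

lemma (in displacement) bounded_spread_imp_zero:
  assumes "\<And>n. spread n \<le> B" shows "u n = 0" "v n = 0"
proof -
  have "spread n = 0" for n using expanding.bounded_imp_zero[OF expanding_spread] assms by blast
  then show "u n = 0" "v n = 0" using abs_u_le_spread[of n] abs_v_le_spread[of n] by auto
qed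

section \<open>Two orbits with a common itinerary\<close>

lemma abs_add_same_sign: "0 \<le> a * b \<Longrightarrow> \<bar>a + b\<bar> = \<bar>a\<bar> + \<bar>b\<bar>" for a b :: real
  by (auto simp: zero_le_mult_iff)

lemma midpoint_ge:
  fixes a b :: real
  assumes "0 \<le> a * b" "l \<le> \<bar>a\<bar>" "l \<le> \<bar>b\<bar>" shows "l \<le> \<bar>(a + b) / 2\<bar>"
  using abs_add_same_sign[OF assms(1)] assms(2,3) by simp

lemma midpoint_le:
  fixes a b :: real
  assumes "\<bar>a\<bar> \<le> l" "\<bar>b\<bar> \<le> l" shows "\<bar>(a + b) / 2\<bar> \<le> l"
  using assms by simp

lemma same_sign_product:
  fixes a b :: real and s :: int
  assumes "0 \<le> of_int s * a" "0 \<le> of_int s * b" "s \<in> {1, -1}" shows "0 \<le> a * b"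
  using assms by (auto simp: mult_nonpos_nonpos)

lemma same_sign_product_pos:
  fixes a b :: real and s :: int
  assumes "0 < of_int s * a" "0 < of_int s * b" "s \<in> {1, -1}" shows "0 < a * b"
  using assms by (auto simp: mult_neg_neg)

lemma same_band_sign:
  assumes "a \<in> band i" "b \<in> band i" "1/2 < \<bar>a\<bar>" "1/2 < \<bar>b\<bar>" "i \<in> {-2, -1, 0, 1, 2}"
  shows "0 < a * b"
  using assms(5)
  by (elim insertE emptyE; use assms(1-4) in \<open>auto simp: band_eq zero_less_mult_iff\<close>)

text \<open>Squares and bilinear terms have exact midpoint differences; the cubic term
  \<open>x * y * z\<close> leaves the extra quarter product, which becomes
  \<open>\<kappa>\<close>.\<close>

lemma surf_difference:
  fixes x y z x' y' z' :: real
  assumes "surf V x y z" "surf V x' y' z'"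
  shows "(2 * ((x + x') / 2) - (y + y') / 2 * ((z + z') / 2) - (y - y') * (z - z') / 4) * (x - x')
    + (2 * ((y + y') / 2) - (x + x') / 2 * ((z + z') / 2)) * (y - y')
    + (2 * ((z + z') / 2) - (x + x') / 2 * ((y + y') / 2)) * (z - z') = 0"
    (is "?lhs = 0")
proof -
  have "?lhs = (x\<^sup>2 + y\<^sup>2 + z\<^sup>2 - x * y * z) - (x'\<^sup>2 + y'\<^sup>2 + z'\<^sup>2 - x' * y' * z')"
    by (simp add: field_simps power2_eq_square)
  then show ?thesis using assms by (simp add: surf_def)
qed

lemma same_sign_midpoint_product:
  fixes a a' b b' :: real
  assumes "0 < a * a'" "0 < b * b'"
  shows "0 \<le> (a * b) * ((b + b') / 2 * ((a + a') / 2))"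
proof -
  have "(a * b) * ((b + b') / 2 * ((a + a') / 2)) = (b\<^sup>2 + b * b') * (a\<^sup>2 + a * a') / 4"
    by (simp add: field_simps power2_eq_square)
  moreover have "0 \<le> b\<^sup>2 + b * b'" "0 \<le> a\<^sup>2 + a * a'"
    using assms zero_le_power2[of a] zero_le_power2[of b] by linarith+
  ultimately show ?thesis by simp
qed

locale twin_orbits = o1: tame_orbit V x y + o2: tame_orbit V x' y' for V x y x' y' +
  assumes same: "\<And>n. \<exists>a. valid a \<and> region x y n a \<and> region x' y' n a"
begin

abbreviation large :: "int \<Rightarrow> bool" where
  "large n \<equiv> 3 < \<bar>y n\<bar>"

lemma large_same: "large n \<longleftrightarrow> 3 < \<bar>y' n\<bar>"
  and large_sign: "large n \<Longrightarrow> 0 < y n * y' n"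
proof -
  obtain a where a: "valid a" "region x y n a" "region x' y' n a" using same by blast
  have "(large n \<longleftrightarrow> 3 < \<bar>y' n\<bar>) \<and> (large n \<longrightarrow> 0 < y n * y' n)"
  proof (cases a)
    case (YL s j)
    then have s: "3 \<le> of_int s * y n" "3 \<le> of_int s * y' n" "s \<in> {1, -1}" using a by auto
    then have "large n" "3 < \<bar>y' n\<bar>" using o1.region_large o2.region_large by blast+
    moreover have "0 < y n * y' n" by (rule same_sign_product_pos[of s]) (use s in simp_all)
    ultimately show ?thesis by simp
  next
    case (XL s j)
    then have "\<bar>y n\<bar> \<le> 8/5" "\<bar>y' n\<bar> \<le> 8/5" using a band_bound by auto
    then show ?thesis by simp
  next
    case (ZL s j)
    then have "\<bar>y n\<bar> \<le> 8/5" "\<bar>y' n\<bar> \<le> 8/5" using a band_bound by auto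
    then show ?thesis by simp
  qed
  then show "large n \<longleftrightarrow> 3 < \<bar>y' n\<bar>" "large n \<Longrightarrow> 0 < y n * y' n" by auto
qed

lemma small_sign:
  assumes "\<not> large n" "1/2 < \<bar>y n\<bar>" "1/2 < \<bar>y' n\<bar>" shows "0 < y n * y' n"
proof -
  obtain a where a: "valid a" "region x y n a" "region x' y' n a" using same by blast
  show ?thesis
  proof (cases a)
    case (YL s j)
    then have "large n" using o1.region_large[of s n] a by auto
    then show ?thesis using assms by simp
  next
    case (XL s j)
    then show ?thesis using a by (intro same_band_sign[OF _ _ assms(2,3), of j]) auto
  next
    case (ZL s j)
    then show ?thesis using a by (intro same_band_sign[OF _ _ assms(2,3), of j]) auto
  qed
qed

text \<open>Equal signs keep the midpoint of \<open>x\<close> and \<open>x'\<close> as large as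
  both. \<open>XL\<close> records this sign; in \<open>ZL\<close> it is deduced from
  \<open>small_one'\<close>, which ties it to the signs of \<open>y n\<close> and
  \<open>y (n - 1)\<close>.\<close>

lemma x_sign:
  assumes "\<not> large n" "\<not> large (n - 1) \<or> \<not> large (n + 1)" shows "0 \<le> x n * x' n"
proof -
  obtain a where a: "valid a" "region x y n a" "region x' y' n a" using same by blast
  show ?thesis
  proof (cases a)
    case (XL s j)
    then show ?thesis using a same_sign_product[of s "x n" "x' n"] by auto
  next
    case (YL s j)
    then have "large n" using o1.region_large[of s n] a by auto
    then show ?thesis using assms by simp
  next
    case (ZL s j)
    then have l: "large (n - 1)" using o1.region_large[of s "n - 1"] a by auto
    then have r: "\<not> large (n + 1)" using assms by simp
    have small: "\<bar>y n\<bar> \<le> 3" "\<bar>y (n + 1)\<bar> \<le> 3" "\<bar>y' n\<bar> \<le> 3" "\<bar>y' (n + 1)\<bar> \<le> 3" "3 < \<bar>y' (n - 1)\<bar>"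
      using assms(1) r l large_same[of n] large_same[of "n + 1"] large_same[of "n - 1"] by simp_all
    note one = o1.small_one'[OF small(1) l small(2)] o2.small_one'[OF small(3) small(5) small(4)]
    have "0 < (x n * y n * y (n - 1)) * (x' n * y' n * y' (n - 1))" by (rule mult_pos_pos[OF one(3) one(6)])
    also have "\<dots> = (x n * x' n) * ((y n * y' n) * (y (n - 1) * y' (n - 1)))" by simp
    finally have "0 < (x n * x' n) * ((y n * y' n) * (y (n - 1) * y' (n - 1)))" .
    moreover have "0 < (y n * y' n) * (y (n - 1) * y' (n - 1))"
    proof (rule mult_pos_pos)
      show "0 < y n * y' n" using one by (intro small_sign[OF assms(1)]) simp_all
    qed (rule large_sign[OF l])
    ultimately have "0 < x n * x' n" by (rule zero_less_mult_pos2)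
    then show ?thesis by simp
  qed
qed

lemma between_midpoints:
  assumes n: "\<not> large n" and l: "large (n - 1)" "large (n + 1)"
  defines "Y \<equiv> \<lambda>k. (y k + y' k) / 2"
  shows "2 * V - 2 \<le> \<bar>Y (n - 1) - Y (n + 1)\<bar> \<or> V \<le> \<bar>(x n + x' n) / 2 + Y n * Y (n - 1)\<bar>"
proof -
  have n': "\<bar>y n\<bar> \<le> 3" "\<bar>y' n\<bar> \<le> 3" using n large_same[of n] by linarith+
  have l': "3 < \<bar>y' (n - 1)\<bar>" "3 < \<bar>y' (n + 1)\<bar>" using l large_same by blast+
  note s = large_sign[OF l(1)] large_sign[OF l(2)]
  note b = o1.large_bounds[OF l(1)] o1.large_bounds[OF l(2)] o2.large_bounds[OF l'(1)] o2.large_bounds[OF l'(2)]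
  have prod: "y' (n - 1) * y' (n + 1) * (y (n - 1) * y (n + 1)) > 0"
    using mult_pos_pos[OF s] by (simp only: mult_ac)
  have "y (n - 1) * y (n + 1) \<noteq> 0" using l by auto
  then consider "y (n - 1) * y (n + 1) < 0" | "0 < y (n - 1) * y (n + 1)" by linarith
  then show ?thesis
  proof cases
    case 1
    then have neg': "y' (n - 1) * y' (n + 1) < 0" using zero_less_mult_iff[THEN iffD1, OF prod] by linarith
    have d: "\<bar>y (n - 1) - y (n + 1)\<bar> = \<bar>y (n - 1)\<bar> + \<bar>y (n + 1)\<bar>"
      "\<bar>y' (n - 1) - y' (n + 1)\<bar> = \<bar>y' (n - 1)\<bar> + \<bar>y' (n + 1)\<bar>"
      using abs_add_same_sign[of "y (n - 1)" "- y (n + 1)"]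
        abs_add_same_sign[of "y' (n - 1)" "- y' (n + 1)"] 1 neg' by simp_all
    have "0 \<le> (y (n - 1) - y (n + 1)) * (y' (n - 1) - y' (n + 1))"
    proof -
      have "0 \<le> y (n - 1) - y (n + 1) \<and> 0 \<le> y' (n - 1) - y' (n + 1) \<or>
          y (n - 1) - y (n + 1) \<le> 0 \<and> y' (n - 1) - y' (n + 1) \<le> 0"
        using 1 neg' s unfolding mult_less_0_iff zero_less_mult_iff by linarith
      then show ?thesis by (simp add: zero_le_mult_iff)
    qed
    then have "2 * V - 2 \<le> \<bar>((y (n - 1) - y (n + 1)) + (y' (n - 1) - y' (n + 1))) / 2\<bar>"
      proof (rule midpoint_ge)
      show "2 * V - 2 \<le> \<bar>y (n - 1) - y (n + 1)\<bar>" unfolding d using b(1,4) by linarith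
      show "2 * V - 2 \<le> \<bar>y' (n - 1) - y' (n + 1)\<bar>" unfolding d using b(7,10) by linarith
    qed
    also have "((y (n - 1) - y (n + 1)) + (y' (n - 1) - y' (n + 1))) / 2 = Y (n - 1) - Y (n + 1)"
      by (simp add: Y_def field_simps)
    finally show ?thesis by simp
  next
    case 2
    then have pos': "0 < y' (n - 1) * y' (n + 1)" using zero_less_mult_iff[THEN iffD1, OF prod] by linarith
    note big = o1.small_between_same(1)[OF n'(1) l 2] o2.small_between_same(1)[OF n'(2) l' pos']
    then have sn: "0 < y n * y' n" using small_sign[OF n] by simp
    define P where "P = y (n - 1) * y n"
    define P' where "P' = y' (n - 1) * y' n"
    have "0 < (y (n - 1) * y' (n - 1)) * (y n * y' n)" using s(1) sn by (rule mult_pos_pos)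
    then have PP: "0 < P * P'" by (simp only: P_def P'_def mult_ac)
    have "999 * (138/100) \<le> \<bar>y (n - 1)\<bar> * \<bar>y n\<bar>" "999 * (138/100) \<le> \<bar>y' (n - 1)\<bar> * \<bar>y' n\<bar>"
      by (rule product_ge; use b(1,7) big o1.V in simp)+
    then have "999 * (138/100) \<le> \<bar>P\<bar>" "999 * (138/100) \<le> \<bar>P'\<bar>"
      unfolding P_def P'_def abs_mult .
    then have mid: "999 * (138/100) \<le> \<bar>(P + P') / 2\<bar>" using PP by (intro midpoint_ge) auto
    \<comment> \<open>Both products \<open>P\<close> and \<open>P'\<close> share the sign of the
      product of midpoints, so their mean, which is the midpoint of \<open>x n\<close> and
      \<open>x' n\<close> up to the tiny \<open>e\<close>, cannot cancel against it.\<close>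
    have pos: "0 \<le> P * (Y n * Y (n - 1))" "0 \<le> P' * (Y n * Y (n - 1))"
      using same_sign_midpoint_product[OF s(1) sn] same_sign_midpoint_product[of "y' (n - 1)" "y (n - 1)" "y' n" "y n"] s(1) sn
      by (simp_all only: P_def P'_def Y_def mult.commute add.commute)
    have "0 \<le> ((P + P') / 2) * (Y n * Y (n - 1))" using pos by (simp add: algebra_simps)
    then have sum: "\<bar>(P + P') / 2 + Y n * Y (n - 1)\<bar> = \<bar>(P + P') / 2\<bar> + \<bar>Y n * Y (n - 1)\<bar>"
      by (rule abs_add_same_sign)
    have "V - 1 \<le> \<bar>Y (n - 1)\<bar>" unfolding Y_def using s(1) b(1,7) by (intro midpoint_ge) simp_all
    moreover have "1 \<le> \<bar>Y n\<bar>" unfolding Y_def using sn big by (intro midpoint_ge) simp_all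
    ultimately have R: "1 * (V - 1) \<le> \<bar>Y n * Y (n - 1)\<bar>"
      unfolding abs_mult using o1.V by (intro product_ge) auto
    define m where "m = (P + P') / 2"
    define e where "e = (x (n - 1) + x' (n - 1)) / 2"
    have xm: "(x n + x' n) / 2 = m - e"
      using o1.rec_x'[of n] o2.rec_x'[of n] by (simp add: P_def P'_def m_def e_def field_simps)
    have "\<bar>e\<bar> \<le> 1/100" unfolding e_def using b(3,9) by (intro midpoint_le)
    moreover have "\<bar>m + Y n * Y (n - 1)\<bar> \<le> \<bar>m - e + Y n * Y (n - 1)\<bar> + \<bar>e\<bar>"
      using abs_triangle_ineq[of "m - e + Y n * Y (n - 1)" e] by simp
    ultimately have "V \<le> \<bar>(x n + x' n) / 2 + Y n * Y (n - 1)\<bar>"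
      using sum mid R unfolding xm m_def[symmetric] by simp
    then show ?thesis by simp
  qed
qed

lemma displacementI:
  defines "X \<equiv> \<lambda>k. (x k + x' k) / 2" and "Y \<equiv> \<lambda>k. (y k + y' k) / 2"
  assumes "\<And>n. v (n + 1) + v (n - 1) = X n * v n + Y n * u n"
    and "\<And>n. u (n + 1) + u n = Y n * v (n + 1) + Y (n + 1) * v n"
    and "\<And>n. (2 * X n - Y n * Y (n - 1) - \<kappa> n) * u n + (2 * Y n - X n * Y (n - 1)) * v n
        + (2 * Y (n - 1) - X n * Y n) * v (n - 1) = 0" "\<And>n. \<bar>\<kappa> n\<bar> \<le> 4"
    and "\<And>n. (2 * X n - Y n * Y (n + 1) - \<kappa>' n) * u n + (2 * Y n - X n * Y (n + 1)) * v n
        + (2 * Y (n + 1) - X n * Y n) * v (n + 1) = 0" "\<And>n. \<bar>\<kappa>' n\<bar> \<le> 4"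
  shows "displacement V X Y u v \<kappa> \<kappa>' large"
proof
  fix n
  show "large n \<Longrightarrow> \<not> large (n - 1)" "large n \<Longrightarrow> \<not> large (n + 1)"
    using o1.large_neighbours[of n] by auto
  show "V - 1 \<le> \<bar>Y n\<bar>" "\<bar>Y n\<bar> \<le> V + 1" "\<bar>X n\<bar> \<le> 1/100" if l: "large n"
  proof -
    have l': "3 < \<bar>y' n\<bar>" using l large_same[of n] by simp
    note b = o1.large_bounds[OF l] o2.large_bounds[OF l']
    show "V - 1 \<le> \<bar>Y n\<bar>" unfolding Y_def using b large_sign[OF l] by (intro midpoint_ge) auto
    show "\<bar>Y n\<bar> \<le> V + 1" "\<bar>X n\<bar> \<le> 1/100" unfolding X_def Y_def by (rule midpoint_le; rule b)+
  qed
  show "\<bar>Y n\<bar> \<le> 3/2" if "\<not> large n"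
    unfolding Y_def using o1.small_bound[of n] o2.small_bound[of n] that large_same[of n]
    by (intro midpoint_le) auto
  show "V - 10 \<le> \<bar>X n\<bar>" "\<bar>X n\<bar> \<le> V + 10" if s: "\<not> large n" "\<not> large (n - 1) \<or> \<not> large (n + 1)"
  proof -
    have s': "\<bar>y n\<bar> \<le> 3" "\<bar>y (n - 1)\<bar> \<le> 3 \<or> \<bar>y (n + 1)\<bar> \<le> 3"
      "\<bar>y' n\<bar> \<le> 3" "\<bar>y' (n - 1)\<bar> \<le> 3 \<or> \<bar>y' (n + 1)\<bar> \<le> 3"
      using s large_same[of n] large_same[of "n + 1"] large_same[of "n - 1"] by auto
    show "V - 10 \<le> \<bar>X n\<bar>" unfolding X_def
      by (rule midpoint_ge[OF x_sign[OF s] o1.x_bounds(1)[OF s'(1,2)] o2.x_bounds(1)[OF s'(3,4)]])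
    show "\<bar>X n\<bar> \<le> V + 10" unfolding X_def
      by (rule midpoint_le[OF o1.x_bounds(2)[OF s'(1,2)] o2.x_bounds(2)[OF s'(3,4)]])
  qed
  show "2 * V - 2 \<le> \<bar>Y (n - 1) - Y (n + 1)\<bar> \<or> V \<le> \<bar>X n + Y n * Y (n - 1)\<bar>"
    if "\<not> large n" "large (n - 1)" "large (n + 1)"
    unfolding X_def Y_def by (rule between_midpoints[OF that])
qed (use o1.V assms in auto)

text \<open>The differences are a bounded displacement. Large values agree in sign and lie within 1
  of \<open>V\<close> in size, small ones are at most 3/2, so \<open>v\<close> is at most 3 and the
  correction at most 9/4.\<close>

lemma coincide: "x n = x' n" "y n = y' n"
proof -
  define u where "u n = x n - x' n" for n
  define v where "v n = y n - y' n" for n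
  have v3: "\<bar>v n\<bar> \<le> 3" for n
  proof (cases "large n")
    case True
    then have "3 < \<bar>y' n\<bar>" using large_same by simp
    note b = o1.large_bounds[OF True] o2.large_bounds[OF this]
    have "\<bar>v n\<bar> = \<bar>\<bar>y n\<bar> - \<bar>y' n\<bar>\<bar>" using large_sign[OF True] unfolding v_def zero_less_mult_iff by auto
    then show ?thesis using b by linarith
  next
    case False
    then have "\<bar>y n\<bar> \<le> 3/2" "\<bar>y' n\<bar> \<le> 3/2" using o1.small_bound[of n] o2.small_bound[of n] large_same[of n] by auto
    then show ?thesis unfolding v_def by linarith
  qed
  have \<kappa>: "\<bar>v n * v k / 4\<bar> \<le> 4" for n k
    using product_abs_le[OF v3 v3, of n k] by simp
  interpret displacement V "\<lambda>k. (x k + x' k) / 2" "\<lambda>k. (y k + y' k) / 2" u v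
    "\<lambda>n. v n * v (n - 1) / 4" "\<lambda>n. v n * v (n + 1) / 4" large
  proof (rule displacementI)
    fix n
    show "v (n + 1) + v (n - 1) = (x n + x' n) / 2 * v n + (y n + y' n) / 2 * u n"
      using o1.rec_y[of n] o2.rec_y[of n] by (simp add: u_def v_def field_simps)
    show "u (n + 1) + u n = (y n + y' n) / 2 * v (n + 1) + (y (n + 1) + y' (n + 1)) / 2 * v n"
      using o1.rec_x[of n] o2.rec_x[of n] by (simp add: u_def v_def field_simps)
  qed (use \<kappa> surf_difference[OF o1.surf o2.surf] surf_difference[OF o1.surf' o2.surf'] in
      \<open>simp_all add: u_def v_def\<close>)
  have "spread n \<le> 3" for n using v3[of n] v3[of "n - 1"] v3[of "n + 1"] by (simp add: spread_def)
  then have "u n = 0" "v n = 0" using bounded_spread_imp_zero by blast+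
  then show "x n = x' n" "y n = y' n" by (simp_all add: u_def v_def)
qed

end

section \<open>Tangent spaces\<close>

fun grad :: "real \<times> real \<times> real \<Rightarrow> real \<times> real \<times> real" where
  "grad (x, y, z) = (2 * x - y * z, 2 * y - x * z, 2 * z - x * y)"

text \<open>At a critical point x^2 = y^2 = z^2 and xyz = 2 x^2, so the surface equation gives x^2 =
  4 + V^2, while criticality leaves only the values 0 and 4 for x^2.\<close>

lemma grad_nonzero:
  assumes "p \<in> trace_surface V" "V > 0" shows "grad p \<noteq> 0"
proof
  assume g: "grad p = 0"
  obtain x y z where p: "p = (x, y, z)" by (cases p)
  have e: "2 * x = y * z" "2 * y = x * z" "2 * z = x * y" using g by (simp_all add: p zero_prod_def)
  have yx: "y\<^sup>2 = x\<^sup>2" and zx: "z\<^sup>2 = x\<^sup>2" and xyz: "x * y * z = 2 * x\<^sup>2" using e by algebra+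
  have x: "x\<^sup>2 = 4 + V\<^sup>2" using assms(1) yx zx xyz by (simp add: p trace_surface_iff surf_def)
  have "4 * x\<^sup>2 = x\<^sup>2 * x\<^sup>2" using e(1) yx zx by (simp add: power_mult_distrib flip: power_mult_distrib[of 2 x]) algebra
  then have "x\<^sup>2 * (x\<^sup>2 - 4) = 0" by algebra
  moreover have "x\<^sup>2 \<noteq> 0" using x zero_le_power2[of V] by linarith
  ultimately have "x\<^sup>2 = 4" by simp
  then show False using x assms(2) by simp
qed

lemma surf_perm: "surf V x y z \<Longrightarrow> surf V y x z" "surf V x y z \<Longrightarrow> surf V z y x"
  by (simp_all add: surf_def algebra_simps)

lemma tangent_orthogonal:
  assumes "\<epsilon> > 0" "\<And>t. t \<in> {-\<epsilon><..<\<epsilon>} \<Longrightarrow> \<gamma> t \<in> trace_surface V"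
    and "(\<gamma> has_vector_derivative v) (at 0)"
  shows "grad (\<gamma> 0) \<bullet> v = 0"
proof -
  define F :: "real \<times> real \<times> real \<Rightarrow> real" where
    "F q = (fst q)\<^sup>2 + (fst (snd q))\<^sup>2 + (snd (snd q))\<^sup>2 - fst q * fst (snd q) * snd (snd q)" for q
  have "(F has_derivative (\<lambda>h. grad (\<gamma> 0) \<bullet> h)) (at (\<gamma> 0))"
    unfolding F_def
    by (auto intro!: derivative_eq_intros simp: fun_eq_iff algebra_simps) (cases "\<gamma> 0", simp add: algebra_simps)
  from has_derivative_compose[OF assms(3)[unfolded has_vector_derivative_def] this]
  have "((\<lambda>t. F (\<gamma> t)) has_derivative (\<lambda>t. grad (\<gamma> 0) \<bullet> (t *\<^sub>R v))) (at 0)" .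
  moreover have "((\<lambda>t. F (\<gamma> t)) has_derivative (\<lambda>t. 0)) (at 0)"
  proof (rule has_derivative_transform_within_open[of "\<lambda>t. 4 + V\<^sup>2" _ 0 UNIV "{-\<epsilon><..<\<epsilon>}"])
    show "4 + V\<^sup>2 = F (\<gamma> t)" if "t \<in> {-\<epsilon><..<\<epsilon>}" for t
      using assms(2)[OF that] by (cases "\<gamma> t") (simp add: F_def trace_surface_iff surf_def)
  qed (use assms(1) in auto)
  ultimately have "(\<lambda>t. grad (\<gamma> 0) \<bullet> (t *\<^sub>R v)) = (\<lambda>t. 0)" by (rule has_derivative_unique)
  then have "grad (\<gamma> 0) \<bullet> (1 *\<^sub>R v) = 0" by meson
  then show ?thesis by simp
qed

text \<open>The surface is a graph over any coordinate plane whose normal is not tangent to it, since its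
  equation is quadratic in each variable.\<close>

lemma root_curve:
  assumes s: "surf V x y z" and D: "2 * x - y * z \<noteq> 0"
  shows "\<exists>X X' \<epsilon>. \<epsilon> > 0 \<and> X 0 = x \<and> (\<forall>t\<in>{-\<epsilon><..<\<epsilon>}. surf V (X t) (y + t * b) (z + t * c)) \<and>
    (\<forall>t\<in>{-\<epsilon><..<\<epsilon>}. (X has_vector_derivative X' t) (at t)) \<and> continuous_on {-\<epsilon><..<\<epsilon>} X'"
proof -
  define Y where "Y t = y + t * b" for t
  define Z where "Z t = z + t * c" for t
  define d where "d t = (Y t * Z t)\<^sup>2 - 4 * ((Y t)\<^sup>2 + (Z t)\<^sup>2 - 4 - V\<^sup>2)" for t
  define d' where "d' t = 2 * (Y t * Z t) * (b * Z t + Y t * c) - 4 * (2 * Y t * b + 2 * Z t * c)" for t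
  \<comment> \<open>The root of the quadratic in \<open>x\<close> on the branch through the given
    point: at 0 the discriminant is the square of 2x - yz, and the sign selects this value.\<close>
  define X where "X t = (Y t * Z t + sgn (2 * x - y * z) * sqrt (d t)) / 2" for t
  define X' where "X' t = (b * Z t + Y t * c + sgn (2 * x - y * z) * (d' t / (2 * sqrt (d t)))) / 2" for t
  have d0: "d 0 = (2 * x - y * z)\<^sup>2"
    using s by (simp add: d_def Y_def Z_def surf_def power2_eq_square algebra_simps)
  have cont: "continuous_on UNIV Y" "continuous_on UNIV Z"
    unfolding Y_def Z_def by (auto intro!: continuous_intros)
  have contd: "continuous_on UNIV d" "continuous_on UNIV d'"
    unfolding d_def d'_def by (auto intro!: continuous_intros cont)
  have "open {t. 0 < d t}" by (intro open_Collect_less contd continuous_intros)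
  moreover have "0 \<in> {t. 0 < d t}" using d0 D by simp
  ultimately obtain \<epsilon> where \<epsilon>: "\<epsilon> > 0" "ball 0 \<epsilon> \<subseteq> {t. 0 < d t}"
    using open_contains_ball by blast
  have pos: "0 < d t" if "t \<in> {-\<epsilon><..<\<epsilon>}" for t
    using \<epsilon>(2) that by (auto simp: subset_iff dist_real_def)
  have sg: "(sgn (2 * x - y * z))\<^sup>2 = 1" using D by (simp add: sgn_if)
  have "X 0 = x"
    by (simp add: X_def d0 Y_def Z_def) (simp add: sgn_mult_abs)
  moreover have "surf V (X t) (Y t) (Z t)" if "t \<in> {-\<epsilon><..<\<epsilon>}" for t
  proof -
    have "2 * X t - Y t * Z t = sgn (2 * x - y * z) * sqrt (d t)" by (simp add: X_def field_simps)
    then have "(2 * X t - Y t * Z t)\<^sup>2 = d t"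
      using pos[OF that] sg by (simp only: power_mult_distrib) simp
    then show ?thesis by (simp add: surf_def d_def power2_eq_square algebra_simps)
  qed
  moreover have "(X has_vector_derivative X' t) (at t)" if "t \<in> {-\<epsilon><..<\<epsilon>}" for t
  proof -
    have dY: "(Y has_real_derivative b) (at t)" and dZ: "(Z has_real_derivative c) (at t)"
      unfolding Y_def Z_def by (auto intro!: derivative_eq_intros)
    have dd: "(d has_real_derivative d' t) (at t)"
      unfolding d_def d'_def
      by (auto intro!: derivative_eq_intros dY dZ simp: power2_eq_square algebra_simps)
    have "(X has_real_derivative X' t) (at t)"
      unfolding X_def X'_def using pos[OF that]
      by (auto intro!: derivative_eq_intros dY dZ dd simp: field_simps)
    then show ?thesis by (simp add: has_real_derivative_iff_has_vector_derivative)
  qed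
  moreover have "continuous_on {-\<epsilon><..<\<epsilon>} X'"
    unfolding X'_def using pos
    by (intro continuous_intros continuous_on_subset[OF cont(1)] continuous_on_subset[OF cont(2)]
        continuous_on_subset[OF contd(1)] continuous_on_subset[OF contd(2)]) force+
  ultimately show ?thesis using \<epsilon>(1) unfolding Y_def Z_def by blast
qed

lemma C1_line: "(\<lambda>t::real. y + t * b :: real) C1_differentiable_on S"
  unfolding C1_differentiable_on_def
  by (intro exI[of _ "\<lambda>_. b"]) (auto intro!: derivative_eq_intros simp: has_vector_derivative_def)

lemma line_has_vector_derivative: "((\<lambda>t. y + t * b) has_vector_derivative b) (at t)" for b y :: real
  by (auto intro!: derivative_eq_intros simp: has_vector_derivative_def)

lemma C1_Pair:
  assumes "f C1_differentiable_on S" "g C1_differentiable_on S"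
  shows "(\<lambda>t. (f t, g t)) C1_differentiable_on S"
proof -
  obtain f' g' where "\<forall>t\<in>S. (f has_vector_derivative f' t) (at t)" "continuous_on S f'"
    "\<forall>t\<in>S. (g has_vector_derivative g' t) (at t)" "continuous_on S g'"
    using assms unfolding C1_differentiable_on_def by blast
  then show ?thesis unfolding C1_differentiable_on_def
    by (intro exI[of _ "\<lambda>t. (f' t, g' t)"]) (auto intro!: has_vector_derivative_Pair continuous_intros)
qed

lemma tangent_spaceI:
  assumes "\<epsilon> > 0" "\<And>t. t \<in> {-\<epsilon><..<\<epsilon>} \<Longrightarrow> (f t, g t, h t) \<in> M"
    "f C1_differentiable_on {-\<epsilon><..<\<epsilon>}" "g C1_differentiable_on {-\<epsilon><..<\<epsilon>}" "h C1_differentiable_on {-\<epsilon><..<\<epsilon>}"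
    "(f has_vector_derivative a) (at 0)" "(g has_vector_derivative b) (at 0)" "(h has_vector_derivative c) (at 0)"
  shows "(a, b, c) \<in> tangent_space M (f 0, g 0, h 0)"
  unfolding tangent_space_def
  by (intro CollectI exI[of _ "\<lambda>t. (f t, g t, h t)"] exI[of _ \<epsilon>])
    (use assms in \<open>auto intro!: C1_Pair has_vector_derivative_Pair\<close>)

text \<open>The derivative at 0 is not read off from the root formula. Both it and \<open>a\<close>
  solve the tangency equation for the same \<open>b\<close> and \<open>c\<close>, and the
  coefficient \<open>2 * x - y * z\<close> is nonzero.\<close>

lemma root_curve_tangent:
  assumes s: "surf V x y z" and D: "2 * x - y * z \<noteq> 0"
    and ker: "(2 * x - y * z) * a + (2 * y - x * z) * b + (2 * z - x * y) * c = 0"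
  obtains X \<epsilon> where "\<epsilon> > 0" "X 0 = x" "\<And>t. t \<in> {-\<epsilon><..<\<epsilon>} \<Longrightarrow> surf V (X t) (y + t * b) (z + t * c)"
    "X C1_differentiable_on {-\<epsilon><..<\<epsilon>}" "(X has_vector_derivative a) (at 0)"
proof -
  from root_curve[OF s D, of b c] obtain X X' \<epsilon> where X: "\<epsilon> > 0" "X 0 = x"
    "\<And>t. t \<in> {-\<epsilon><..<\<epsilon>} \<Longrightarrow> surf V (X t) (y + t * b) (z + t * c)"
    "\<forall>t\<in>{-\<epsilon><..<\<epsilon>}. (X has_vector_derivative X' t) (at t)" "continuous_on {-\<epsilon><..<\<epsilon>} X'"
    by blast
  have der: "(X has_vector_derivative X' 0) (at 0)" using X(1,4) by simp
  have "grad (X 0, y + 0 * b, z + 0 * c) \<bullet> (X' 0, b, c) = 0"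
  proof (rule tangent_orthogonal[OF X(1), of "\<lambda>t. (X t, y + t * b, z + t * c)" V])
    show "((\<lambda>t. (X t, y + t * b, z + t * c)) has_vector_derivative (X' 0, b, c)) (at 0)"
      by (intro has_vector_derivative_Pair der line_has_vector_derivative)
  qed (use X(3) in \<open>simp add: trace_surface_iff\<close>)
  then have "(2 * x - y * z) * X' 0 + (2 * y - x * z) * b + (2 * z - x * y) * c = 0" by (simp add: X(2))
  then have "(2 * x - y * z) * X' 0 = (2 * x - y * z) * a" using ker by linarith
  then have "X' 0 = a" using D by simp
  then show ?thesis using that[OF X(1-3)] X(4,5) der unfolding C1_differentiable_on_def by blast
qed

lemma tangent_space_trace_surface:
  assumes p: "p \<in> trace_surface V" "V > 0"
  shows "tangent_space (trace_surface V) p = {h. grad p \<bullet> h = 0}"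
proof (intro equalityI subsetI)
  fix h assume "h \<in> tangent_space (trace_surface V) p"
  then show "h \<in> {h. grad p \<bullet> h = 0}"
    unfolding tangent_space_def using tangent_orthogonal by blast
next
  fix h assume "h \<in> {h. grad p \<bullet> h = 0}"
  moreover obtain x y z where xyz: "p = (x, y, z)" by (cases p)
  moreover obtain a b c where abc: "h = (a, b, c)" by (cases h)
  ultimately have ker: "(2 * x - y * z) * a + (2 * y - x * z) * b + (2 * z - x * y) * c = 0"
    "(2 * y - x * z) * b + (2 * x - y * z) * a + (2 * z - y * x) * c = 0"
    "(2 * z - y * x) * c + (2 * y - z * x) * b + (2 * x - z * y) * a = 0"
    by (simp_all add: ac_simps)
  have s: "surf V x y z" using p by (simp add: xyz trace_surface_iff)
  note I = tangent_spaceI[where M = "trace_surface V"] and line = C1_line line_has_vector_derivative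
  have "grad p \<noteq> 0" by (rule grad_nonzero[OF p])
  then consider "2 * x - y * z \<noteq> 0" | "2 * y - x * z \<noteq> 0" | "2 * z - y * x \<noteq> 0"
    by (auto simp: xyz zero_prod_def mult.commute)
  then show "h \<in> tangent_space (trace_surface V) p"
  proof cases
    case 1
    from root_curve_tangent[OF s 1 ker(1)] obtain X \<epsilon> where X: "\<epsilon> > 0" "X 0 = x"
      "\<And>t. t \<in> {-\<epsilon><..<\<epsilon>} \<Longrightarrow> surf V (X t) (y + t * b) (z + t * c)"
      "X C1_differentiable_on {-\<epsilon><..<\<epsilon>}" "(X has_vector_derivative a) (at 0)" by blast
    show ?thesis
      using I[OF X(1) _ X(4) line(1) line(1) X(5) line(2) line(2), of y b z c] X(2,3)
      by (simp add: xyz abc trace_surface_iff)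
  next
    case 2
    from root_curve_tangent[OF surf_perm(1)[OF s] 2 ker(2)] obtain X \<epsilon> where X: "\<epsilon> > 0" "X 0 = y"
      "\<And>t. t \<in> {-\<epsilon><..<\<epsilon>} \<Longrightarrow> surf V (X t) (x + t * a) (z + t * c)"
      "X C1_differentiable_on {-\<epsilon><..<\<epsilon>}" "(X has_vector_derivative b) (at 0)" by blast
    show ?thesis
      using I[OF X(1) _ line(1) X(4) line(1) line(2) X(5) line(2), of x a z c] X(2) surf_perm(1)[OF X(3)]
      by (simp add: xyz abc trace_surface_iff)
  next
    case 3
    from root_curve_tangent[OF surf_perm(2)[OF s] 3 ker(3)] obtain X \<epsilon> where X: "\<epsilon> > 0" "X 0 = z"
      "\<And>t. t \<in> {-\<epsilon><..<\<epsilon>} \<Longrightarrow> surf V (X t) (y + t * b) (x + t * a)"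
      "X C1_differentiable_on {-\<epsilon><..<\<epsilon>}" "(X has_vector_derivative c) (at 0)" by blast
    show ?thesis
      using I[OF X(1) _ line(1) line(1) X(4) line(2) line(2) X(5), of x a y b] X(2) surf_perm(2)[OF X(3)]
      by (simp add: xyz abc trace_surface_iff)
  qed
qed

section \<open>Hyperbolicity\<close>

fun dT :: "real \<times> real \<times> real \<Rightarrow> real \<times> real \<times> real \<Rightarrow> real \<times> real \<times> real" where
  "dT (x, y, z) (a, b, c) = (a * (y\<^sup>2 - 1) + 2 * x * y * b - (z * b + c * y), a * y + x * b - c, b)"

fun dTi :: "real \<times> real \<times> real \<Rightarrow> real \<times> real \<times> real \<Rightarrow> real \<times> real \<times> real" where
  "dTi (x, y, z) (a, b, c) = (b * z + y * c - a, c, b * (z\<^sup>2 - 1) + 2 * y * z * c - (a * z + x * c))"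

lemma dTi_dT: "dTi (trace_map p) (dT p h) = h"
  by (cases p; cases h) (simp add: trace_map_def power2_eq_square algebra_simps)

lemma dT_dTi: "dT (trace_map_inv p) (dTi p h) = h"
  by (cases p; cases h) (simp add: trace_map_inv_def power2_eq_square algebra_simps)

lemma linear_dT: "linear (dT p)" and linear_dTi: "linear (dTi p)"
proof -
  obtain x y z where p: "p = (x, y, z)" by (cases p)
  show "linear (dT p)" "linear (dTi p)"
    by (auto intro!: linearI simp: p algebra_simps)
qed

lemma grad_dT: "grad (trace_map p) \<bullet> dT p h = grad p \<bullet> h"
  by (cases p; cases h) (simp add: trace_map_def power2_eq_square algebra_simps)

lemma trace_map_has_derivative: "(trace_map has_derivative dT p) (at p)"
proof -
  have "((\<lambda>q. (fst q * ((fst (snd q))\<^sup>2 - 1) - snd (snd q) * fst (snd q),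
              fst q * fst (snd q) - snd (snd q), fst (snd q))) has_derivative dT p) (at p)"
    by (cases p) (auto intro!: derivative_eq_intros simp: fun_eq_iff algebra_simps)
  then show ?thesis by (simp add: trace_map_def case_prod_beta')
qed

text \<open>The tangent map on the tangent bundle. Its two-sided iterates carry the derivatives
  along an orbit, including backwards in time.\<close>

definition TD :: "(real \<times> real \<times> real) \<times> (real \<times> real \<times> real) \<Rightarrow> (real \<times> real \<times> real) \<times> (real \<times> real \<times> real)" where
  "TD = (\<lambda>(p, h). (trace_map p, dT p h))"

definition TDi :: "(real \<times> real \<times> real) \<times> (real \<times> real \<times> real) \<Rightarrow> (real \<times> real \<times> real) \<times> (real \<times> real \<times> real)" where
  "TDi = (\<lambda>(p, h). (trace_map_inv p, dTi p h))"

lemma TD_simps: "fst (TD w) = trace_map (fst w)" "snd (TD w) = dT (fst w) (snd w)"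
  "fst (TDi w) = trace_map_inv (fst w)" "snd (TDi w) = dTi (fst w) (snd w)"
  by (cases w; simp add: TD_def TDi_def)+

lemma TDi_TD: "TDi (TD w) = w" and TD_TDi: "TD (TDi w) = w"
  by (cases w; simp add: TD_def TDi_def dTi_dT dT_dTi)+

definition tvec :: "real \<times> real \<times> real \<Rightarrow> real \<times> real \<times> real \<Rightarrow> int \<Rightarrow> real \<times> real \<times> real" where
  "tvec p h n = snd (zpow TD TDi n (p, h))"

lemma zpow_TD: "zpow TD TDi n (p, h) = (tz n p, tvec p h n)"
proof -
  have "fst (zpow TD TDi n (p, h)) = tz n p"
  proof (induction n rule: int_induct[where k=0])
    case (step1 i)
    then show ?case by (simp add: zpow_Suc[of TD TDi, OF TD_TDi] tz_Suc TD_simps)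
  next
    case (step2 i)
    then show ?case by (simp add: zpow_pred[of TDi TD, OF TDi_TD] tz_pred TD_simps)
  qed simp
  then show ?thesis by (simp add: tvec_def prod_eq_iff)
qed

lemma tvec_0 [simp]: "tvec p h 0 = h"
  by (simp add: tvec_def)

lemma tvec_Suc: "tvec p h (n + 1) = dT (tz n p) (tvec p h n)"
  using zpow_Suc[of TD TDi n "(p, h)", OF TD_TDi] by (simp add: zpow_TD) (simp add: TD_def)

lemma tvec_pred: "tvec p h (n - 1) = dTi (tz n p) (tvec p h n)"
  using zpow_pred[of TDi TD n "(p, h)", OF TDi_TD] by (simp add: zpow_TD) (simp add: TDi_def)

lemma tvec_add: "tvec p h (n + k) = tvec (tz k p) (tvec p h k) n"
  using zpow_add[of TD TDi n k "(p, h)", OF TD_TDi TDi_TD] by (simp add: zpow_TD)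

lemma linear_tvec: "linear (\<lambda>h. tvec p h n)"
proof (induction n rule: int_induct[where k=0])
  case base
  show ?case by (simp add: linear_id[unfolded id_def])
next
  case (step1 i)
  then show ?case using linear_compose[OF step1(2) linear_dT[of "tz i p"]] by (simp add: tvec_Suc o_def)
next
  case (step2 i)
  then show ?case using linear_compose[OF step2(2) linear_dTi[of "tz i p"]] by (simp add: tvec_pred o_def)
qed

lemma grad_tvec: "grad (tz n p) \<bullet> tvec p h n = grad p \<bullet> h"
proof (induction n rule: int_induct[where k=0])
  case (step1 i)
  then show ?case by (simp add: tvec_Suc tz_Suc grad_dT)
next
  case (step2 i)
  then show ?case using grad_dT[of "tz (i - 1) p" "tvec p h (i - 1)"]
    by (simp add: tvec_pred tz_pred dT_dTi)
qed simp

lemma funpow_has_derivative: "((trace_map ^^ n) has_derivative (\<lambda>h. tvec p h (int n))) (at p)"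
proof (induction n)
  case 0
  show ?case by (simp add: has_derivative_ident[unfolded id_def])
next
  case (Suc n)
  have "(trace_map \<circ> (trace_map ^^ n) has_derivative dT ((trace_map ^^ n) p) \<circ> (\<lambda>h. tvec p h (int n))) (at p)"
    by (rule diff_chain_at[OF Suc trace_map_has_derivative])
  moreover have "(trace_map ^^ n) p = tz (int n) p" by (simp add: zpow_of_nat)
  moreover have "tvec p h (int (Suc n)) = dT (tz (int n) p) (tvec p h (int n))" for h
    using tvec_Suc[of p h "int n"] by (simp add: add.commute)
  ultimately show ?case by (simp add: o_def)
qed

lemma frechet_derivative_funpow: "frechet_derivative (trace_map ^^ n) (at p) = (\<lambda>h. tvec p h (int n))"
  using frechet_derivative_at[OF funpow_has_derivative] by simp

lemma frechet_derivative_trace_map: "frechet_derivative trace_map (at p) = (\<lambda>h. tvec p h 1)"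
  using frechet_derivative_funpow[of 1] by simp

definition us :: "real \<times> real \<times> real \<Rightarrow> real \<times> real \<times> real \<Rightarrow> int \<Rightarrow> real" where
  "us p h n = fst (tvec p h n)"

definition vs :: "real \<times> real \<times> real \<Rightarrow> real \<times> real \<times> real \<Rightarrow> int \<Rightarrow> real" where
  "vs p h n = fst (snd (tvec p h n))"

lemma tvec_eq: "tvec p h n = (us p h n, vs p h n, vs p h (n - 1))"
proof -
  have "tvec p h n = dT (tz (n - 1) p) (tvec p h (n - 1))" using tvec_Suc[of p h "n - 1"] by simp
  then show ?thesis
    by (cases "tvec p h (n - 1)") (simp add: us_def vs_def tz_eq)
qed

abbreviation big :: "real \<times> real \<times> real \<Rightarrow> int \<Rightarrow> bool" where
  "big p n \<equiv> 3 < \<bar>ys p n\<bar>"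

text \<open>An orbit is its own twin: midpoints become the orbit itself, the correction vanishes,
  and every size estimate is inherited from \<open>displacementI\<close>.\<close>

lemma tangent_displacement:
  assumes V: "V \<ge> 1000" and p: "p \<in> trace_surface V" and t: "tame (xs p) (ys p)"
    and h: "grad p \<bullet> h = 0"
  shows "displacement V (xs p) (ys p) (us p h) (vs p h) (\<lambda>_. 0) (\<lambda>_. 0) (big p)"
proof -
  interpret o: tame_orbit V "xs p" "ys p"
    by unfold_locales (rule V orbit_xs_ys[OF p] t)+
  interpret twin_orbits V "xs p" "ys p" "xs p" "ys p"
    by unfold_locales (use o.ex_region in blast)
  have step: "us p h (n + 1) = us p h n * ((ys p n)\<^sup>2 - 1) + 2 * xs p n * ys p n * vs p h n
      - (ys p (n - 1) * vs p h n + vs p h (n - 1) * ys p n)"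
    "vs p h (n + 1) = us p h n * ys p n + xs p n * vs p h n - vs p h (n - 1)" for n
    using tvec_Suc[of p h n] by (simp_all add: tvec_eq tz_eq)
  have ker: "(2 * xs p n - ys p n * ys p (n - 1)) * us p h n + (2 * ys p n - xs p n * ys p (n - 1)) * vs p h n
      + (2 * ys p (n - 1) - xs p n * ys p n) * vs p h (n - 1) = 0" for n
    using grad_tvec[of n p h] h by (simp add: tvec_eq tz_eq)
  have "displacement V (\<lambda>k. (xs p k + xs p k) / 2) (\<lambda>k. (ys p k + ys p k) / 2) (us p h) (vs p h)
      (\<lambda>_. 0) (\<lambda>_. 0) (big p)"
  proof (rule displacementI)
    have half: "(a + a) / 2 = a" for a :: real by simp
    fix n
    have yn: "ys p (n + 1) = xs p n * ys p n - ys p (n - 1)" using o.rec_y[of n] by simp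
    show "vs p h (n + 1) + vs p h (n - 1) = (xs p n + xs p n) / 2 * vs p h n + (ys p n + ys p n) / 2 * us p h n"
      by (simp add: step(2))
    show "us p h (n + 1) + us p h n = (ys p n + ys p n) / 2 * vs p h (n + 1) + (ys p (n + 1) + ys p (n + 1)) / 2 * vs p h n"
      unfolding step yn half by (simp add: algebra_simps power2_eq_square)
    show "(2 * ((xs p n + xs p n) / 2) - (ys p n + ys p n) / 2 * ((ys p (n - 1) + ys p (n - 1)) / 2) - 0) * us p h n
       + (2 * ((ys p n + ys p n) / 2) - (xs p n + xs p n) / 2 * ((ys p (n - 1) + ys p (n - 1)) / 2)) * vs p h n
       + (2 * ((ys p (n - 1) + ys p (n - 1)) / 2) - (xs p n + xs p n) / 2 * ((ys p n + ys p n) / 2)) * vs p h (n - 1) = 0"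
      using ker[of n] by simp
    have "(2 * xs p n - ys p n * ys p (n + 1)) * us p h n + (2 * ys p n - xs p n * ys p (n + 1)) * vs p h n
       + (2 * ys p (n + 1) - xs p n * ys p n) * vs p h (n + 1)
       = (2 * xs p n - ys p n * ys p (n - 1)) * us p h n + (2 * ys p n - xs p n * ys p (n - 1)) * vs p h n
      + (2 * ys p (n - 1) - xs p n * ys p n) * vs p h (n - 1)"
      unfolding step(2) yn by (simp add: algebra_simps power2_eq_square)
    then show "(2 * ((xs p n + xs p n) / 2) - (ys p n + ys p n) / 2 * ((ys p (n + 1) + ys p (n + 1)) / 2) - 0) * us p h n
       + (2 * ((ys p n + ys p n) / 2) - (xs p n + xs p n) / 2 * ((ys p (n + 1) + ys p (n + 1)) / 2)) * vs p h n
       + (2 * ((ys p (n + 1) + ys p (n + 1)) / 2) - (xs p n + xs p n) / 2 * ((ys p n + ys p n) / 2)) * vs p h (n + 1) = 0"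
      using ker[of n] by simp
  qed simp_all
  then show ?thesis by simp
qed

text \<open>The same quantity as in the displacement setting, but as a function of every vector
  \<open>h\<close>, tangent or not, so that continuity and homogeneity in \<open>h\<close> can be
  stated.\<close>

definition spread :: "real \<times> real \<times> real \<Rightarrow> real \<times> real \<times> real \<Rightarrow> int \<Rightarrow> real" where
  "spread p h n = (if big p n then (\<bar>vs p h (n - 1)\<bar> + \<bar>vs p h (n + 1)\<bar>) / 3 else \<bar>vs p h n\<bar>)"

text \<open>A unit vector vanishing at time \<open>N\<close> decreases up to that time, since an
  earlier step up would keep growing and stay positive. Letting \<open>N\<close> tend to infinity,
  compactness of the unit sphere in \<open>K\<close> provides a vector that decreases
  forever.\<close>

lemma ex_decreasing_vector:
  fixes g :: "'a::euclidean_space \<Rightarrow> int \<Rightarrow> real"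
  assumes K: "subspace K" and ex: "\<And>h. h \<in> K \<Longrightarrow> expanding (g h)"
    and cont: "\<And>n. continuous_on UNIV (\<lambda>h. g h n)"
    and hom: "\<And>c h n. g (c *\<^sub>R h) n = \<bar>c\<bar> * g h n"
    and zeros: "\<And>M. \<exists>N\<ge>M. \<exists>h\<in>K. h \<noteq> 0 \<and> g h N = 0"
  shows "\<exists>h\<in>K. h \<noteq> 0 \<and> (\<forall>n. g h (n + 1) \<le> g h n)"
proof -
  define S where "S = K \<inter> sphere 0 1"
  define F where "F M = S \<inter> (\<Inter>n\<in>{- int M..int M}. {h. g h (n + 1) \<le> g h n})" for M :: nat
  have "compact S" unfolding S_def using closed_subspace[OF K] by (simp add: closed_Int_compact)
  then have "compact (F M)" for M
    unfolding F_def by (intro compact_Int_closed closed_INT ballI closed_Collect_le cont)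
  moreover have "F M \<noteq> {}" for M
  proof -
    obtain N h where N: "N \<ge> int M + 1" and h: "h \<in> K" "h \<noteq> 0" "g h N = 0" using zeros by blast
    define k where "k = (1 / norm h) *\<^sub>R h"
    have k: "k \<in> S" "g k N = 0"
      using h K by (auto simp: S_def k_def hom subspace_scale)
    interpret expanding "g k" using k(1) ex by (simp add: S_def)
    have "g k (n + 1) \<le> g k n" if "n \<le> int M" for n
    proof (rule ccontr)
      assume "\<not> ?thesis"
      then have *: "g k n \<le> g k (n + 1)" "0 < g k (n + 1)" using nonneg[of n] by auto
      have "2 ^ nat (N - (n + 1)) * g k (n + 1) \<le> g k (n + 1 + int (nat (N - (n + 1))))"
        by (rule increases[OF *(1)])
      also have "n + 1 + int (nat (N - (n + 1))) = N" using N that by simp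
      finally have "2 ^ nat (N - (n + 1)) * g k (n + 1) \<le> 0" using k(2) by simp
      moreover have "0 < 2 ^ nat (N - (n + 1)) * g k (n + 1)" using *(2) by simp
      ultimately show False by linarith
    qed
    then have "k \<in> F M" using k(1) by (simp add: F_def)
    then show ?thesis by blast
  qed
  moreover have "F M \<subseteq> F N" if "N \<le> M" for M N
    using that by (auto simp: F_def)
  ultimately have "\<Inter>(range F) \<noteq> {}" by (intro compact_nest)
  then obtain h where h: "\<And>M. h \<in> F M" by blast
  have "g h (n + 1) \<le> g h n" for n
  proof -
    have "n \<in> {- int (nat \<bar>n\<bar>)..int (nat \<bar>n\<bar>)}" by auto
    then show ?thesis using h[of "nat \<bar>n\<bar>"] unfolding F_def by blast
  qed
  moreover have "h \<in> K" "h \<noteq> 0" using h[of 0] by (auto simp: F_def S_def)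
  ultimately show ?thesis by blast
qed

section \<open>Stable and unstable subspaces\<close>

definition Es :: "real \<times> real \<times> real \<Rightarrow> (real \<times> real \<times> real) set" where
  "Es p = {h. grad p \<bullet> h = 0 \<and> (\<exists>B. \<forall>n\<in>{0..}. norm (tvec p h n) \<le> B)}"

definition Eu :: "real \<times> real \<times> real \<Rightarrow> (real \<times> real \<times> real) set" where
  "Eu p = {h. grad p \<bullet> h = 0 \<and> (\<exists>B. \<forall>n\<in>{..0}. norm (tvec p h n) \<le> B)}"

lemma subspace_bounded:
  fixes J :: "int set"
  shows "subspace {h. grad p \<bullet> h = 0 \<and> (\<exists>B. \<forall>n\<in>J. norm (tvec p h n) \<le> B)}"
  unfolding subspace_def
proof (intro conjI ballI allI)
  show "0 \<in> {h. grad p \<bullet> h = 0 \<and> (\<exists>B. \<forall>n\<in>J. norm (tvec p h n) \<le> B)}"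
    by (auto simp: linear_0[OF linear_tvec])
  fix h k assume "h \<in> {h. grad p \<bullet> h = 0 \<and> (\<exists>B. \<forall>n\<in>J. norm (tvec p h n) \<le> B)}"
    "k \<in> {h. grad p \<bullet> h = 0 \<and> (\<exists>B. \<forall>n\<in>J. norm (tvec p h n) \<le> B)}"
  then obtain A B where *: "grad p \<bullet> h = 0" "\<And>n. n \<in> J \<Longrightarrow> norm (tvec p h n) \<le> A" "grad p \<bullet> k = 0" "\<And>n. n \<in> J \<Longrightarrow> norm (tvec p k n) \<le> B"
    by auto
  have "norm (tvec p (h + k) n) \<le> A + B" if "n \<in> J" for n
    using *(2)[OF that] *(4)[OF that] by (simp add: linear_add[OF linear_tvec] norm_triangle_le)
  then show "h + k \<in> {h. grad p \<bullet> h = 0 \<and> (\<exists>B. \<forall>n\<in>J. norm (tvec p h n) \<le> B)}"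
    using * by (auto simp: inner_add_right)
next
  fix c h assume "h \<in> {h. grad p \<bullet> h = 0 \<and> (\<exists>B. \<forall>n\<in>J. norm (tvec p h n) \<le> B)}"
  then obtain A where *: "grad p \<bullet> h = 0" "\<And>n. n \<in> J \<Longrightarrow> norm (tvec p h n) \<le> A" by auto
  have "norm (tvec p (c *\<^sub>R h) n) \<le> \<bar>c\<bar> * A" if "n \<in> J" for n
    using *(2)[OF that] by (simp add: linear_scale[OF linear_tvec] mult_left_mono)
  then show "c *\<^sub>R h \<in> {h. grad p \<bullet> h = 0 \<and> (\<exists>B. \<forall>n\<in>J. norm (tvec p h n) \<le> B)}"
    using * by auto
qed

lemma subspace_Es: "subspace (Es p)" and subspace_Eu: "subspace (Eu p)"
  using subspace_bounded[of p "{0..}"] subspace_bounded[of p "{..0}"] by (simp_all add: Es_def Eu_def)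

text \<open>A time shift moves only finitely many indices outside the half-line, so boundedness
  along the orbit survives; this gives invariance of the two subspaces.\<close>

lemma bounded_shift:
  assumes "\<And>n::int. n \<in> J \<Longrightarrow> norm (f n) \<le> (B::real)" "finite (J' - (\<lambda>n. n + k) -` J)"
  shows "\<exists>B. \<forall>n\<in>J'. norm (f (n + k)) \<le> B"
proof -
  have "finite ((\<lambda>n. norm (f (n + k))) ` (J' - (\<lambda>n. n + k) -` J))" using assms(2) by simp
  then obtain A where A: "\<And>n. n \<in> J' - (\<lambda>n. n + k) -` J \<Longrightarrow> norm (f (n + k)) \<le> A"
    using bdd_above_finite unfolding bdd_above_def by (metis imageI)
  have "norm (f (n + k)) \<le> max A B" if "n \<in> J'" for n
    using A[of n] assms(1)[of "n + k"] that by (cases "n + k \<in> J") (auto simp: le_max_iff_disj)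
  then show ?thesis by blast
qed

lemma tvec_Es: "h \<in> Es p \<Longrightarrow> tvec p h k \<in> Es (tz k p)"
proof -
  assume "h \<in> Es p"
  then obtain B where "grad p \<bullet> h = 0" and B: "\<And>n. n \<in> {0..} \<Longrightarrow> norm (tvec p h n) \<le> B" by (auto simp: Es_def)
  moreover have "{0..} - (\<lambda>n. n + k) -` {0..} \<subseteq> {0..\<bar>k\<bar>}" by auto
  then have "finite ({0..} - (\<lambda>n. n + k) -` {0..})" using finite_subset by blast
  from bounded_shift[OF B this] have "\<exists>B. \<forall>n\<in>{0..}. norm (tvec p h (n + k)) \<le> B" .
  ultimately show ?thesis by (simp add: Es_def grad_tvec tvec_add)
qed

lemma tvec_Eu: "h \<in> Eu p \<Longrightarrow> tvec p h k \<in> Eu (tz k p)"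
proof -
  assume "h \<in> Eu p"
  then obtain B where "grad p \<bullet> h = 0" and B: "\<And>n. n \<in> {..0} \<Longrightarrow> norm (tvec p h n) \<le> B" by (auto simp: Eu_def)
  moreover have "{..0} - (\<lambda>n. n + k) -` {..0} \<subseteq> {- \<bar>k\<bar>..0}" by auto
  then have "finite ({..0} - (\<lambda>n. n + k) -` {..0})" using finite_subset by blast
  from bounded_shift[OF B this] have "\<exists>B. \<forall>n\<in>{..0}. norm (tvec p h (n + k)) \<le> B" .
  ultimately show ?thesis by (simp add: Eu_def grad_tvec tvec_add)
qed

lemma tvec_inverse: "tvec (tz k p) (tvec p h k) (- k) = h" "tvec (tz (- k) p) (tvec p h (- k)) k = h"
  using tvec_add[of p h "- k" k] tvec_add[of p h k "- k"] by simp_all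

lemma tz_inverse: "tz (- k) (tz k p) = p" "tz k (tz (- k) p) = p"
  using tz_add[of "- k" k p] tz_add[of k "- k" p] by simp_all

lemma image_Es: "(\<lambda>h. tvec p h k) ` Es p = Es (tz k p)"
proof (intro equalityI subsetI)
  fix h assume "h \<in> Es (tz k p)"
  then have "tvec (tz k p) h (- k) \<in> Es p" using tvec_Es[of h "tz k p" "- k"] by (simp add: tz_inverse)
  moreover have "tvec p (tvec (tz k p) h (- k)) k = h" using tvec_inverse(2)[of k "tz k p" h] by (simp add: tz_inverse)
  ultimately show "h \<in> (\<lambda>h. tvec p h k) ` Es p" by (metis image_eqI)
qed (erule imageE, simp only: tvec_Es)

lemma image_Eu: "(\<lambda>h. tvec p h k) ` Eu p = Eu (tz k p)"
proof (intro equalityI subsetI)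
  fix h assume "h \<in> Eu (tz k p)"
  then have "tvec (tz k p) h (- k) \<in> Eu p" using tvec_Eu[of h "tz k p" "- k"] by (simp add: tz_inverse)
  moreover have "tvec p (tvec (tz k p) h (- k)) k = h" using tvec_inverse(2)[of k "tz k p" h] by (simp add: tz_inverse)
  ultimately show "h \<in> (\<lambda>h. tvec p h k) ` Eu p" by (metis image_eqI)
qed (erule imageE, simp only: tvec_Eu)

locale tame_point =
  fixes V p
  assumes V: "V \<ge> 1000" and surface: "p \<in> trace_surface V" and tame: "tame (xs p) (ys p)"
begin

sublocale o: tame_orbit V "xs p" "ys p"
  by unfold_locales (rule V orbit_xs_ys[OF surface] tame)+

context
  fixes h assumes h: "grad p \<bullet> h = 0"
begin

interpretation d: displacement V "xs p" "ys p" "us p h" "vs p h" "\<lambda>_. 0" "\<lambda>_. 0" "big p"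
  by (rule tangent_displacement[OF V surface tame h])

lemma spread_eq: "spread p h = d.spread"
  by (auto simp: spread_def d.spread_def)

lemma expanding_spread: "expanding (spread p h)"
  unfolding spread_eq by (rule d.expanding_spread)

lemma norm_tvec_le: "norm (tvec p h n) \<le> 3 * (V + 4) * (spread p h n + spread p h (n - 1))"
proof -
  let ?s = "spread p h n + spread p h (n - 1)"
  have g: "0 \<le> spread p h n" "0 \<le> spread p h (n - 1)" by (simp_all add: spread_def)
  have "norm (tvec p h n) \<le> \<bar>us p h n\<bar> + (\<bar>vs p h n\<bar> + \<bar>vs p h (n - 1)\<bar>)"
    unfolding tvec_eq by (intro order.trans[OF norm_Pair_le] add_mono order.refl) simp_all
  also have "\<dots> \<le> (V + 4) * ?s + ((V + 4) * ?s + (V + 4) * ?s)"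
  proof (intro add_mono)
    show "\<bar>us p h n\<bar> \<le> (V + 4) * ?s" using d.abs_u_le_spread[of n] by (simp add: spread_eq)
    have "1 * ?s \<le> (V + 4) * ?s" using g V by (intro mult_right_mono) auto
    then show "\<bar>vs p h n\<bar> \<le> (V + 4) * ?s" "\<bar>vs p h (n - 1)\<bar> \<le> (V + 4) * ?s"
      using d.abs_v_le_spread[of n] d.abs_v_le_spread[of "n - 1"] g by (simp_all add: spread_eq)
  qed
  finally show ?thesis by (simp add: algebra_simps)
qed

lemma spread_le_norm: "spread p h n \<le> 30 * V\<^sup>2 * norm (tvec p h n)"
  "spread p h (n - 1) \<le> 30 * V\<^sup>2 * norm (tvec p h n)"
proof -
  have n: "\<bar>us p h n\<bar> \<le> norm (tvec p h n)" "\<bar>vs p h n\<bar> \<le> norm (tvec p h n)" "\<bar>vs p h (n - 1)\<bar> \<le> norm (tvec p h n)"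
  proof -
    have "norm (fst (tvec p h n)) \<le> norm (tvec p h n)" "norm (snd (tvec p h n)) \<le> norm (tvec p h n)"
      by (metis norm_fst_le norm_snd_le prod.collapse)+
    moreover have "norm (fst (snd (tvec p h n))) \<le> norm (snd (tvec p h n))" "norm (snd (snd (tvec p h n))) \<le> norm (snd (tvec p h n))"
      by (metis norm_fst_le norm_snd_le prod.collapse)+
    ultimately show "\<bar>us p h n\<bar> \<le> norm (tvec p h n)" "\<bar>vs p h n\<bar> \<le> norm (tvec p h n)" "\<bar>vs p h (n - 1)\<bar> \<le> norm (tvec p h n)"
      by (simp_all add: tvec_eq)
  qed
  have "10 * V\<^sup>2 * (\<bar>us p h n\<bar> + \<bar>vs p h n\<bar> + \<bar>vs p h (n - 1)\<bar>) \<le> 10 * V\<^sup>2 * (3 * norm (tvec p h n))"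
    using n by (intro mult_left_mono) auto
  then show "spread p h n \<le> 30 * V\<^sup>2 * norm (tvec p h n)" "spread p h (n - 1) \<le> 30 * V\<^sup>2 * norm (tvec p h n)"
    using d.spread_le[of n] d.spread_pred_le[of n] by (simp_all add: spread_eq)
qed

end

text \<open>The constant is 3 (V + 4), from bounding the norm by two consecutive spreads, times 2
  times 30 V^2, from bounding each spread by the norm. In between, the spread halves in each
  step.\<close>

lemma Es_contracts:
  assumes "h \<in> Es p" shows "norm (tvec p h (int n)) \<le> 180 * (V + 4) * V\<^sup>2 / 2 ^ n * norm h"
proof -
  obtain B where h: "grad p \<bullet> h = 0" and B: "\<And>n. 0 \<le> n \<Longrightarrow> norm (tvec p h n) \<le> B"
    using assms by (auto simp: Es_def)
  interpret expanding "spread p h" by (rule expanding_spread[OF h])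
  have "spread p h n \<le> 30 * V\<^sup>2 * B" if "0 \<le> n" for n
    by (rule order.trans[OF spread_le_norm(1)[OF h]]) (use B[OF that] in \<open>simp add: mult_left_mono\<close>)
  then have dec: "spread p h (n + 1) \<le> spread p h n" for n by (rule bounded_forward_decreasing)
  have "spread p h (int n) \<le> spread p h 0 / 2 ^ n" "spread p h (int n - 1) \<le> spread p h (- 1) / 2 ^ n"
    using decreasing_halves[OF dec, of 0 n] decreasing_halves[OF dec, of "- 1" n] by simp_all
  moreover have "spread p h 0 \<le> 30 * V\<^sup>2 * norm h" "spread p h (- 1) \<le> 30 * V\<^sup>2 * norm h"
    using spread_le_norm[OF h, of 0] by simp_all
  then have "spread p h 0 / 2 ^ n \<le> 30 * V\<^sup>2 * norm h / 2 ^ n" "spread p h (- 1) / 2 ^ n \<le> 30 * V\<^sup>2 * norm h / 2 ^ n"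
    by (intro divide_right_mono; simp)+
  ultimately have "spread p h (int n) + spread p h (int n - 1) \<le> 2 * (30 * V\<^sup>2 * norm h / 2 ^ n)" by linarith
  then have "3 * (V + 4) * (spread p h (int n) + spread p h (int n - 1)) \<le> 3 * (V + 4) * (2 * (30 * V\<^sup>2 * norm h / 2 ^ n))"
    using V by (intro mult_left_mono) auto
  with norm_tvec_le[OF h, of "int n"]
  have "norm (tvec p h (int n)) \<le> 3 * (V + 4) * (2 * (30 * V\<^sup>2 * norm h / 2 ^ n))" by (rule order.trans)
  also have "\<dots> = 180 * (V + 4) * V\<^sup>2 / 2 ^ n * norm h" by (simp add: field_simps)
  finally show ?thesis .
qed

lemma Eu_expands:
  assumes "h \<in> Eu p" shows "2 ^ n / (180 * (V + 4) * V\<^sup>2) * norm h \<le> norm (tvec p h (int n))"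
proof -
  obtain B where h: "grad p \<bullet> h = 0" and B: "\<And>n. n \<le> 0 \<Longrightarrow> norm (tvec p h n) \<le> B"
    using assms by (auto simp: Eu_def)
  interpret expanding "\<lambda>n. spread p h (- n)" using expanding.reverse[OF expanding_spread[OF h]] .
  have "spread p h (- n) \<le> 30 * V\<^sup>2 * B" if "0 \<le> n" for n
    by (rule order.trans[OF spread_le_norm(1)[OF h]]) (use B[of "- n"] that in \<open>simp add: mult_left_mono\<close>)
  then have dec: "spread p h (- (n + 1)) \<le> spread p h (- n)" for n by (rule bounded_forward_decreasing)
  \<comment> \<open>In reversed time, halving runs from \<open>- int n\<close> to 0. The second
    start \<open>1 - int n\<close> is needed because the norm at a time involves the spread one step
    earlier as well.\<close>
  have "spread p h 0 \<le> spread p h (int n) / 2 ^ n" "spread p h (- 1) \<le> spread p h (int n - 1) / 2 ^ n"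
    using decreasing_halves[OF dec, of "- int n" n] decreasing_halves[OF dec, of "1 - int n" n] by simp_all
  then have "2 ^ n * (spread p h 0 + spread p h (- 1)) \<le> spread p h (int n) + spread p h (int n - 1)"
    by (simp add: field_simps)
  also have "\<dots> \<le> 60 * V\<^sup>2 * norm (tvec p h (int n))"
    using spread_le_norm[OF h, of "int n"] by simp
  finally have 1: "2 ^ n * (spread p h 0 + spread p h (- 1)) \<le> 60 * V\<^sup>2 * norm (tvec p h (int n))" .
  have "2 ^ n * norm h \<le> 2 ^ n * (3 * (V + 4) * (spread p h 0 + spread p h (- 1)))"
    using norm_tvec_le[OF h, of 0] by (intro mult_left_mono) simp_all
  also have "\<dots> = 3 * (V + 4) * (2 ^ n * (spread p h 0 + spread p h (- 1)))" by simp
  also have "\<dots> \<le> 3 * (V + 4) * (60 * V\<^sup>2 * norm (tvec p h (int n)))"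
    using 1 V by (intro mult_left_mono) auto
  finally have "2 ^ n * norm h \<le> (180 * (V + 4) * V\<^sup>2) * norm (tvec p h (int n))" by (simp add: algebra_simps)
  moreover have "0 < 180 * (V + 4) * V\<^sup>2" using V by simp
  ultimately show ?thesis by (simp add: divide_le_eq mult.commute)
qed

lemma Es_Int_Eu: "Eu p \<inter> Es p = {0}"
proof (intro equalityI subsetI)
  fix h assume "h \<in> Eu p \<inter> Es p"
  then obtain A B where h: "grad p \<bullet> h = 0" and B: "\<And>n. 0 \<le> n \<Longrightarrow> norm (tvec p h n) \<le> A" "\<And>n. n \<le> 0 \<Longrightarrow> norm (tvec p h n) \<le> B"
    by (auto simp: Es_def Eu_def)
  have "norm (tvec p h n) \<le> max A B" for n using B[of n] by (cases "0 \<le> n") auto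
  then have "spread p h n \<le> 30 * V\<^sup>2 * max A B" for n
    by (intro order.trans[OF spread_le_norm(1)[OF h]] mult_left_mono) auto
  then have "spread p h n = 0" for n by (rule expanding.bounded_imp_zero[OF expanding_spread[OF h]])
  then have "norm (tvec p h 0) \<le> 0" using norm_tvec_le[OF h, of 0] by simp
  then show "h \<in> {0}" by simp
qed (simp add: subspace_0 subspace_Es subspace_Eu)

text \<open>At a non-large index the spread is the absolute value of one coordinate, so it vanishes
  on the intersection of the tangent plane at time \<open>n\<close> with a coordinate plane, and
  these share a line. The vector is then transported back to time 0.\<close>

lemma ex_vanishing:
  assumes "\<not> big p n" shows "\<exists>h. grad p \<bullet> h = 0 \<and> h \<noteq> 0 \<and> spread p h n = 0"
proof -
  obtain a b c where abc: "grad (tz n p) = (a, b, c)" by (cases "grad (tz n p)")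
  define k :: "real \<times> real \<times> real" where "k = (if a = 0 \<and> c = 0 then (1, 0, 0) else (c, 0, - a))"
  have k: "grad (tz n p) \<bullet> k = 0" "k \<noteq> 0" "fst (snd k) = 0"
    by (auto simp: abc k_def zero_prod_def)
  define h where "h = tvec (tz n p) k (- n)"
  have hk: "tvec p h n = k" using tvec_inverse(2)[of n "tz n p" k] by (simp add: h_def tz_inverse)
  have "grad p \<bullet> h = 0" using grad_tvec[of n p h] k by (simp add: hk)
  moreover have "h \<noteq> 0" using hk k(2) linear_0[OF linear_tvec, of p n] by auto
  moreover have "spread p h n = 0" using assms k(3) by (simp add: spread_def vs_def hk)
  ultimately show ?thesis by blast
qed

lemma continuous_spread: "continuous_on UNIV (\<lambda>h. spread p h n)"
proof -
  have "continuous_on UNIV (\<lambda>h. tvec p h k)" for k 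
    by (rule linear_continuous_on[OF linear_conv_bounded_linear[THEN iffD1, OF linear_tvec]])
  then have "continuous_on UNIV (\<lambda>h. vs p h k)" for k unfolding vs_def by (intro continuous_intros)
  then show ?thesis unfolding spread_def by (cases "big p n") (auto intro!: continuous_intros)
qed

lemma spread_scale: "spread p (c *\<^sub>R h) n = \<bar>c\<bar> * spread p h n"
proof -
  have "vs p (c *\<^sub>R h) k = c * vs p h k" for k by (simp add: vs_def linear_scale[OF linear_tvec])
  then show ?thesis by (simp add: spread_def abs_mult algebra_simps)
qed

lemma ex_Es: "\<exists>h\<in>Es p. h \<noteq> 0"
proof -
  have "\<exists>h\<in>{h. grad p \<bullet> h = 0}. h \<noteq> 0 \<and> (\<forall>n. spread p h (n + 1) \<le> spread p h n)"
  proof (rule ex_decreasing_vector)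
    fix M :: int
    \<comment> \<open>Large indices are never adjacent, so \<open>M\<close> or \<open>M + 1\<close>
      will do.\<close>
    obtain N where "N \<ge> M" "\<not> big p N"
      using o.large_neighbours(3)[of M] by (cases "big p M") (auto intro: that[of "M + 1"])
    then show "\<exists>N\<ge>M. \<exists>h\<in>{h. grad p \<bullet> h = 0}. h \<noteq> 0 \<and> spread p h N = 0" using ex_vanishing by blast
  qed (simp_all only: mem_Collect_eq subspace_hyperplane expanding_spread continuous_spread spread_scale)
  then obtain h where h: "grad p \<bullet> h = 0" "h \<noteq> 0" "\<And>n. spread p h (n + 1) \<le> spread p h n" by blast
  interpret expanding "spread p h" by (rule expanding_spread[OF h(1)])
  have le: "spread p h n \<le> spread p h (- 1)" if "- 1 \<le> n" for n
    using that
  proof (induction n rule: int_ge_induct)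
    case (step i)
    then show ?case using h(3)[of i] by simp
  qed simp
  have "norm (tvec p h n) \<le> 3 * (V + 4) * (spread p h (- 1) + spread p h (- 1))" if "0 \<le> n" for n
    using le[of n] le[of "n - 1"] that V
    by (intro order.trans[OF norm_tvec_le[OF h(1)]] mult_left_mono) auto
  then have "\<exists>B. \<forall>n\<in>{0..}. norm (tvec p h n) \<le> B" by (meson atLeast_iff)
  then show ?thesis using h unfolding Es_def by blast
qed

lemma ex_Eu: "\<exists>h\<in>Eu p. h \<noteq> 0"
proof -
  have "\<exists>h\<in>{h. grad p \<bullet> h = 0}. h \<noteq> 0 \<and> (\<forall>n. spread p h (- (n + 1)) \<le> spread p h (- n))"
  proof (rule ex_decreasing_vector)
    fix M :: int
    obtain N where "N \<ge> M" "\<not> big p (- N)"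
      using o.large_neighbours(2)[of "- M"] by (cases "big p (- M)") (auto intro: that[of "M + 1"])
    then show "\<exists>N\<ge>M. \<exists>h\<in>{h. grad p \<bullet> h = 0}. h \<noteq> 0 \<and> spread p h (- N) = 0" using ex_vanishing by blast
  qed (simp_all only: mem_Collect_eq subspace_hyperplane expanding.reverse expanding_spread continuous_spread spread_scale)
  then obtain h where h: "grad p \<bullet> h = 0" "h \<noteq> 0" "\<And>n. spread p h (- (n + 1)) \<le> spread p h (- n)" by blast
  interpret expanding "spread p h" by (rule expanding_spread[OF h(1)])
  have le: "spread p h (- n) \<le> spread p h 0" if "0 \<le> n" for n
    using that
  proof (induction n rule: int_ge_induct)
    case (step i)
    then show ?case using h(3)[of i] by simp
  qed simp
  have "norm (tvec p h n) \<le> 3 * (V + 4) * (spread p h 0 + spread p h 0)" if "n \<le> 0" for n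
    using le[of "- n"] le[of "1 - n"] that V
    by (intro order.trans[OF norm_tvec_le[OF h(1)]] mult_left_mono) auto
  then have "\<exists>B. \<forall>n\<in>{..0}. norm (tvec p h n) \<le> B" by (meson atMost_iff)
  then show ?thesis using h unfolding Eu_def by blast
qed

text \<open>A nonzero vector from each space gives two independent vectors, because the spaces meet
  only in 0; the tangent plane is two-dimensional.\<close>

lemma splitting: "{u + s |u s. u \<in> Eu p \<and> s \<in> Es p} = {h. grad p \<bullet> h = 0}"
proof (intro equalityI subsetI)
  fix h assume "h \<in> {u + s |u s. u \<in> Eu p \<and> s \<in> Es p}"
  then obtain u s where "h = u + s" "u \<in> Eu p" "s \<in> Es p" by blast
  then show "h \<in> {h. grad p \<bullet> h = 0}" unfolding Eu_def Es_def by (simp add: inner_add_right)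
next
  fix h assume h: "h \<in> {h. grad p \<bullet> h = 0}"
  obtain e s where e: "e \<in> Eu p" "e \<noteq> 0" and s: "s \<in> Es p" "s \<noteq> 0" using ex_Eu ex_Es by blast
  have "e \<notin> span {s}"
  proof
    assume "e \<in> span {s}"
    then have "e \<in> Es p" using s(1) subspace_Es span_minimal[of "{s}" "Es p"] by blast
    then show False using Es_Int_Eu e by blast
  qed
  then have ind: "independent {e, s}" "e \<noteq> s"
    using s(2) by (auto simp: independent_insert span_base)
  have "dim {h. grad p \<bullet> h = 0} = 2"
    using dim_hyperplane[OF grad_nonzero[OF surface]] V by simp
  then have "{h. grad p \<bullet> h = 0} \<subseteq> span {e, s}"
    using e s ind by (intro card_ge_dim_independent) (auto simp: Eu_def Es_def)
  then have "h \<in> span {e, s}" using h by blast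
  obtain a b where "h = a *\<^sub>R e + b *\<^sub>R s"
  proof -
    obtain a where "h - a *\<^sub>R e \<in> span {s}" using \<open>h \<in> span {e, s}\<close> unfolding span_breakdown_eq by blast
    then obtain b where "h - a *\<^sub>R e = b *\<^sub>R s" unfolding span_singleton by blast
    then have "h = a *\<^sub>R e + b *\<^sub>R s" by (simp add: diff_eq_eq add.commute)
    then show ?thesis using that by blast
  qed
  moreover have "a *\<^sub>R e \<in> Eu p" "b *\<^sub>R s \<in> Es p"
    using e s by (simp_all add: subspace_scale subspace_Eu subspace_Es)
  ultimately show "h \<in> {u + s |u s. u \<in> Eu p \<and> s \<in> Es p}" by blast
qed

end

section \<open>The set of tame orbits\<close>

definition \<Omega> :: "real \<Rightarrow> (real \<times> real \<times> real) set" where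
  "\<Omega> V = {p \<in> trace_surface V. tame (xs p) (ys p)}"

lemma tame_shift: "tame x y \<Longrightarrow> tame (\<lambda>n. x (n + k)) (\<lambda>n. y (n + k))"
  unfolding tame_def by (simp add: diff_add_eq)

lemma tz_\<Omega>: "p \<in> \<Omega> V \<Longrightarrow> tz k p \<in> \<Omega> V"
proof -
  have "xs (tz k p) = (\<lambda>n. xs p (n + k))" "ys (tz k p) = (\<lambda>n. ys p (n + k))"
    by (simp_all add: fun_eq_iff seq_tz)
  then show "p \<in> \<Omega> V \<Longrightarrow> tz k p \<in> \<Omega> V" by (simp add: \<Omega>_def tame_shift)
qed

lemma tame_point_\<Omega>: "V \<ge> 1000 \<Longrightarrow> p \<in> \<Omega> V \<Longrightarrow> tame_point V p"
  by unfold_locales (auto simp: \<Omega>_def)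

lemma closed_\<Omega>: "closed (\<Omega> V)"
proof -
  have "\<Omega> V = trace_surface V \<inter> (\<Inter>n. ({p. \<bar>xs p n\<bar> \<le> 3} \<union> {p. \<bar>ys p n\<bar> \<le> 3}) \<inter>
      ({p. \<bar>ys p n\<bar> \<le> 3} \<union> {p. \<bar>ys p (n - 1)\<bar> \<le> 3}))"
    by (auto simp: \<Omega>_def tame_def)
  then show ?thesis
    by (auto intro!: closed_Int closed_INT closed_Un closed_Collect_le closed_trace_surface
        continuous_intros continuous_xs continuous_ys)
qed

lemma finite_valid: "finite {a. valid a}"
proof -
  have "{a. valid a} \<subseteq> (\<Union>s\<in>{1, -1}. \<Union>j\<in>{-2, -1, 0, 1, 2}. {XL s j, YL s j, ZL s j})"
  proof
    fix a assume "a \<in> {a. valid a}"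
    then show "a \<in> (\<Union>s\<in>{1, -1}. \<Union>j\<in>{-2, -1, 0, 1, 2}. {XL s j, YL s j, ZL s j})"
      by (cases a) auto
  qed
  then show ?thesis by (rule finite_subset) simp
qed

definition itinerary :: "real \<times> real \<times> real \<Rightarrow> int \<Rightarrow> state" where
  "itinerary p n = (THE a. valid a \<and> region (xs p) (ys p) n a)"

context
  fixes V :: real assumes V: "V \<ge> 1000"
begin

lemma itinerary_iff:
  assumes "p \<in> \<Omega> V"
  shows "itinerary p n = a \<longleftrightarrow> valid a \<and> region (xs p) (ys p) n a"
proof -
  interpret tame_point V p by (rule tame_point_\<Omega>[OF V assms])
  obtain b where b: "valid b" "region (xs p) (ys p) n b" using o.ex_region by blast
  then have "itinerary p n = b"
    unfolding itinerary_def using o.region_unique by (intro the_equality) blast+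
  then show ?thesis using b o.region_unique by blast
qed

lemma itinerary_region:
  assumes "p \<in> \<Omega> V" shows "valid (itinerary p n)" "region (xs p) (ys p) n (itinerary p n)"
  using itinerary_iff[OF assms] by blast+

lemma admissible_itinerary:
  assumes "p \<in> \<Omega> V" shows "admissible (itinerary p)"
proof -
  interpret tame_point V p by (rule tame_point_\<Omega>[OF V assms])
  show ?thesis unfolding admissible_def using itinerary_region[OF assms] o.region_edge by blast
qed

lemma itinerary_tz:
  assumes "p \<in> \<Omega> V" shows "itinerary (tz k p) n = itinerary p (n + k)"
  using itinerary_region[OF assms] by (simp add: itinerary_iff[OF tz_\<Omega>[OF assms]] region_tz)

lemma itinerary_inj:
  assumes p: "p \<in> \<Omega> V" and q: "q \<in> \<Omega> V" and eq: "itinerary p = itinerary q" shows "p = q"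
proof -
  interpret p: tame_point V p by (rule tame_point_\<Omega>[OF V p])
  interpret q: tame_point V q by (rule tame_point_\<Omega>[OF V q])
  interpret twin_orbits V "xs p" "ys p" "xs q" "ys q"
  proof
    fix n
    show "\<exists>a. valid a \<and> region (xs p) (ys p) n a \<and> region (xs q) (ys q) n a"
      using itinerary_region[OF p, of n] itinerary_region[OF q, of n] eq by auto
  qed
  have "tz 0 p = tz 0 q" unfolding tz_eq by (simp only: coincide)
  then show ?thesis by simp
qed

lemma itinerary_surj:
  assumes "admissible a" shows "\<exists>p\<in>\<Omega> V. itinerary p = a"
proof -
  obtain p where p: "p \<in> trace_surface V" "\<And>k. region (xs p) (ys p) k (a k)"
    using realisation[OF V assms] by blast
  then have "p \<in> \<Omega> V"
    using tame_of_regions[OF orbit_xs_ys[OF p(1)]] by (auto simp: \<Omega>_def)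
  moreover have "itinerary p k = a k" for k
    using itinerary_iff[OF \<open>p \<in> \<Omega> V\<close>] p(2) assms by (auto simp: admissible_def)
  ultimately show ?thesis by blast
qed

lemma compact_\<Omega>: "compact (\<Omega> V)"
proof -
  have "compact (\<Union>a\<in>{a. valid a}. {p \<in> trace_surface V. region (xs p) (ys p) 0 a})"
    by (intro compact_UN finite_valid compact_region V) simp
  moreover have "\<Omega> V \<subseteq> (\<Union>a\<in>{a. valid a}. {p \<in> trace_surface V. region (xs p) (ys p) 0 a})"
  proof
    fix p assume p: "p \<in> \<Omega> V"
    then have "p \<in> trace_surface V" by (simp add: \<Omega>_def)
    then show "p \<in> (\<Union>a\<in>{a. valid a}. {p \<in> trace_surface V. region (xs p) (ys p) 0 a})"
      using itinerary_region[OF p, of 0] by (intro UN_I[of "itinerary p 0"]) simp_all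
  qed
  ultimately show ?thesis
    using compact_Int_closed[OF _ closed_\<Omega>[of V]] Int_absorb1 by (metis (no_types, lifting))
qed

lemma closed_cylinder: "closed {p \<in> \<Omega> V. itinerary p n = a}"
proof (cases "valid a")
  case True
  have "p \<in> {p \<in> \<Omega> V. itinerary p n = a} \<longleftrightarrow> p \<in> \<Omega> V \<inter> {p. region (xs p) (ys p) n a}" for p
    using itinerary_iff[of p n a] True by auto
  then have "{p \<in> \<Omega> V. itinerary p n = a} = \<Omega> V \<inter> {p. region (xs p) (ys p) n a}"
    by (rule set_eqI)
  then show ?thesis by (simp add: closed_Int closed_\<Omega> closed_region)
next
  case False
  then have "{p \<in> \<Omega> V. itinerary p n = a} = {}" using itinerary_region(1) by blast
  then show ?thesis by (simp only: closed_empty)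
qed

text \<open>Finitely many states exist, so the complement is a finite union of closed cylinders.
  Cylinders are thus clopen in \<open>\<Omega> V\<close>.\<close>

lemma closed_complement_cylinder: "closed {p \<in> \<Omega> V. itinerary p n \<noteq> a}"
proof -
  have "{p \<in> \<Omega> V. itinerary p n \<noteq> a} = (\<Union>b\<in>{b. valid b} - {a}. {p \<in> \<Omega> V. itinerary p n = b})"
    using itinerary_region(1) by blast
  then show ?thesis using finite_valid closed_cylinder by auto
qed

text \<open>Otherwise points outside \<open>U\<close> would agree with \<open>p\<close> on longer
  and longer windows; by compactness one of them has the full itinerary of \<open>p\<close> and
  equals \<open>p\<close>.\<close>

lemma cylinder_neighbourhood:
  assumes U: "openin (top_of_set (\<Omega> V)) U" "p \<in> U"
  shows "\<exists>N\<ge>1. \<forall>q\<in>\<Omega> V. (\<forall>k\<in>{- N..N}. itinerary q k = itinerary p k) \<longrightarrow> q \<in> U"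
proof (rule ccontr)
  assume no: "\<not> ?thesis"
  obtain T where T: "open T" "U = \<Omega> V \<inter> T" using U unfolding openin_open by blast
  define K where "K N = (\<Omega> V - T) \<inter> (\<Inter>k\<in>{- int (Suc N)..int (Suc N)}. {q \<in> \<Omega> V. itinerary q k = itinerary p k})" for N
  have "compact (K N)" for N
    unfolding K_def by (intro compact_Int_closed compact_diff compact_\<Omega> T closed_INT ballI closed_cylinder)
  moreover have "K N \<noteq> {}" for N
  proof -
    have "1 \<le> int (Suc N)" by simp
    then obtain q where "q \<in> \<Omega> V" "\<forall>k\<in>{- int (Suc N)..int (Suc N)}. itinerary q k = itinerary p k" "q \<notin> U"
      using no by blast
    then have "q \<in> K N" by (auto simp: K_def T)
    then show ?thesis by blast
  qed
  moreover have "K M \<subseteq> K N" if "N \<le> M" for M N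
    using that by (auto simp: K_def)
  ultimately have "\<Inter>(range K) \<noteq> {}" by (intro compact_nest)
  then obtain q where q: "\<And>N. q \<in> K N" by blast
  have "itinerary q k = itinerary p k" for k
  proof -
    have "k \<in> {- int (Suc (nat \<bar>k\<bar>))..int (Suc (nat \<bar>k\<bar>))}" by auto
    then show ?thesis using q[of "nat \<bar>k\<bar>"] unfolding K_def by blast
  qed
  moreover have "q \<in> \<Omega> V" "q \<notin> T" using q[of 0] by (auto simp: K_def)
  moreover have "p \<in> \<Omega> V" using U T by blast
  ultimately have "q = p" by (intro itinerary_inj) auto
  then show False using \<open>q \<notin> T\<close> U T by blast
qed

end

section \<open>Mixing of the symbolic dynamics\<close>

definition edges :: "state rel" where
  "edges = {(a, b). valid a \<and> valid b \<and> edge a b}"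

text \<open>Every state reaches \<open>XL 1 0\<close> and is reached from it, which gives
  transitivity without treating all pairs of states.\<close>

lemma reach_hub: "valid a \<Longrightarrow> (a, XL 1 0) \<in> edges\<^sup>*"
proof -
  have "(XL (- 1) 0, XL 1 0) \<in> edges" by (simp add: edges_def)
  then have X0: "(XL s 0, XL 1 0) \<in> edges\<^sup>*" if "s \<in> {1, -1}" for s
    using that by (elim insertE emptyE) (simp_all add: r_into_rtrancl)
  have Z1: "(ZL s i, XL 1 0) \<in> edges\<^sup>*" if "s \<in> {1, -1}" "i \<in> {1, -1}" for s i
  proof (rule converse_rtrancl_into_rtrancl)
    show "(ZL s i, XL (- (s * i)) 0) \<in> edges" using that by (auto simp: edges_def)
    show "(XL (- (s * i)) 0, XL 1 0) \<in> edges\<^sup>*" using that by (intro X0) auto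
  qed
  have Y1: "(YL s 1, XL 1 0) \<in> edges\<^sup>*" if "s \<in> {1, -1}" for s
    using that by (intro converse_rtrancl_into_rtrancl[OF _ Z1[of s 1]]) (auto simp: edges_def)
  have Z: "(ZL s i, XL 1 0) \<in> edges\<^sup>*" if v: "valid (ZL s i)" for s i
  proof -
    consider "i \<in> {1, -1}" | "i = 0" | "i \<in> {2, -2}" using v by auto
    then show ?thesis
    proof cases
      case 1 then show ?thesis using Z1 v by auto
    next
      case 2 then show ?thesis
        using v by (intro converse_rtrancl_into_rtrancl[OF _ Y1[of "- s"]]) (auto simp: edges_def)
    next
      case 3 then show ?thesis
        using v by (intro converse_rtrancl_into_rtrancl[OF _ Y1[of s]]) (auto simp: edges_def)
    qed
  qed
  have Y: "(YL s i, XL 1 0) \<in> edges\<^sup>*" if v: "valid (YL s i)" for s i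
    using v by (intro converse_rtrancl_into_rtrancl[OF _ Z[of s i]]) (auto simp: edges_def)
  have X: "(XL s i, XL 1 0) \<in> edges\<^sup>*" if v: "valid (XL s i)" for s i
  proof (cases "i = 0")
    case False
    then show ?thesis
      using v by (intro converse_rtrancl_into_rtrancl[OF _ Y[of "s * i" 0]]) (auto simp: edges_def)
  qed (use X0 v in auto)
  show "valid a \<Longrightarrow> (a, XL 1 0) \<in> edges\<^sup>*" using X Y Z by (cases a) auto
qed

lemma reach_from_hub: "valid b \<Longrightarrow> (XL 1 0, b) \<in> edges\<^sup>*"
proof -
  have X: "(XL 1 0, XL s j) \<in> edges\<^sup>*" if v: "valid (XL s j)" for s j
  proof (cases "s = 1")
    case True
    have "(XL 1 0, XL (- 1) 0) \<in> edges" "(XL (- 1) 0, XL s j) \<in> edges" using v True by (auto simp: edges_def)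
    then show ?thesis by auto
  next
    case False
    then show ?thesis using v by (auto simp: edges_def intro!: r_into_rtrancl)
  qed
  have Y: "(XL 1 0, YL s j) \<in> edges\<^sup>*" if v: "valid (YL s j)" for s j
    using v by (intro rtrancl_into_rtrancl[OF X[of s 1]]) (auto simp: edges_def)
  have Z: "(XL 1 0, ZL s j) \<in> edges\<^sup>*" if v: "valid (ZL s j)" for s j
    using v by (intro rtrancl_into_rtrancl[OF Y[of s j]]) (auto simp: edges_def)
  show "valid b \<Longrightarrow> (XL 1 0, b) \<in> edges\<^sup>*" using X Y Z by (cases b) auto
qed

lemma reach: "valid a \<Longrightarrow> valid b \<Longrightarrow> (a, b) \<in> edges\<^sup>*"
  using reach_hub reach_from_hub by (metis rtrancl_trans)

lemma extend_ray:
  assumes "(c, d) \<in> edges\<^sup>*" "f 0 = d" "\<And>i. (f i, f (Suc i)) \<in> edges"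
  shows "\<exists>u m. u 0 = c \<and> (\<forall>i. (u i, u (Suc i)) \<in> edges) \<and> (\<forall>i. u (m + i) = f i)"
  using assms(1)
proof (induction rule: converse_rtrancl_induct)
  case base
  then show ?case using assms(2,3) by (intro exI[of _ f] exI[of _ 0]) auto
next
  case (step b c')
  then obtain u m where u: "u 0 = c'" "\<And>i. (u i, u (Suc i)) \<in> edges" "\<And>i. u (m + i) = f i" by blast
  define u' where "u' = case_nat b u"
  have "u' 0 = b" "\<And>i. u' (Suc m + i) = f i" using u by (simp_all add: u'_def)
  moreover have "(u' i, u' (Suc i)) \<in> edges" for i
    using u step.hyps by (cases i) (simp_all add: u'_def)
  ultimately show ?case by blast
qed

definition glue :: "(int \<Rightarrow> state) \<Rightarrow> int \<Rightarrow> (nat \<Rightarrow> state) \<Rightarrow> int \<Rightarrow> state" where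
  "glue a N u n = (if n \<le> N then a n else u (nat (n - N)))"

lemma admissible_glue:
  assumes a: "admissible a" and u: "u 0 = a N" "\<And>i. (u i, u (Suc i)) \<in> edges"
  shows "admissible (glue a N u)"
proof -
  have "(glue a N u n, glue a N u (n + 1)) \<in> edges" for n
  proof -
    consider "n < N" | "N \<le> n" by linarith
    then show ?thesis
    proof cases
      case 1
      then show ?thesis using a by (auto simp: glue_def edges_def admissible_def)
    next
      case 2
      then have "glue a N u n = u (nat (n - N))" "glue a N u (n + 1) = u (Suc (nat (n - N)))"
        using u(1) by (auto simp: glue_def Suc_nat_eq_nat_zadd1 algebra_simps)
      then show ?thesis using u(2) by simp
    qed
  qed
  then show ?thesis by (auto simp: admissible_def edges_def)
qed

lemma glue_right: "u 0 = a N \<Longrightarrow> glue a N u (N + int i) = u i"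
  by (auto simp: glue_def)

text \<open>Follow \<open>a\<close> up to \<open>N\<close>, walk back to the state
  \<open>a (- N)\<close>, and follow \<open>a\<close> again from there: the window is repeated after
  a delay of \<open>m + 2 * N\<close>, where \<open>m\<close> is the length of the walk.\<close>

lemma recurrent_admissible:
  assumes a: "admissible a" and N: "N \<ge> 1"
  shows "\<exists>b m. admissible b \<and> m \<ge> 1 \<and> (\<forall>n\<in>{- N..N}. b n = a n) \<and> (\<forall>n\<in>{- N..N}. b (n + int m) = a n)"
proof -
  have "(a N, a (- N)) \<in> edges\<^sup>*" using a by (intro reach) (auto simp: admissible_def)
  moreover have "(a (- N + int i), a (- N + int (Suc i))) \<in> edges" for i
    using a[unfolded admissible_def, rule_format, of "- N + int i"] a[unfolded admissible_def, rule_format, of "- N + int (Suc i)"]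
    by (simp add: edges_def add.commute add.left_commute)
  ultimately obtain u m where u: "u 0 = a N" "\<And>i. (u i, u (Suc i)) \<in> edges" "\<And>i. u (m + i) = a (- N + int i)"
    using extend_ray[of "a N" "a (- N)" "\<lambda>i. a (- N + int i)"] by auto
  define M where "M = m + nat (2 * N)"
  have "glue a N u (n + int M) = a n" if "n \<in> {- N..N}" for n
  proof -
    have "n + int M = N + int (m + nat (n + N))" using that N by (simp add: M_def)
    then have "glue a N u (n + int M) = u (m + nat (n + N))" using glue_right[of u a N, OF u(1)] by metis
    also have "\<dots> = a n" using u(3) that by simp
    finally show ?thesis .
  qed
  moreover have "admissible (glue a N u)" by (rule admissible_glue[OF a u(1,2)])
  moreover have "glue a N u n = a n" if "n \<in> {- N..N}" for n using that by (simp add: glue_def)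
  moreover have "M \<ge> 1" using N by (simp add: M_def)
  ultimately show ?thesis by blast
qed

lemma branching_admissible:
  assumes a: "admissible a"
  shows "\<exists>b. admissible b \<and> b \<noteq> a \<and> (\<forall>n\<le>N. b n = a n)"
proof -
  \<comment> \<open>Two tails that never share a state, one made of \<open>XL\<close> only and one
    of \<open>YL\<close> and \<open>ZL\<close>. Hence the two continuations differ, and at least one
    of them differs from \<open>a\<close>.\<close>
  define f where "f i = XL (if even i then 1 else - 1) 0" for i :: nat
  define g where "g i = (if even i then YL 1 2 else ZL 1 2)" for i :: nat
  have f: "(f i, f (Suc i)) \<in> edges" for i by (auto simp: f_def edges_def)
  have g: "(g i, g (Suc i)) \<in> edges" for i by (auto simp: g_def edges_def)
  have aN: "valid (a N)" using a by (simp add: admissible_def)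
  have "(a N, f 0) \<in> edges\<^sup>*" using reach[OF aN] f[of 0] by (simp add: edges_def)
  from extend_ray[OF this refl f] obtain u m where
    u: "u 0 = a N" "\<And>i. (u i, u (Suc i)) \<in> edges" "\<And>i. u (m + i) = f i" by blast
  have "(a N, g 0) \<in> edges\<^sup>*" using reach[OF aN] g[of 0] by (simp add: edges_def)
  from extend_ray[OF this refl g] obtain w k where
    w: "w 0 = a N" "\<And>i. (w i, w (Suc i)) \<in> edges" "\<And>i. w (k + i) = g i" by blast
  \<comment> \<open>Both connecting paths are over at step \<open>m + k\<close>, whichever is
    longer.\<close>
  have "glue a N u (N + int (m + k)) = f k" using glue_right[of u a N "m + k"] u by simp
  moreover have "glue a N w (N + int (m + k)) = g m" using glue_right[of w a N "k + m"] w by (simp add: add.commute)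
  moreover have "f k \<noteq> g m" by (auto simp: f_def g_def)
  ultimately have "glue a N u \<noteq> a \<or> glue a N w \<noteq> a" by metis
  moreover have "admissible (glue a N u)" "admissible (glue a N w)" using admissible_glue[OF a] u w by blast+
  moreover have "glue a N u n = a n" "glue a N w n = a n" if "n \<le> N" for n using that by (simp_all add: glue_def)
  ultimately show ?thesis by metis
qed

section \<open>The non-wandering set\<close>

lemma \<Omega>_nonempty: "V \<ge> 1000 \<Longrightarrow> \<Omega> V \<noteq> {}"
proof -
  assume V: "V \<ge> 1000"
  have "admissible (\<lambda>n. XL (if even n then 1 else - 1) 0)" by (auto simp: admissible_def)
  then show "\<Omega> V \<noteq> {}" using itinerary_surj[OF V] by blast
qed

lemma \<Omega>_not_isolated:
  assumes V: "V \<ge> 1000" and U: "openin (top_of_set (\<Omega> V)) U" "p \<in> U"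
  shows "\<exists>q\<in>U. q \<noteq> p"
proof -
  have p: "p \<in> \<Omega> V" using U openin_imp_subset by blast
  obtain N where N: "\<And>q. q \<in> \<Omega> V \<Longrightarrow> (\<forall>k\<in>{- N..N}. itinerary q k = itinerary p k) \<Longrightarrow> q \<in> U"
    using cylinder_neighbourhood[OF V U] by blast
  obtain b where b: "admissible b" "b \<noteq> itinerary p" "\<And>n. n \<le> N \<Longrightarrow> b n = itinerary p n"
    using branching_admissible[OF admissible_itinerary[OF V p], of N] by blast
  obtain q where "q \<in> \<Omega> V" "itinerary q = b" using itinerary_surj[OF V b(1)] by blast
  then have "q \<in> U" "q \<noteq> p" using N[of q] b by auto
  then show ?thesis by blast
qed

lemma \<Omega>_homeomorphic_cantor_set:
  assumes V: "V \<ge> 1000" shows "\<Omega> V homeomorphic cantor_set"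
proof -
  obtain enum :: "nat \<Rightarrow> int \<times> state" where enum: "range enum = UNIV \<times> {a. valid a}"
  proof -
    have "(0, XL 1 0) \<in> (UNIV :: int set) \<times> {a. valid a}" by simp
    then have ne: "(UNIV :: int set) \<times> {a. valid a} \<noteq> {}" by blast
    have cnt: "countable ((UNIV :: int set) \<times> {a. valid a})"
      by (intro countable_SIGMA countableI_type countable_finite finite_valid)
    show ?thesis by (rule that[OF range_from_nat_into[OF ne cnt]])
  qed
  define D where "D k = {p \<in> \<Omega> V. itinerary p (fst (enum k)) = snd (enum k)}" for k
  have "\<Omega> V homeomorphic range (\<lambda>b (n::nat). of_bool (b n) :: real)"
  proof (rule homeomorphic_binary_sequences[of _ D])
    fix k
    have "\<Omega> V \<inter> D k = \<Omega> V \<inter> - {p \<in> \<Omega> V. itinerary p (fst (enum k)) \<noteq> snd (enum k)}"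
      by (auto simp: D_def)
    moreover have "open (- {p \<in> \<Omega> V. itinerary p (fst (enum k)) \<noteq> snd (enum k)})"
      using closed_complement_cylinder[OF V] by (simp only: closed_def)
    ultimately show "openin (top_of_set (\<Omega> V)) (\<Omega> V \<inter> D k)" by (simp only: openin_open_Int)
    have "\<Omega> V - D k = \<Omega> V \<inter> - D k" by auto
    moreover have "open (- D k)" unfolding D_def using closed_cylinder[OF V] by (simp only: closed_def)
    ultimately show "openin (top_of_set (\<Omega> V)) (\<Omega> V - D k)" by (simp only: openin_open_Int)
  next
    fix p q assume p: "p \<in> \<Omega> V" and q: "q \<in> \<Omega> V" and "p \<noteq> q"
    then obtain n where n: "itinerary p n \<noteq> itinerary q n" using itinerary_inj[OF V p q] by blast
    have "(n, itinerary p n) \<in> range enum" using enum itinerary_region(1)[OF V p] by simp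
    then obtain k where k: "enum k = (n, itinerary p n)" by (elim imageE) simp
    have "p \<in> D k" "q \<notin> D k" using p n by (auto simp: D_def k)
    then show "\<exists>k. (p \<in> D k) \<noteq> (q \<in> D k)" by blast
  next
    show "compact (\<Omega> V)" by (rule compact_\<Omega>[OF V])
    show "\<Omega> V \<noteq> {}" by (rule \<Omega>_nonempty[OF V])
    show "\<exists>q\<in>U. q \<noteq> p" if "openin (top_of_set (\<Omega> V)) U" "p \<in> U" for U p
      by (rule \<Omega>_not_isolated[OF V that])
  qed
  then show ?thesis
    using cantor_set_homeomorphic_binary_sequences by (metis homeomorphic_sym homeomorphic_trans)
qed

text \<open>A point whose itinerary repeats the central window of \<open>p\<close> visits the given
  neighbourhood at times 0 and \<open>m\<close>.\<close>

lemma \<Omega>_subset_nonwandering: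
  assumes V: "V \<ge> 1000" shows "\<Omega> V \<subseteq> nonwandering_set (trace_surface V) trace_map"
proof
  fix p assume p: "p \<in> \<Omega> V"
  show "p \<in> nonwandering_set (trace_surface V) trace_map"
    unfolding nonwandering_set_def
  proof (intro CollectI conjI allI impI)
    show "p \<in> trace_surface V" using p by (simp add: \<Omega>_def)
    fix U assume U: "openin (top_of_set (trace_surface V)) U \<and> p \<in> U"
    obtain G where G: "open G" "U = trace_surface V \<inter> G" using U unfolding openin_open by blast
    have "\<Omega> V \<inter> U = \<Omega> V \<inter> G" by (auto simp: \<Omega>_def G)
    then have "openin (top_of_set (\<Omega> V)) (\<Omega> V \<inter> U)" using G(1) by (simp add: openin_open_Int)
    then obtain N where N: "N \<ge> 1"
      "\<And>q. q \<in> \<Omega> V \<Longrightarrow> (\<forall>k\<in>{- N..N}. itinerary q k = itinerary p k) \<Longrightarrow> q \<in> \<Omega> V \<inter> U"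
      using cylinder_neighbourhood[OF V, of "\<Omega> V \<inter> U" p] U p by blast
    obtain b m where b: "admissible b" "m \<ge> 1" "\<forall>n\<in>{- N..N}. b n = itinerary p n"
      "\<forall>n\<in>{- N..N}. b (n + int m) = itinerary p n"
      using recurrent_admissible[OF admissible_itinerary[OF V p] N(1)] by blast
    obtain q where q: "q \<in> \<Omega> V" "itinerary q = b" using itinerary_surj[OF V b(1)] by blast
    have "q \<in> U" using N(2)[of q] q b by auto
    moreover have "tz (int m) q \<in> U"
      using N(2)[of "tz (int m) q"] q b(4) tz_\<Omega>[OF q(1)] by (auto simp: itinerary_tz[OF V q(1)])
    ultimately show "\<exists>n\<ge>1. (trace_map ^^ n) ` U \<inter> U \<noteq> {}"
      using b(2) by (intro exI[of _ m]) (auto simp: zpow_of_nat)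
  qed
qed

section \<open>Orbits that are not tame wander\<close>

lemma growing_monotone:
  assumes o: "orbit V x y" and i: "growing (y (- 1)) (y 0) (x 0)"
  shows "\<bar>x 0\<bar> < \<bar>x 1\<bar>" "\<bar>x 1\<bar> \<le> \<bar>x (1 + int k)\<bar>"
proof -
  have inc: "growing (y (int k - 1)) (y (int k)) (x (int k))" for k
  proof (induction k)
    case (Suc k)
    then show ?case using growing_step(1)[OF o Suc] by (simp add: add.commute)
  qed (use i in simp)
  have step: "\<bar>x (int k)\<bar> < \<bar>x (1 + int k)\<bar>" for k
    using growing_step(2,3)[OF o inc[of k]] inc[of k] by (simp add: growing_def add.commute)
  show "\<bar>x 0\<bar> < \<bar>x 1\<bar>" using step[of 0] by simp
  show "\<bar>x 1\<bar> \<le> \<bar>x (1 + int k)\<bar>"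
  proof (induction k)
    case (Suc k)
    then show ?case using step[of "Suc k"] by (simp add: add.commute)
  qed simp
qed

lemma not_nonwanderingI:
  assumes "open G" "p \<in> G" "p \<in> M" "\<And>q n. q \<in> G \<inter> M \<Longrightarrow> n \<ge> 1 \<Longrightarrow> (f ^^ n) q \<notin> G"
  shows "p \<notin> nonwandering_set M f"
proof
  assume "p \<in> nonwandering_set M f"
  moreover have "openin (top_of_set M) (M \<inter> G)" using assms(1) by (rule openin_open_Int)
  ultimately obtain n where "n \<ge> 1" "(f ^^ n) ` (M \<inter> G) \<inter> (M \<inter> G) \<noteq> {}"
    using assms(2,3) unfolding nonwandering_set_def by blast
  then show False using assms(4) by blast
qed

lemma open_less_abs:
  fixes f g :: "'a::topological_space \<Rightarrow> real"
  assumes "continuous_on UNIV f"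
  shows "continuous_on UNIV g \<Longrightarrow> open {p. \<bar>f p\<bar> < \<bar>g p\<bar>}" "open {p. \<bar>f p\<bar> < c}" "open {p. c < \<bar>f p\<bar>}"
  using assms by (auto intro!: open_Collect_less continuous_intros)

text \<open>A level \<open>c\<close> strictly between the present and the next size of
  \<open>x\<close> defines a neighbourhood. Growth keeps |x| above \<open>c\<close> at all later
  times, so no point returns.\<close>

lemma escaping_forward_wanders:
  assumes q: "q \<in> trace_surface V" and i: "growing (ys q (- 1)) (ys q 0) (xs q 0)"
  shows "q \<notin> nonwandering_set (trace_surface V) trace_map"
proof -
  obtain c where c: "\<bar>xs q 0\<bar> < c" "c < \<bar>xs q 1\<bar>"
    using growing_monotone(1)[OF orbit_xs_ys[OF q] i] dense by blast
  define G where "G = {r. 3 < \<bar>ys r (- 1)\<bar>} \<inter> {r. \<bar>ys r (- 1)\<bar> < \<bar>ys r 0\<bar>} \<inter> {r. \<bar>ys r 0\<bar> < \<bar>xs r 0\<bar>}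
      \<inter> {r. \<bar>xs r 0\<bar> < c} \<inter> {r. c < \<bar>xs r 1\<bar>}"
  show ?thesis
  proof (rule not_nonwanderingI[of G, OF _ _ q])
    show "open G" unfolding G_def by (intro open_Int open_less_abs continuous_xs continuous_ys)
    show "q \<in> G" using i c by (auto simp: G_def growing_def)
    fix r and n :: nat assume r: "r \<in> G \<inter> trace_surface V" and n: "n \<ge> 1"
    then have inc: "growing (ys r (- 1)) (ys r 0) (xs r 0)" by (auto simp: G_def growing_def)
    have "\<bar>xs r 1\<bar> \<le> \<bar>xs r (1 + int (n - 1))\<bar>"
      using growing_monotone(2)[OF orbit_xs_ys inc] r by blast
    also have "xs r (1 + int (n - 1)) = xs ((trace_map ^^ n) r) 0"
      using n seq_tz(1)[of "int n" r 0] by (simp add: zpow_of_nat)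
    finally show "(trace_map ^^ n) r \<notin> G" using r by (auto simp: G_def)
  qed
qed

text \<open>Here the return point is the one examined: if it lies in the neighbourhood, its whole
  past has |x| above \<open>c\<close>, and the starting point belongs to that past.\<close>

lemma escaping_backward_wanders:
  assumes q: "q \<in> trace_surface V" and i: "growing (ys q 1) (ys q 0) (xs q 0)"
  shows "q \<notin> nonwandering_set (trace_surface V) trace_map"
proof -
  have mono: "\<bar>xs r 0\<bar> < \<bar>xs r (- 1)\<bar>" "\<bar>xs r (- 1)\<bar> \<le> \<bar>xs r (- 1 - int k)\<bar>"
    if "r \<in> trace_surface V" "growing (ys r 1) (ys r 0) (xs r 0)" for r k
    using growing_monotone(1)[OF orbit_reverse[OF orbit_xs_ys[OF that(1)]]]
      growing_monotone(2)[OF orbit_reverse[OF orbit_xs_ys[OF that(1)]], of k] that(2) by simp_all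
  obtain c where c: "\<bar>xs q 0\<bar> < c" "c < \<bar>xs q (- 1)\<bar>"
    using mono(1)[OF q i] dense by blast
  define G where "G = {r. 3 < \<bar>ys r 1\<bar>} \<inter> {r. \<bar>ys r 1\<bar> < \<bar>ys r 0\<bar>} \<inter> {r. \<bar>ys r 0\<bar> < \<bar>xs r 0\<bar>}
      \<inter> {r. \<bar>xs r 0\<bar> < c} \<inter> {r. c < \<bar>xs r (- 1)\<bar>}"
  show ?thesis
  proof (rule not_nonwanderingI[of G, OF _ _ q])
    show "open G" unfolding G_def by (intro open_Int open_less_abs continuous_xs continuous_ys)
    show "q \<in> G" using i c by (auto simp: G_def growing_def)
    fix r and n :: nat assume r: "r \<in> G \<inter> trace_surface V" and n: "n \<ge> 1"
    define r' where "r' = (trace_map ^^ n) r"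
    have r': "r' = tz (int n) r" by (simp add: r'_def zpow_of_nat)
    show "(trace_map ^^ n) r \<notin> G"
    proof
      assume "(trace_map ^^ n) r \<in> G"
      then have G: "r' \<in> G" by (simp add: r'_def)
      then have inc: "growing (ys r' 1) (ys r' 0) (xs r' 0)" by (auto simp: G_def growing_def)
      have "\<bar>xs r' (- 1)\<bar> \<le> \<bar>xs r' (- 1 - int (n - 1))\<bar>"
        using mono(2)[OF _ inc] r by (simp add: r')
      also have "xs r' (- 1 - int (n - 1)) = xs r 0" using n by (simp add: r' seq_tz)
      finally show False using r G by (auto simp: G_def)
    qed
  qed
qed

text \<open>Invariance of the nonwandering set permits moving to the time at which growth becomes
  visible.\<close>

lemma tz_nonwandering:
  assumes "p \<in> nonwandering_set (trace_surface V) trace_map"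
  shows "tz k p \<in> nonwandering_set (trace_surface V) trace_map"
  unfolding nonwandering_set_def
proof (intro CollectI conjI allI impI)
  have p: "p \<in> trace_surface V" using assms by (simp add: nonwandering_set_def)
  then show "tz k p \<in> trace_surface V" by simp
  fix U assume U: "openin (top_of_set (trace_surface V)) U \<and> tz k p \<in> U"
  then obtain G where G: "open G" "U = trace_surface V \<inter> G" unfolding openin_open by blast
  have "open (tz k -` G)" using open_vimage[OF G(1)] continuous_tz by blast
  then have "openin (top_of_set (trace_surface V)) (trace_surface V \<inter> tz k -` G)" by (rule openin_open_Int)
  moreover have "p \<in> trace_surface V \<inter> tz k -` G" using p U G by auto
  ultimately obtain n where n: "n \<ge> 1" "(trace_map ^^ n) ` (trace_surface V \<inter> tz k -` G) \<inter> (trace_surface V \<inter> tz k -` G) \<noteq> {}"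
    using assms unfolding nonwandering_set_def by blast
  then obtain q where "q \<in> trace_surface V \<inter> tz k -` G" "(trace_map ^^ n) q \<in> trace_surface V \<inter> tz k -` G"
    by blast
  then have q: "q \<in> trace_surface V" "tz k q \<in> G" "tz k ((trace_map ^^ n) q) \<in> G" by simp_all
  have "(trace_map ^^ n) (tz k q) = tz k ((trace_map ^^ n) q)"
    using tz_add[of "int n" k q] tz_add[of k "int n" q] by (simp add: zpow_of_nat add.commute)
  moreover have "tz (int n) (tz k q) \<in> trace_surface V" using q by simp
  ultimately have "(trace_map ^^ n) (tz k q) \<in> U" "tz k q \<in> U"
    using q G by (auto simp: zpow_of_nat)
  then show "\<exists>n\<ge>1. (trace_map ^^ n) ` U \<inter> U \<noteq> {}" using n(1) by blast
qed

lemma nonwandering_eq_\<Omega>: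
  assumes V: "V \<ge> 1000" shows "nonwandering_set (trace_surface V) trace_map = \<Omega> V"
proof (intro equalityI \<Omega>_subset_nonwandering[OF V] subsetI)
  fix p assume p: "p \<in> nonwandering_set (trace_surface V) trace_map"
  then have S: "p \<in> trace_surface V" by (simp add: nonwandering_set_def)
  show "p \<in> \<Omega> V"
  proof (rule ccontr)
    assume "p \<notin> \<Omega> V"
    then have "\<not> tame (xs p) (ys p)" using S by (simp add: \<Omega>_def)
    then obtain n where "growing (ys p (n - 1)) (ys p n) (xs p n) \<or> growing (ys p (n + 1)) (ys p n) (xs p n)"
      using not_tame_escapes[OF orbit_xs_ys[OF S]] by blast
    then have "growing (ys (tz n p) (- 1)) (ys (tz n p) 0) (xs (tz n p) 0) \<or>
        growing (ys (tz n p) 1) (ys (tz n p) 0) (xs (tz n p) 0)"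
      by (simp add: seq_tz add.commute)
    moreover have "tz n p \<in> nonwandering_set (trace_surface V) trace_map" by (rule tz_nonwandering[OF p])
    ultimately show False
      using escaping_forward_wanders[of "tz n p" V] escaping_backward_wanders[of "tz n p" V] S by auto
  qed
qed

section \<open>Local maximality, hyperbolicity and the conclusion\<close>

lemma iterate_on_trace_map:
  assumes "p \<in> trace_surface V" shows "iterate_on (trace_surface V) trace_map k p = tz k p"
proof (cases "k \<ge> 0")
  case False
  have inv: "inv_into (trace_surface V) trace_map q = trace_map_inv q" if "q \<in> trace_surface V" for q
  proof (rule inv_into_f_eq)
    show "inj_on trace_map (trace_surface V)" using bij_betw_trace_map by (rule bij_betw_imp_inj_on)
    show "trace_map_inv q \<in> trace_surface V"
      using that trace_map_in_trace_surface_iff[of "trace_map_inv q" V] by simp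
  qed simp
  have "(inv_into (trace_surface V) trace_map ^^ n) p = (trace_map_inv ^^ n) p \<and> (trace_map_inv ^^ n) p \<in> trace_surface V" for n
  proof (induction n)
    case (Suc n)
    then show ?case using inv trace_map_in_trace_surface_iff[of "trace_map_inv ((trace_map_inv ^^ n) p)" V] by simp
  qed (use assms in simp)
  then show ?thesis using False by (simp add: iterate_on_def zpow_def)
qed (simp add: iterate_on_def zpow_def)

lemma \<Omega>_locally_maximal: "locally_maximal (trace_surface V) trace_map (\<Omega> V)"
  unfolding locally_maximal_def
proof (intro exI conjI)
  \<comment> \<open>The conditions of \<open>tame\<close> at time 0, made open by relaxing 3 to 4.
    Nothing new survives: one step after growth sets in, in either time direction, both
    \<open>x\<close> and \<open>y\<close> exceed 6 in size and the orbit leaves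
    \<open>G\<close>.\<close>
  define G where "G = ({p. \<bar>xs p 0\<bar> < 4} \<union> {p. \<bar>ys p 0\<bar> < 4}) \<inter> ({p. \<bar>ys p 0\<bar> < 4} \<union> {p. \<bar>ys p (- 1)\<bar> < 4})"
  let ?U = "trace_surface V \<inter> G"
  have "open G" unfolding G_def by (intro open_Int open_Un open_less_abs continuous_xs continuous_ys)
  then show "openin (top_of_set (trace_surface V)) ?U" by (rule openin_open_Int)
  show sub: "\<Omega> V \<subseteq> ?U"
  proof
    fix p assume "p \<in> \<Omega> V"
    then have "p \<in> trace_surface V" "(\<bar>xs p 0\<bar> \<le> 3 \<or> \<bar>ys p 0\<bar> \<le> 3) \<and> (\<bar>ys p 0\<bar> \<le> 3 \<or> \<bar>ys p (0 - 1)\<bar> \<le> 3)"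
      unfolding \<Omega>_def tame_def by blast+
    then show "p \<in> ?U" by (auto simp: G_def)
  qed
  have img: "p \<in> iterate_on (trace_surface V) trace_map k ` ?U \<longleftrightarrow> tz (- k) p \<in> ?U" for p k
  proof
    assume "p \<in> iterate_on (trace_surface V) trace_map k ` ?U"
    then obtain q where "q \<in> ?U" "p = tz k q" using iterate_on_trace_map by auto
    then show "tz (- k) p \<in> ?U" by (simp add: tz_inverse)
  next
    assume *: "tz (- k) p \<in> ?U"
    then have "p = iterate_on (trace_surface V) trace_map k (tz (- k) p)"
      using iterate_on_trace_map[of "tz (- k) p" V k] by (simp add: tz_inverse)
    then show "p \<in> iterate_on (trace_surface V) trace_map k ` ?U" using * by blast
  qed
  show "\<Omega> V = (\<Inter>k. iterate_on (trace_surface V) trace_map k ` ?U)"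
  proof (intro equalityI subsetI)
    fix p assume "p \<in> \<Omega> V"
    then have "tz (- k) p \<in> ?U" for k using tz_\<Omega> sub by blast
    then show "p \<in> (\<Inter>k. iterate_on (trace_surface V) trace_map k ` ?U)" using img by blast
  next
    fix p assume "p \<in> (\<Inter>k. iterate_on (trace_surface V) trace_map k ` ?U)"
    then have "tz (- k) p \<in> ?U" for k using img by blast
    from this[of "- _"] have U: "tz k p \<in> ?U" for k by simp
    then have S: "p \<in> trace_surface V" by simp
    note o = orbit_xs_ys[OF S]
    have "\<not> (4 \<le> \<bar>xs p k\<bar> \<and> 4 \<le> \<bar>ys p k\<bar>)" for k
      using U[of k] by (auto simp: G_def seq_tz)
    moreover have "4 \<le> \<bar>xs p (n + 1)\<bar> \<and> 4 \<le> \<bar>ys p (n + 1)\<bar>" if "growing (ys p (n - 1)) (ys p n) (xs p n)" for n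
      using growing_step(2,3)[OF o that] that by (auto simp: growing_def)
    moreover have "4 \<le> \<bar>xs p (n - 1)\<bar> \<and> 4 \<le> \<bar>ys p (n - 1)\<bar>" if i: "growing (ys p (n + 1)) (ys p n) (xs p n)" for n
    proof -
      have "growing (ys p (- (- n - 1))) (ys p (- (- n))) (xs p (- (- n)))" using i by (simp add: add.commute)
      from growing_step(2,3)[OF orbit_reverse[OF o] this] i show ?thesis by (auto simp: growing_def)
    qed
    ultimately have "tame (xs p) (ys p)" using not_tame_escapes[OF o] by metis
    then show "p \<in> \<Omega> V" using S by (simp add: \<Omega>_def)
  qed
qed

lemma \<Omega>_hyperbolic:
  assumes V: "V \<ge> 1000" shows "hyperbolic_set (trace_surface V) trace_map (\<Omega> V)"
proof -
  define C where "C = 180 * (V + 4) * V\<^sup>2"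
  have one: "tz 1 p = trace_map p" for p using tz_Suc[of 0 p] by simp
  have split: "\<forall>p\<in>\<Omega> V. subspace (Eu p) \<and> subspace (Es p) \<and> Eu p \<inter> Es p = {0} \<and>
      {u + s |u s. u \<in> Eu p \<and> s \<in> Es p} = tangent_space (trace_surface V) p \<and>
      frechet_derivative trace_map (at p) ` Eu p = Eu (trace_map p) \<and>
      frechet_derivative trace_map (at p) ` Es p = Es (trace_map p)"
  proof (intro ballI conjI)
    fix p assume p: "p \<in> \<Omega> V"
    interpret tame_point V p by (rule tame_point_\<Omega>[OF V p])
    show "subspace (Eu p)" "subspace (Es p)" by (rule subspace_Eu subspace_Es)+
    show "Eu p \<inter> Es p = {0}" by (rule Es_Int_Eu)
    show "{u + s |u s. u \<in> Eu p \<and> s \<in> Es p} = tangent_space (trace_surface V) p"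
      unfolding splitting using V by (simp add: tangent_space_trace_surface[OF surface])
    show "frechet_derivative trace_map (at p) ` Eu p = Eu (trace_map p)"
      "frechet_derivative trace_map (at p) ` Es p = Es (trace_map p)"
      using image_Eu[of p 1] image_Es[of p 1] by (simp_all add: frechet_derivative_trace_map one)
  qed
  have rates: "\<forall>p\<in>\<Omega> V. \<forall>n.
      (\<forall>v\<in>Es p. norm (frechet_derivative (trace_map ^^ n) (at p) v) \<le> C / 2 ^ n * norm v) \<and>
      (\<forall>v\<in>Eu p. norm (frechet_derivative (trace_map ^^ n) (at p) v) \<ge> 2 ^ n / C * norm v)"
  proof (intro ballI allI conjI)
    fix p n v assume p: "p \<in> \<Omega> V"
    interpret tame_point V p by (rule tame_point_\<Omega>[OF V p])
    show "norm (frechet_derivative (trace_map ^^ n) (at p) v) \<le> C / 2 ^ n * norm v"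
      if "v \<in> Es p" using Es_contracts[OF that, of n] by (simp only: frechet_derivative_funpow C_def)
    show "2 ^ n / C * norm v \<le> norm (frechet_derivative (trace_map ^^ n) (at p) v)"
      if "v \<in> Eu p" using Eu_expands[OF that, of n] by (simp only: frechet_derivative_funpow C_def)
  qed
  have "closedin (top_of_set (trace_surface V)) (\<Omega> V)"
    using closed_\<Omega> by (intro closed_subset) (auto simp: \<Omega>_def)
  moreover have "trace_map ` \<Omega> V = \<Omega> V"
  proof (intro equalityI subsetI)
    fix p assume "p \<in> \<Omega> V"
    then have "tz (- 1) p \<in> \<Omega> V" by (rule tz_\<Omega>)
    moreover have "trace_map (tz (- 1) p) = p" using tz_inverse(2)[of 1 p] by (simp add: one)
    ultimately show "p \<in> trace_map ` \<Omega> V" by (metis imageI)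
  next
    fix p assume "p \<in> trace_map ` \<Omega> V"
    then obtain q where "p = tz 1 q" "q \<in> \<Omega> V" using one by auto
    then show "p \<in> \<Omega> V" using tz_\<Omega> by blast
  qed
  moreover have "C > 0" using V by (simp add: C_def)
  then have "\<exists>C>0. \<exists>\<mu>>1. \<forall>p\<in>\<Omega> V. \<forall>n.
      (\<forall>v\<in>Es p. norm (frechet_derivative (trace_map ^^ n) (at p) v) \<le> C / \<mu> ^ n * norm v) \<and>
      (\<forall>v\<in>Eu p. norm (frechet_derivative (trace_map ^^ n) (at p) v) \<ge> \<mu> ^ n / C * norm v)"
    using rates by (intro exI[of _ C] exI[of _ "2::real"] conjI) simp_all
  ultimately show ?thesis unfolding hyperbolic_set_def using split by blast
qed

theorem theorem1:
  shows "\<exists>V0>0. \<forall>V>V0.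
    hyperbolic_set (trace_surface V) trace_map (nonwandering_set (trace_surface V) trace_map) \<and>
    locally_maximal (trace_surface V) trace_map (nonwandering_set (trace_surface V) trace_map) \<and>
    nonwandering_set (trace_surface V) trace_map homeomorphic cantor_set"
proof (intro exI[of _ 1000] conjI allI impI)
  fix V :: real assume "V > 1000"
  then have V: "V \<ge> 1000" by simp
  show "hyperbolic_set (trace_surface V) trace_map (nonwandering_set (trace_surface V) trace_map)"
    "locally_maximal (trace_surface V) trace_map (nonwandering_set (trace_surface V) trace_map)"
    "nonwandering_set (trace_surface V) trace_map homeomorphic cantor_set"
    using \<Omega>_hyperbolic[OF V] \<Omega>_locally_maximal \<Omega>_homeomorphic_cantor_set[OF V]
    by (simp_all add: nonwandering_eq_\<Omega>[OF V])
qed simp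

end
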